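(* Let $D_a>0$, $L>0$. $\alpha$) For all $\gamma<0$, $$\mathcal{F}\subseteq\mathcal{E}\quad\text{and}\quad\mathcal{F}\setminus(\mathrm{L}^2(0,L))_-\ne\emptyset,$$ where $$\mathcal{E}:=\{e\in\mathrm{L}^2(0,L):\exists\,\omega\ge0,\ \forall\lambda>\omega,\ \forall m\in\mathbb{N}\setminus\{0\},\ (R(\lambda,SA_\gamma S^{-1})^me)(0)\le0\},$$ $$\mathcal{F}:=\bigcup_{I\subset\mathbb{N}\setminus\{0\},\ |I|<\infty}\Big\{\sum_{i\in I}a_i\phi_i:(a_i)_{i\in I}\in\Gamma_I^1\cap\Gamma_I^2\Big\},$$ with, for every finite $I\subset\mathbb{N}\setminus\{0\}$, $$\Gamma_I^1:=\Big\{(a_i)_{i\in I}\in\mathbb{R}^{|I|}:\sum_{i\in I}a_ic_i\le0\Big\},\qquad \Gamma_I^2:=\Big\{(a_i)_{i\in I}\in\mathbb{R}^{|I|}:\min_{i\in I:\,a_i<0}\lambda_i>\max_{i\in I:\,a_i>0}\lambda_i\Big\},$$ and where $\lambda_i$ (resp. $\phi_i$), $i\in\mathbb{N}\setminus\{0\}$, are the eigenvalues (resp. normalized eigenfunctions) of $SA_\gamma S^{-1}$, that is, $\lambda_i=-D_a\mu_i^2$ and $\phi_i(z)=c_i\cos(\mu_iz)$, $z\in[0,L]$, with $\mu_i$ the $i$-th (positive) solution of $-\frac{\gamma}{\mu_i}=\tan(\mu_iL)$ and $c_i>0$. $\beta$) For all $\kappa<0$ and $\gamma<0$ with $\kappa\neq\gamma$,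 and every $e_0\in\mathcal{F}\cup(\mathrm{L}^2(0,L))_-$, the mild solution of $$\frac{\mathrm{d}}{\mathrm{d}t}\begin{pmatrix}x(t)\\ e(t)\end{pmatrix}=\tilde A_{\kappa\gamma}\begin{pmatrix}x(t)\\ e(t)\end{pmatrix},\qquad \begin{pmatrix}x(0)\\ e(0)\end{pmatrix}=\begin{pmatrix}x_0\\ e_0\end{pmatrix},$$ belongs to $\mathrm{L}^2(0,L)_+\times\mathrm{L}^2(0,L)$ at every time $t\ge0$, for all $x_0\in\mathrm{L}^2(0,L)_+$.
   Context: $\mathrm{L}^2(0,L)_+$ (resp. $(\mathrm{L}^2(0,L))_-$) is the cone of a.e. nonnegative (resp. nonpositive) functions. $SA_\gamma S^{-1}$ (with $(Sx)(z)=x(L-z)$) is the operator $D_a\frac{\mathrm{d}^2}{\mathrm{d}z^2}$ on $\mathrm{L}^2(0,L)$ with domain $\{e\in\mathrm{H}^2(0,L):\frac{\mathrm{d}e}{\mathrm{d}z}(0)=0,\ \frac{\mathrm{d}e}{\mathrm{d}z}(L)=\gamma e(L)\}$. $R(\lambda,A)=(\lambda I-A)^{-1}$ denotes the resolvent operator; values at $z=0$ make sense since the range of $R(\lambda,SA_\gamma S^{-1})$ consists of continuous functions on $[0,L]$. $\tilde A_{\kappa\gamma}$ is the operator on $\mathrm{L}^2(0,L)\times\mathrm{L}^2(0,L)$ given by $\tilde A_{\kappa\gamma}(x,e)=\left(D_a\frac{\mathrm{d}^2x}{\mathrm{d}z^2},D_a\frac{\mathrm{d}^2e}{\mathrm{d}z^2}\right)$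 with domain the set of $(x,e)\in\mathrm{H}^2(0,L)\times\mathrm{H}^2(0,L)$ such that $\frac{\mathrm{d}x}{\mathrm{d}z}(0)=-\kappa x(0)-\kappa e(0)$, $\frac{\mathrm{d}e}{\mathrm{d}z}(0)=0$, $\frac{\mathrm{d}x}{\mathrm{d}z}(L)=0$, $\frac{\mathrm{d}e}{\mathrm{d}z}(L)=\gamma e(L)$. It generates a $C_0$-semigroup $(T_{\tilde A_{\kappa\gamma}}(t))_{t\ge0}$, and the mild solution is $t\mapsto T_{\tilde A_{\kappa\gamma}}(t)(x_0,e_0)^\top$. Normalized means of unit $\mathrm{L}^2(0,L)$-norm. Conventions: $\min\emptyset=+\infty$, $\max\emptyset=-\infty$. *)

theory Defs
  imports "HOL-Analysis.Analysis"
begin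

text \<open>
  The real Hilbert space of square-integrable functions on the line modulo equality almost
  everywhere. Since L varies, the space of square-integrable functions on the interval (0, L) is
  not a type; it is the closed subspace \<open>L2_on L\<close> of the classes that vanish almost everywhere
  outside (0, L), i.e. a function on (0, L) is identified with its extension by zero.
\<close>

definition square_integrable :: "(real \<Rightarrow> real) \<Rightarrow> bool" where
  "square_integrable f \<longleftrightarrow>
     f \<in> borel_measurable lborel \<and> integrable lborel (\<lambda>z. (f z)\<^sup>2)"

lemma square_integrable_mult:
  assumes "square_integrable f" "square_integrable g"
  shows "integrable lborel (\<lambda>z. f z * g z)"
proof (rule Bochner_Integration.integrable_bound)
  show "integrable lborel (\<lambda>z. (f z)\<^sup>2 + (g z)\<^sup>2)"
    using assms by (auto simp: square_integrable_def)
  show "(\<lambda>z. f z * g z) \<in> borel_measurable lborel"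
    using assms by (auto simp: square_integrable_def)
  have "\<bar>a * b\<bar> \<le> a\<^sup>2 + b\<^sup>2" for a b :: real
  proof -
    have "2 * (\<bar>a\<bar> * \<bar>b\<bar>) \<le> \<bar>a\<bar>\<^sup>2 + \<bar>b\<bar>\<^sup>2"
      using sum_squares_bound[of "\<bar>a\<bar>" "\<bar>b\<bar>"] by simp
    moreover have "0 \<le> \<bar>a\<bar> * \<bar>b\<bar>" by simp
    ultimately show ?thesis unfolding abs_mult power2_abs by linarith
  qed
  then show "AE z in lborel. norm (f z * g z) \<le> norm ((f z)\<^sup>2 + (g z)\<^sup>2)"
    by simp
qed

lemma square_integrable_add:
  assumes "square_integrable f" "square_integrable g"
  shows "square_integrable (\<lambda>z. f z + g z)"
proof -
  have "integrable lborel (\<lambda>z. (f z)\<^sup>2 + (g z)\<^sup>2 + 2 * (f z * g z))"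
    using assms square_integrable_mult[OF assms] by (auto simp: square_integrable_def)
  moreover have "(\<lambda>z. (f z)\<^sup>2 + (g z)\<^sup>2 + 2 * (f z * g z)) = (\<lambda>z. (f z + g z)\<^sup>2)"
    by (auto simp: power2_eq_square algebra_simps)
  ultimately show ?thesis
    using assms by (auto simp: square_integrable_def)
qed

lemma square_integrable_scale:
  assumes "square_integrable f"
  shows "square_integrable (\<lambda>z. r * f z)"
  using assms by (auto simp: square_integrable_def power_mult_distrib)

definition L2_rel :: "(real \<Rightarrow> real) \<Rightarrow> (real \<Rightarrow> real) \<Rightarrow> bool" where
  "L2_rel f g \<longleftrightarrow>
     square_integrable f \<and> square_integrable g \<and> (AE z in lborel. f z = g z)"

lemma L2_rel_refl_iff: "L2_rel f f \<longleftrightarrow> square_integrable f"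
  by (simp add: L2_rel_def)

lemma L2_rel_integral_mult:
  assumes "L2_rel f f'" "L2_rel g g'"
  shows "(LINT z|lborel. f z * g z) = (LINT z|lborel. f' z * g' z)"
  using assms by (intro integral_cong_AE) (auto simp: L2_rel_def square_integrable_def)

quotient_type L2 = "real \<Rightarrow> real" / partial: L2_rel
proof (rule part_equivpI)
  show "\<exists>f. L2_rel f f"
    by (rule exI[of _ "\<lambda>_. 0"]) (simp add: L2_rel_def square_integrable_def)
  show "symp L2_rel"
    by (rule sympI) (auto simp: L2_rel_def)
  show "transp L2_rel"
    by (rule transpI) (auto simp: L2_rel_def)
qed

instantiation L2 :: real_inner
begin

lift_definition zero_L2 :: L2 is "\<lambda>_. 0"
  by (simp add: L2_rel_def square_integrable_def)

lift_definition plus_L2 :: "L2 \<Rightarrow> L2 \<Rightarrow> L2" is "\<lambda>f g z. f z + g z"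
  by (auto simp: L2_rel_def square_integrable_add)

lift_definition scaleR_L2 :: "real \<Rightarrow> L2 \<Rightarrow> L2" is "\<lambda>r f z. r * f z"
  by (auto simp: L2_rel_def square_integrable_scale)

lift_definition inner_L2 :: "L2 \<Rightarrow> L2 \<Rightarrow> real" is "\<lambda>f g. LINT z|lborel. f z * g z"
  by (rule L2_rel_integral_mult)

definition uminus_L2 :: "L2 \<Rightarrow> L2" where "- f = (-1) *\<^sub>R (f::L2)"
definition minus_L2 :: "L2 \<Rightarrow> L2 \<Rightarrow> L2" where "f - g = f + - (g::L2)"
definition norm_L2 :: "L2 \<Rightarrow> real" where "norm f = sqrt (inner f (f::L2))"
definition sgn_L2 :: "L2 \<Rightarrow> L2" where "sgn f = inverse (norm f) *\<^sub>R (f::L2)"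
definition dist_L2 :: "L2 \<Rightarrow> L2 \<Rightarrow> real" where "dist f g = norm (f - (g::L2))"
definition uniformity_L2 :: "(L2 \<times> L2) filter" where
  "uniformity_L2 = (INF e\<in>{0<..}. principal {(f::L2, g). dist f g < e})"
definition open_L2 :: "L2 set \<Rightarrow> bool" where
  "open_L2 U \<longleftrightarrow> (\<forall>f\<in>U. eventually (\<lambda>(f', g). f' = f \<longrightarrow> g \<in> U) uniformity)"

instance
proof
  fix f g h :: L2 and r s :: real
  show "f + g + h = f + (g + h)"
    by transfer (auto simp: L2_rel_def square_integrable_add add.assoc)
  show "f + g = g + f"
    by transfer (auto simp: L2_rel_def square_integrable_add add.commute)
  show "0 + f = f"
    by transfer (auto simp: L2_rel_def)
  show "- f + f = 0"
    unfolding uminus_L2_def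
    by transfer
      (auto simp: L2_rel_def square_integrable_def)
  show "f - g = f + - g" by (simp add: minus_L2_def)
  show "r *\<^sub>R (f + g) = r *\<^sub>R f + r *\<^sub>R g"
    by transfer
      (auto simp: L2_rel_def square_integrable_add square_integrable_scale algebra_simps)
  show "(r + s) *\<^sub>R f = r *\<^sub>R f + s *\<^sub>R f"
    by transfer
      (auto simp: L2_rel_def square_integrable_add square_integrable_scale algebra_simps)
  show "r *\<^sub>R s *\<^sub>R f = (r * s) *\<^sub>R f"
    by transfer (auto simp: L2_rel_def square_integrable_scale algebra_simps)
  show "1 *\<^sub>R f = f"
    by transfer (auto simp: L2_rel_def)
  show "dist f g = norm (f - g)" by (simp add: dist_L2_def)
  show "sgn f = inverse (norm f) *\<^sub>R f" by (simp add: sgn_L2_def)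
  show "norm f = sqrt (inner f f)" by (simp add: norm_L2_def)
  show "(uniformity :: (L2 \<times> L2) filter) = (INF e\<in>{0<..}. principal {(f, g). dist f g < e})"
    by (simp add: uniformity_L2_def)
  show "open U \<longleftrightarrow> (\<forall>f\<in>U. eventually (\<lambda>(f', g). f' = f \<longrightarrow> g \<in> U) uniformity)"
    for U :: "L2 set"
    by (simp add: open_L2_def)
  show "inner f g = inner g f"
    by transfer (simp add: mult.commute)
  show "inner (f + g) h = inner f h + inner g h"
    by transfer (simp add: L2_rel_def distrib_right square_integrable_mult)
  show "inner (r *\<^sub>R f) g = r * inner f g"
    by transfer (simp add: mult.assoc)
  show "0 \<le> inner f f"
    by transfer simp
  show "inner f f = 0 \<longleftrightarrow> f = 0"
  proof transfer
    fix f assume "L2_rel f f"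
    then have sq: "square_integrable f" by (simp add: L2_rel_refl_iff)
    then have "(LINT z|lborel. f z * f z) = 0 \<longleftrightarrow> (AE z in lborel. f z * f z = 0)"
      by (intro integral_nonneg_eq_0_iff_AE square_integrable_mult) auto
    then show "(LINT z|lborel. f z * f z) = 0 \<longleftrightarrow> L2_rel f (\<lambda>_. 0)"
      using sq by (auto simp: L2_rel_def square_integrable_def)
  qed
qed

end

lemma L2_rel_rep_abs:
  assumes "square_integrable f"
  shows "L2_rel (rep_L2 (abs_L2 f)) f"
  using rep_abs_rsp_left[OF Quotient3_L2, of f f] assms by (simp add: L2_rel_refl_iff)

lemma abs_rep_L2: "abs_L2 (rep_L2 f) = f"
  by (rule Quotient3_abs_rep[OF Quotient3_L2])

definition L2_on :: "real \<Rightarrow> L2 set" where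
  "L2_on L = {f. AE z in lborel. z \<notin> {0<..<L} \<longrightarrow> rep_L2 f z = 0}"

definition L2_nonneg :: "real \<Rightarrow> L2 set" where
  "L2_nonneg L = {f \<in> L2_on L. AE z in lborel. z \<in> {0<..<L} \<longrightarrow> 0 \<le> rep_L2 f z}"

definition L2_nonpos :: "real \<Rightarrow> L2 set" where
  "L2_nonpos L = {f \<in> L2_on L. AE z in lborel. z \<in> {0<..<L} \<longrightarrow> rep_L2 f z \<le> 0}"

text \<open>\<open>represents L g f\<close>: the function g is a representative on (0, L) of the class f.\<close>

definition represents :: "real \<Rightarrow> (real \<Rightarrow> real) \<Rightarrow> L2 \<Rightarrow> bool" where
  "represents L g f \<longleftrightarrow>
     f \<in> L2_on L \<and> (AE z in lborel. z \<in> {0<..<L} \<longrightarrow> rep_L2 f z = g z)"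

definition L2_of :: "real \<Rightarrow> (real \<Rightarrow> real) \<Rightarrow> L2" where
  "L2_of L g = abs_L2 (\<lambda>z. indicator {0<..<L} z * g z)"

text \<open>Pointwise value on [0, L] of a class that has a continuous representative.\<close>

definition point_value :: "real \<Rightarrow> L2 \<Rightarrow> real \<Rightarrow> real" where
  "point_value L f z = (THE v. \<exists>g. continuous_on {0..L} g \<and> represents L g f \<and> v = g z)"

text \<open>
  \<open>H2_data L f g g' f''\<close>: f belongs to the Sobolev space of order two on (0, L), its continuously
  differentiable representative on [0, L] is g, with derivative g', and f'' is its second
  derivative. In dimension one this is the space of continuously differentiable functions whose
  derivative is absolutely continuous (here: an indefinite Lebesgue integral) with a
  square-integrable derivative. For L > 0 the class f determines g and g' on [0, L] and f''.
\<close>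

definition H2_data ::
    "real \<Rightarrow> L2 \<Rightarrow> (real \<Rightarrow> real) \<Rightarrow> (real \<Rightarrow> real) \<Rightarrow> L2 \<Rightarrow> bool" where
  "H2_data L f g g' f'' \<longleftrightarrow>
     represents L g f \<and> f'' \<in> L2_on L \<and>
     (\<forall>z\<in>{0..L}. (g has_real_derivative g' z) (at z within {0..L})) \<and>
     (\<forall>z\<in>{0..L}. g' z = g' 0 + (LINT s:{0..z}|lborel. rep_L2 f'' s))"

text \<open>
  An unbounded linear operator is given by its graph. \<open>refl_op\<close> is the diffusion operator with the
  Robin condition at L, i.e. the conjugate under the reflection of [0, L] that exchanges z and
  L - z of the diffusion operator with the Robin condition at 0.
\<close>

definition refl_op :: "real \<Rightarrow> real \<Rightarrow> real \<Rightarrow> (L2 \<times> L2) set" where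
  "refl_op D\<^sub>a L \<gamma> =
     {(e, D\<^sub>a *\<^sub>R e'') | e e''. \<exists>g g'. H2_data L e g g' e'' \<and> g' 0 = 0 \<and> g' L = \<gamma> * g L}"

definition coupled_op :: "real \<Rightarrow> real \<Rightarrow> real \<Rightarrow> real \<Rightarrow> ((L2 \<times> L2) \<times> (L2 \<times> L2)) set" where
  "coupled_op D\<^sub>a L \<kappa> \<gamma> =
     {((x, e), (D\<^sub>a *\<^sub>R x'', D\<^sub>a *\<^sub>R e'')) | x e x'' e''.
        \<exists>gx gx' ge ge'. H2_data L x gx gx' x'' \<and> H2_data L e ge ge' e'' \<and>
          gx' 0 = - \<kappa> * gx 0 - \<kappa> * ge 0 \<and> ge' 0 = 0 \<and>
          gx' L = 0 \<and> ge' L = \<gamma> * ge L}"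

definition resolvent :: "real \<Rightarrow> ('a::real_vector \<times> 'a) set \<Rightarrow> 'a \<Rightarrow> 'a" where
  "resolvent lam A y = (THE w. \<exists>v. (w, v) \<in> A \<and> lam *\<^sub>R w - v = y)"

definition eigenvector :: "('a::real_vector \<times> 'a) set \<Rightarrow> real \<Rightarrow> 'a \<Rightarrow> bool" where
  "eigenvector A lam w \<longleftrightarrow> w \<noteq> 0 \<and> (w, lam *\<^sub>R w) \<in> A"

text \<open>
  Strongly continuous semigroups of bounded linear operators on a subspace X; the values of T
  outside X and at negative times are irrelevant.
\<close>

definition C0_semigroup_on :: "'a::real_normed_vector set \<Rightarrow> (real \<Rightarrow> 'a \<Rightarrow> 'a) \<Rightarrow> bool" where
  "C0_semigroup_on X T \<longleftrightarrow>
     (\<forall>t\<ge>0.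
        (\<forall>u\<in>X. T t u \<in> X) \<and>
        (\<forall>u\<in>X. \<forall>v\<in>X. T t (u + v) = T t u + T t v) \<and>
        (\<forall>r. \<forall>u\<in>X. T t (r *\<^sub>R u) = r *\<^sub>R T t u) \<and>
        (\<exists>M. \<forall>u\<in>X. norm (T t u) \<le> M * norm u)) \<and>
     (\<forall>u\<in>X. T 0 u = u) \<and>
     (\<forall>s\<ge>0. \<forall>t\<ge>0. \<forall>u\<in>X. T (s + t) u = T s (T t u)) \<and>
     (\<forall>u\<in>X. ((\<lambda>t. T t u) \<longlongrightarrow> u) (at_right 0))"

definition generator_on ::
    "'a::real_normed_vector set \<Rightarrow> (real \<Rightarrow> 'a \<Rightarrow> 'a) \<Rightarrow> ('a \<times> 'a) set" where
  "generator_on X T =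
     {(u, v). u \<in> X \<and> v \<in> X \<and> ((\<lambda>h. (T h u - u) /\<^sub>R h) \<longlongrightarrow> v) (at_right 0)}"

definition generates_on ::
    "'a::real_normed_vector set \<Rightarrow> ('a \<times> 'a) set \<Rightarrow> (real \<Rightarrow> 'a \<Rightarrow> 'a) \<Rightarrow> bool" where
  "generates_on X A T \<longleftrightarrow> C0_semigroup_on X T \<and> generator_on X T = A"

text \<open>
  The guard \<open>cos (\<mu> * L) \<noteq> 0\<close> excludes the poles of the tangent, where \<open>tan\<close> takes the value 0.
\<close>

definition char_roots :: "real \<Rightarrow> real \<Rightarrow> real set" where
  "char_roots L \<gamma> = {\<mu>. 0 < \<mu> \<and> cos (\<mu> * L) \<noteq> 0 \<and> - \<gamma> / \<mu> = tan (\<mu> * L)}"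

text \<open>The i-th root in increasing order, for i = 1, 2, ...\<close>

definition eig_mu :: "real \<Rightarrow> real \<Rightarrow> nat \<Rightarrow> real" where
  "eig_mu L \<gamma> i =
     (THE \<mu>. \<mu> \<in> char_roots L \<gamma> \<and> finite {\<nu> \<in> char_roots L \<gamma>. \<nu> \<le> \<mu>} \<and>
             card {\<nu> \<in> char_roots L \<gamma>. \<nu> \<le> \<mu>} = i)"

definition eig_val :: "real \<Rightarrow> real \<Rightarrow> real \<Rightarrow> nat \<Rightarrow> real" where
  "eig_val D\<^sub>a L \<gamma> i = - D\<^sub>a * (eig_mu L \<gamma> i)\<^sup>2"

definition eig_coeff :: "real \<Rightarrow> real \<Rightarrow> nat \<Rightarrow> real" where
  "eig_coeff L \<gamma> i = 1 / norm (L2_of L (\<lambda>z. cos (eig_mu L \<gamma> i * z)))"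

definition eig_fun :: "real \<Rightarrow> real \<Rightarrow> nat \<Rightarrow> L2" where
  "eig_fun L \<gamma> i = L2_of L (\<lambda>z. eig_coeff L \<gamma> i * cos (eig_mu L \<gamma> i * z))"

definition set_E :: "real \<Rightarrow> real \<Rightarrow> real \<Rightarrow> L2 set" where
  "set_E D\<^sub>a L \<gamma> =
     {e \<in> L2_on L. \<exists>\<omega>\<ge>0. \<forall>lam>\<omega>. \<forall>m\<ge>1.
        point_value L ((resolvent lam (refl_op D\<^sub>a L \<gamma>) ^^ m) e) 0 \<le> 0}"

definition Gamma1 :: "real \<Rightarrow> real \<Rightarrow> nat set \<Rightarrow> (nat \<Rightarrow> real) set" where
  "Gamma1 L \<gamma> I = {a. (\<Sum>i\<in>I. a i * eig_coeff L \<gamma> i) \<le> 0}"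

text \<open>
  In the extended reals the infimum of the empty set is \<open>\<infinity>\<close> and its supremum is \<open>-\<infinity>\<close>; for finite
  I the infimum and supremum over nonempty index sets are attained.
\<close>

definition Gamma2 :: "real \<Rightarrow> real \<Rightarrow> real \<Rightarrow> nat set \<Rightarrow> (nat \<Rightarrow> real) set" where
  "Gamma2 D\<^sub>a L \<gamma> I =
     {a. (INF i\<in>{i \<in> I. a i < 0}. ereal (eig_val D\<^sub>a L \<gamma> i))
           > (SUP i\<in>{i \<in> I. a i > 0}. ereal (eig_val D\<^sub>a L \<gamma> i))}"

definition set_F :: "real \<Rightarrow> real \<Rightarrow> real \<Rightarrow> L2 set" where
  "set_F D\<^sub>a L \<gamma> =
     (\<Union>I\<in>{I. I \<subseteq> {1..} \<and> finite I}.
        {\<Sum>i\<in>I. a i *\<^sub>R eig_fun L \<gamma> i | a. a \<in> Gamma1 L \<gamma> I \<inter> Gamma2 D\<^sub>a L \<gamma> I})"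

end

theory Submission
  imports Defs
begin

text \<open>
  On a finite sum of eigenfunctions, the powers of the resolvent and the semigroup multiply the
  coefficient of the i-th eigenfunction by a positive weight that increases with the eigenvalue.
  Since the negative coefficients belong to the larger eigenvalues, the weighted sum of the boundary
  values stays below a positive multiple of the unweighted one, hence nonpositive.

  For the coupled system let E(t) be the explicit solution of the error equation that starts at an
  element of \<open>set_F\<close> above the initial error; its value at 0 is nonpositive at all times. For initial
  data in the domain of the generator,
  \<open>\<parallel>max (-x) 0\<parallel>\<^sup>2 + C * \<parallel>max (e - E) 0\<parallel>\<^sup>2\<close>
  is nonincreasing for a suitable constant C, because the flux that the error injects at 0 is dominated
  by the dissipation of the error equation. The domain is dense, so this holds for all mild
  solutions, and the functional vanishes at time 0. The orbits of a semigroup are given only as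
  continuous from the right; continuity from the left uses the uniform boundedness principle, hence
  the completeness of L2.
\<close>

text \<open>The semigroup \<open>T\<close> is known only through its generator, so nothing says at
  once that its second component is the diagonal evolution on the eigenfunctions; comparison
  replaces explicit formulas. An element of \<open>set_F\<close> may be positive inside (0, L), so
  the positive part of the error itself need not start at 0. But only the value of the error at 0
  enters the equation for x, and the excess e - E starts nonpositive and satisfies the same boundary
  conditions as e. For a nonpositive initial error, E is 0, the empty sum.

  The constant is C = -\<kappa> (L - 1/\<gamma>). Put k = -\<kappa>, and let q and r be the positive
  parts of e - E at 0 and at L. Completing a square bounds the influx by k q^2/4. The dissipation of
  the excess is at least |\<gamma>| r^2 + (r - q)^2/L. As C is k times the sum of L and
  1/|\<gamma>|, both terms have weight at least k after multiplication by C, and r^2 + (r - q)^2 >=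
  q^2/2 makes the dissipation win.

  Time derivatives of orbits are taken from the right only, as in the definition of the
  generator.\<close>

section \<open>Almost-everywhere calculus of representatives\<close>

lemma square_integrable_rep: "square_integrable (rep_L2 f)"
  using Quotient3_rep_reflp[OF Quotient3_L2] by (simp add: L2_rel_refl_iff)

lemma measurable_rep [measurable]: "rep_L2 f \<in> borel_measurable borel"
  using square_integrable_rep[of f] by (simp add: square_integrable_def)

lemma rep_abs_AE: "square_integrable f \<Longrightarrow> AE z in lborel. rep_L2 (abs_L2 f) z = f z"
  using L2_rel_rep_abs by (simp add: L2_rel_def)

lemma rep_zero_AE: "AE z in lborel. rep_L2 0 z = 0"
  unfolding zero_L2_def by (rule rep_abs_AE) (simp add: square_integrable_def)

lemma rep_add_AE: "AE z in lborel. rep_L2 (f + g) z = rep_L2 f z + rep_L2 g z"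
proof -
  have "f + g = abs_L2 (\<lambda>z. rep_L2 f z + rep_L2 g z)"
    using plus_L2.abs_eq[of "rep_L2 f" "rep_L2 g"]
    by (simp add: abs_rep_L2 L2_rel_refl_iff square_integrable_rep)
  then show ?thesis
    using rep_abs_AE[OF square_integrable_add[OF square_integrable_rep square_integrable_rep]] by simp
qed

lemma rep_scaleR_AE: "AE z in lborel. rep_L2 (r *\<^sub>R f) z = r * rep_L2 f z"
proof -
  have "r *\<^sub>R f = abs_L2 (\<lambda>z. r * rep_L2 f z)"
    using scaleR_L2.abs_eq[of "rep_L2 f" r]
    by (simp add: abs_rep_L2 L2_rel_refl_iff square_integrable_rep)
  then show ?thesis
    using rep_abs_AE[OF square_integrable_scale[OF square_integrable_rep]] by simp
qed

lemma rep_uminus_AE: "AE z in lborel. rep_L2 (- f) z = - rep_L2 f z"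
  using rep_scaleR_AE[of "-1" f] by simp

lemma rep_diff_AE: "AE z in lborel. rep_L2 (f - g) z = rep_L2 f z - rep_L2 g z"
  using rep_add_AE[of f "- g"] rep_uminus_AE[of g] by eventually_elim simp

lemma rep_sum_AE:
  assumes "finite I"
  shows "AE z in lborel. rep_L2 (\<Sum>i\<in>I. f i) z = (\<Sum>i\<in>I. rep_L2 (f i) z)"
  using assms
proof (induction I)
  case empty
  then show ?case using rep_zero_AE by simp
next
  case (insert i I)
  show ?case
    using rep_add_AE[of "f i" "sum f I"] insert.IH by eventually_elim (simp add: insert.hyps)
qed

lemma inner_L2_eq: "inner f g = (LINT z|lborel. rep_L2 f z * rep_L2 g z)"
  using inner_L2.abs_eq[of "rep_L2 f" "rep_L2 g"]
  by (simp add: abs_rep_L2 L2_rel_refl_iff square_integrable_rep)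

lemma integrable_rep_mult: "integrable lborel (\<lambda>z. rep_L2 f z * rep_L2 g z)"
  by (intro square_integrable_mult square_integrable_rep)

lemma power2_norm_L2: "(norm f)\<^sup>2 = (LINT z|lborel. (rep_L2 f z)\<^sup>2)"
  unfolding power2_norm_eq_inner inner_L2_eq by (simp add: power2_eq_square)

lemma integrable_rep_power2: "integrable lborel (\<lambda>z. (rep_L2 f z)\<^sup>2)"
  using square_integrable_rep[of f] by (simp add: square_integrable_def)

lemma L2_eqI:
  assumes "AE z in lborel. rep_L2 f z = rep_L2 g z"
  shows "f = g"
  using Quotient3_rel_rep[OF Quotient3_L2, of f g] assms
  by (simp add: L2_rel_def square_integrable_rep)

lemma norm_L2_mono:
  assumes "AE z in lborel. \<bar>rep_L2 f z\<bar> \<le> \<bar>rep_L2 g z\<bar>"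
  shows "norm f \<le> norm g"
proof (rule power2_le_imp_le)
  show "(norm f)\<^sup>2 \<le> (norm g)\<^sup>2"
    unfolding power2_norm_L2 using assms
    by (intro integral_mono_AE integrable_rep_power2) (auto simp: abs_le_square_iff)
qed simp

lemma L2_on_subspace: "subspace (L2_on L)"
  unfolding subspace_def
proof (intro conjI ballI allI)
  show "0 \<in> L2_on L"
    using rep_zero_AE by (auto simp: L2_on_def)
  show "f + g \<in> L2_on L" if "f \<in> L2_on L" "g \<in> L2_on L" for f g
    using that rep_add_AE[of f g] unfolding L2_on_def mem_Collect_eq by eventually_elim auto
  show "r *\<^sub>R f \<in> L2_on L" if "f \<in> L2_on L" for r f
    using that rep_scaleR_AE[of r f] unfolding L2_on_def mem_Collect_eq by eventually_elim auto
qed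

section \<open>Completeness\<close>

text \<open>Dominated convergence applied to the squared distance. The majorant is asked of the
  squared difference, which is the integrand of the squared norm of the difference of the
  classes.\<close>

lemma tendsto_abs_L2:
  assumes sq: "\<And>n. square_integrable (s n)" and sqf: "square_integrable f"
    and lim: "AE z in lborel. (\<lambda>n. s n z) \<longlonglongrightarrow> f z"
    and bound: "\<And>n. AE z in lborel. (s n z - f z)\<^sup>2 \<le> w z" and w: "integrable lborel w"
  shows "(\<lambda>n. abs_L2 (s n)) \<longlonglongrightarrow> abs_L2 f"
proof -
  have ms: "s n \<in> borel_measurable borel" for n using sq[of n] by (simp add: square_integrable_def)
  have mf: "f \<in> borel_measurable borel" using sqf by (simp add: square_integrable_def)
  note [measurable] = ms mf
  have "(\<lambda>n. LINT z|lborel. (s n z - f z)\<^sup>2) \<longlonglongrightarrow> (LINT (z::real)|lborel. (0::real))"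
  proof (rule integral_dominated_convergence[where w = w])
    show "AE z in lborel. (\<lambda>n. (s n z - f z)\<^sup>2) \<longlonglongrightarrow> 0"
      using lim
    proof eventually_elim
      case (elim z)
      have "(\<lambda>n. (s n z - f z)\<^sup>2) \<longlonglongrightarrow> (f z - f z)\<^sup>2"
        by (intro tendsto_intros elim)
      then show ?case by simp
    qed
    show "AE z in lborel. norm ((s n z - f z)\<^sup>2) \<le> w z" for n
      using bound[of n] by simp
  qed (use w in measurable)
  moreover have "(LINT z|lborel. (s n z - f z)\<^sup>2) = (norm (abs_L2 (s n) - abs_L2 f))\<^sup>2" for n
    unfolding power2_norm_L2
  proof (rule integral_cong_AE)
    show "AE z in lborel. (s n z - f z)\<^sup>2 = (rep_L2 (abs_L2 (s n) - abs_L2 f) z)\<^sup>2"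
      using rep_diff_AE[of "abs_L2 (s n)" "abs_L2 f"] rep_abs_AE[OF sq[of n]] rep_abs_AE[OF sqf]
      by eventually_elim simp
  qed measurable
  ultimately have "(\<lambda>n. (norm (abs_L2 (s n) - abs_L2 f))\<^sup>2) \<longlonglongrightarrow> 0" by simp
  then have "(\<lambda>n. sqrt ((norm (abs_L2 (s n) - abs_L2 f))\<^sup>2)) \<longlonglongrightarrow> sqrt 0"
    by (rule tendsto_real_sqrt)
  then show ?thesis
    using LIM_zero_iff tendsto_norm_zero_iff by fastforce
qed

text \<open>Riesz-Fischer in series form. The partial sums of the absolute values have norm at most
  the sum of the norms, so by monotone convergence their squares have an integrable supremum. Where
  it is finite the series converges absolutely, and it also serves as the majorant for convergence
  in norm.\<close>

lemma summable_L2: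
  fixes f :: "nat \<Rightarrow> L2"
  assumes "summable (\<lambda>n. norm (f n))"
  shows "summable f"
proof -
  define C where "C = (\<Sum>n. norm (f n))"
  have C: "(\<Sum>i<n. norm (f i)) \<le> C" for n
    unfolding C_def by (rule sum_le_suminf[OF assms]) auto
  define a where "a = (\<lambda>i. abs_L2 (\<lambda>z. \<bar>rep_L2 (f i) z\<bar>))"
  have sqa: "square_integrable (\<lambda>z. \<bar>rep_L2 (f i) z\<bar>)" for i
    using square_integrable_rep[of "f i"] by (simp add: square_integrable_def)
  have repa: "AE z in lborel. rep_L2 (a i) z = \<bar>rep_L2 (f i) z\<bar>" for i
    unfolding a_def by (rule rep_abs_AE[OF sqa])
  have norma: "norm (a i) \<le> norm (f i)" for i
    using repa[of i] by (intro norm_L2_mono) auto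
  define G where "G = (\<lambda>n z. (\<Sum>i<n. \<bar>rep_L2 (f i) z\<bar>))"
  have [measurable]: "G n \<in> borel_measurable borel" for n unfolding G_def by measurable
  have repG: "AE z in lborel. rep_L2 (\<Sum>i<n. a i) z = G n z" for n
  proof -
    have "AE z in lborel. \<forall>i\<in>{..<n}. rep_L2 (a i) z = \<bar>rep_L2 (f i) z\<bar>"
      using repa by (intro AE_ball_countable[THEN iffD2]) auto
    with rep_sum_AE[of "{..<n}" a] show ?thesis
      unfolding G_def by (auto elim!: AE_mp)
  qed
  have sqG: "square_integrable (G n)" for n
  proof -
    have "integrable lborel (\<lambda>z. (G n z)\<^sup>2)"
      using repG[of n] by (intro integrable_cong_AE_imp[OF integrable_rep_power2[of "\<Sum>i<n. a i"]]) auto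
    then show ?thesis by (simp add: square_integrable_def)
  qed
  have "(LINT z|lborel. (G n z)\<^sup>2) \<le> C\<^sup>2" for n
  proof -
    have "(LINT z|lborel. (G n z)\<^sup>2) = (norm (\<Sum>i<n. a i))\<^sup>2"
      unfolding power2_norm_L2 using repG[of n] by (intro integral_cong_AE) auto
    also have "norm (\<Sum>i<n. a i) \<le> C"
      using norm_sum[of a "{..<n}"] sum_mono[of "{..<n}" "\<lambda>i. norm (a i)" "\<lambda>i. norm (f i)"] norma C[of n]
      by force
    then have "(norm (\<Sum>i<n. a i))\<^sup>2 \<le> C\<^sup>2" by (intro power_mono) auto
    finally show ?thesis .
  qed
  then have intG: "(\<integral>\<^sup>+z. ennreal ((G n z)\<^sup>2) \<partial>lborel) \<le> ennreal (C\<^sup>2)" for n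
    using sqG[of n] by (subst nn_integral_eq_integral) (auto simp: square_integrable_def ennreal_leI)
  \<comment> \<open>The supremum is taken in \<open>ennreal\<close>, where it always exists;
    \<open>h\<close> is its real version, meaningful off the null set where \<open>H\<close> is
    infinite.\<close>
  define H where "H = (\<lambda>z. SUP n. ennreal ((G n z)\<^sup>2))"
  have [measurable]: "H \<in> borel_measurable borel" unfolding H_def by measurable
  have Gmono: "G m z \<le> G n z" if "m \<le> n" for m n z
    unfolding G_def using that by (intro sum_mono2) auto
  have Gpos: "0 \<le> G n z" for n z unfolding G_def by (simp add: sum_nonneg)
  have "(\<integral>\<^sup>+z. H z \<partial>lborel) = (SUP n. \<integral>\<^sup>+z. ennreal ((G n z)\<^sup>2) \<partial>lborel)"
    unfolding H_def
  proof (rule nn_integral_monotone_convergence_SUP)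
    show "incseq (\<lambda>n z. ennreal ((G n z)\<^sup>2))"
      using Gmono Gpos by (auto simp: incseq_def le_fun_def intro!: ennreal_leI power_mono)
  qed measurable
  also have "\<dots> \<le> ennreal (C\<^sup>2)" by (rule SUP_least) (rule intG)
  finally have intH: "(\<integral>\<^sup>+z. H z \<partial>lborel) < \<infinity>"
    using ennreal_less_top le_less_trans by (metis infinity_ennreal_def)
  have Hfin: "AE z in lborel. H z \<noteq> \<infinity>"
    by (rule nn_integral_PInf_AE) (use intH in auto)
  define h where "h = (\<lambda>z. enn2real (H z))"
  have inth: "integrable lborel h"
  proof (rule integrableI_nonneg)
    have "(\<integral>\<^sup>+z. ennreal (h z) \<partial>lborel) = (\<integral>\<^sup>+z. H z \<partial>lborel)"
      using Hfin by (intro nn_integral_cong_AE) (auto simp: h_def less_top)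
    then show "(\<integral>\<^sup>+z. ennreal (h z) \<partial>lborel) < \<infinity>" using intH by simp
  qed (auto simp: h_def)
  have Gh: "(G n z)\<^sup>2 \<le> h z" if "H z \<noteq> \<infinity>" for n z
  proof -
    have "ennreal ((G n z)\<^sup>2) \<le> H z" unfolding H_def by (rule SUP_upper) simp
    also have "H z = ennreal (h z)" using that by (simp add: h_def less_top)
    finally show ?thesis by (simp add: h_def)
  qed
  define s where "s = (\<lambda>n z. \<Sum>i<n. rep_L2 (f i) z)"
  define F where "F = (\<lambda>z. \<Sum>i. rep_L2 (f i) z)"
  have [measurable]: "s n \<in> borel_measurable borel" for n unfolding s_def by measurable
  have [measurable]: "F \<in> borel_measurable borel" unfolding F_def by measurable
  have sG: "\<bar>s n z\<bar> \<le> G n z" for n z unfolding s_def G_def by (rule sum_abs)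
  have reps: "AE z in lborel. rep_L2 (\<Sum>i<n. f i) z = s n z" for n
    unfolding s_def by (rule rep_sum_AE) simp
  have sqs: "square_integrable (s n)" for n
  proof -
    have "integrable lborel (\<lambda>z. (s n z)\<^sup>2)"
      using reps[of n] by (intro integrable_cong_AE_imp[OF integrable_rep_power2[of "\<Sum>i<n. f i"]]) auto
    then show ?thesis by (simp add: square_integrable_def)
  qed
  have sh: "(s n z)\<^sup>2 \<le> h z" if "H z \<noteq> \<infinity>" for n z
  proof -
    have "(s n z)\<^sup>2 \<le> (G n z)\<^sup>2" using sG[of n z] by (simp add: abs_le_square_iff[symmetric])
    with Gh[OF that, of n] show ?thesis by linarith
  qed
  have lim: "(\<lambda>n. s n z) \<longlonglongrightarrow> F z" if "H z \<noteq> \<infinity>" for z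
  proof -
    have "G n z \<le> sqrt (h z)" for n using Gh[OF that, of n] real_le_rsqrt by blast
    then have "summable (\<lambda>i. \<bar>rep_L2 (f i) z\<bar>)"
      unfolding G_def by (intro summableI_nonneg_bounded) auto
    then have "summable (\<lambda>i. rep_L2 (f i) z)" by (rule summable_rabs_cancel)
    then show ?thesis unfolding s_def F_def by (rule summable_LIMSEQ)
  qed
  have Fh: "(F z)\<^sup>2 \<le> h z" if "H z \<noteq> \<infinity>" for z
    by (rule LIMSEQ_le_const2[OF tendsto_power[OF lim[OF that]]]) (use sh[OF that] in auto)
  have sqF: "square_integrable F"
  proof -
    have "integrable lborel (\<lambda>z. (F z)\<^sup>2)"
      using Hfin by (intro Bochner_Integration.integrable_bound[OF inth])
        (auto elim!: AE_mp simp: h_def Fh[unfolded h_def])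
    then show ?thesis by (simp add: square_integrable_def)
  qed
  have "(\<lambda>n. abs_L2 (s n)) \<longlonglongrightarrow> abs_L2 F"
  proof (rule tendsto_abs_L2[OF sqs sqF])
    show "AE z in lborel. (\<lambda>n. s n z) \<longlonglongrightarrow> F z" using Hfin by eventually_elim (rule lim)
    \<comment> \<open>The factor 4 comes from (a - b)^2 <= 2 a^2 + 2 b^2 with both squares at most
      h.\<close>
    show "AE z in lborel. (s n z - F z)\<^sup>2 \<le> 4 * h z" for n
      using Hfin
    proof eventually_elim
      case (elim z)
      have "(s n z - F z)\<^sup>2 \<le> 2 * (s n z)\<^sup>2 + 2 * (F z)\<^sup>2"
        using zero_le_power2[of "s n z + F z"] by (simp add: power2_eq_square algebra_simps)
      with sh[OF elim, of n] Fh[OF elim] show ?case by linarith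
    qed
    show "integrable lborel (\<lambda>z. 4 * h z)" using inth by simp
  qed
  moreover have "abs_L2 (s n) = (\<Sum>i<n. f i)" for n
    using reps[of n] rep_abs_AE[OF sqs[of n]] by (intro L2_eqI) auto
  ultimately have "f sums abs_L2 F" by (simp add: sums_def)
  then show ?thesis by (rule sums_summable)
qed


section \<open>Positive parts\<close>

lift_definition pos_part :: "L2 \<Rightarrow> L2" is "\<lambda>f z. max (f z) 0"
proof -
  fix f g assume fg: "L2_rel f g"
  have "square_integrable (\<lambda>z. max (h z) 0)" if h: "square_integrable h" for h
  proof -
    have [measurable]: "h \<in> borel_measurable borel" using h by (simp add: square_integrable_def)
    have "integrable lborel (\<lambda>z. (max (h z) 0)\<^sup>2)"
    proof (rule Bochner_Integration.integrable_bound)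
      show "integrable lborel (\<lambda>z. (h z)\<^sup>2)" using h by (simp add: square_integrable_def)
      show "AE z in lborel. norm ((max (h z) 0)\<^sup>2) \<le> norm ((h z)\<^sup>2)"
        by (simp add: abs_le_square_iff[symmetric])
    qed measurable
    then show ?thesis by (simp add: square_integrable_def)
  qed
  moreover have "AE z in lborel. max (f z) 0 = max (g z) 0"
    using fg unfolding L2_rel_def by (auto elim: eventually_mono)
  ultimately show "L2_rel (\<lambda>z. max (f z) 0) (\<lambda>z. max (g z) 0)"
    using fg by (simp add: L2_rel_def)
qed

lemma rep_pos_part_AE: "AE z in lborel. rep_L2 (pos_part f) z = max (rep_L2 f z) 0"
proof -
  have "L2_rel (rep_L2 f) (rep_L2 f)" by (simp add: L2_rel_refl_iff square_integrable_rep)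
  then have "pos_part f = abs_L2 (\<lambda>z. max (rep_L2 f z) 0)" "L2_rel (\<lambda>z. max (rep_L2 f z) 0) (\<lambda>z. max (rep_L2 f z) 0)"
    using pos_part.abs_eq[of "rep_L2 f"] pos_part.rsp by (auto simp: abs_rep_L2 rel_fun_def)
  then show ?thesis
    using rep_abs_AE by (simp add: L2_rel_refl_iff)
qed

text \<open>The scalar positive part is 1-Lipschitz; this is the source of the continuity of
  \<open>pos_part\<close>.\<close>

lemma norm_pos_part_diff_le: "norm (pos_part f - pos_part g) \<le> norm (f - g)"
proof (rule norm_L2_mono)
  show "AE z in lborel. \<bar>rep_L2 (pos_part f - pos_part g) z\<bar> \<le> \<bar>rep_L2 (f - g) z\<bar>"
    using rep_diff_AE[of "pos_part f" "pos_part g"] rep_diff_AE[of f g]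
      rep_pos_part_AE[of f] rep_pos_part_AE[of g]
    by eventually_elim auto
qed

lemma tendsto_pos_part [tendsto_intros]:
  assumes "(f \<longlongrightarrow> l) F"
  shows "((\<lambda>x. pos_part (f x)) \<longlongrightarrow> pos_part l) F"
proof -
  have "((\<lambda>x. norm (f x - l)) \<longlongrightarrow> 0) F"
    using assms by (simp add: LIM_zero_iff tendsto_norm_zero_iff)
  then have "((\<lambda>x. pos_part (f x) - pos_part l) \<longlongrightarrow> 0) F"
    by (rule Lim_null_comparison[rotated]) (simp add: norm_pos_part_diff_le)
  then show ?thesis by (simp add: LIM_zero_iff)
qed

lemma pos_part_eq_0_iff: "pos_part f = 0 \<longleftrightarrow> (AE z in lborel. rep_L2 f z \<le> 0)"
proof
  assume "pos_part f = 0"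
  with rep_pos_part_AE[of f] rep_zero_AE show "AE z in lborel. rep_L2 f z \<le> 0"
    by (auto elim!: AE_mp)
next
  assume "AE z in lborel. rep_L2 f z \<le> 0"
  with rep_pos_part_AE[of f] rep_zero_AE show "pos_part f = 0"
    by (intro L2_eqI) (auto elim!: AE_mp)
qed

text \<open>The function (max s 0)^2 has derivative 2 max s 0, which is 2-Lipschitz, so its
  first-order Taylor remainder is at most the square of the increment. Integrating this makes the
  squared norm of the positive part differentiable with a quadratic remainder.\<close>

lemma power2_norm_pos_part_add:
  "\<bar>(norm (pos_part (f + h)))\<^sup>2 - (norm (pos_part f))\<^sup>2 - 2 * inner (pos_part f) h\<bar> \<le> (norm h)\<^sup>2"
proof -
  let ?g = "\<lambda>z. (rep_L2 (pos_part (f + h)) z)\<^sup>2 - (rep_L2 (pos_part f) z)\<^sup>2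
    - 2 * (rep_L2 (pos_part f) z * rep_L2 h z)"
  have int: "integrable lborel ?g"
    by (intro Bochner_Integration.integrable_diff integrable_rep_power2
        Bochner_Integration.integrable_mult_right integrable_rep_mult)
  have "(norm (pos_part (f + h)))\<^sup>2 - (norm (pos_part f))\<^sup>2 - 2 * inner (pos_part f) h = (LINT z|lborel. ?g z)"
    by (simp add: power2_norm_L2 inner_L2_eq integrable_rep_power2 integrable_rep_mult)
  also have "\<bar>\<dots>\<bar> \<le> (LINT z|lborel. \<bar>?g z\<bar>)"
    using integral_norm_bound[of lborel ?g] by simp
  also have "\<dots> \<le> (LINT z|lborel. (rep_L2 h z)\<^sup>2)"
  proof (rule integral_mono_AE)
    \<comment> \<open>If s and s + t have the same sign, the remainder is t^2 or 0; only a change of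
      sign needs an argument.\<close>
    have *: "\<bar>(max (s + t) 0)\<^sup>2 - (max s 0)\<^sup>2 - 2 * (max s 0 * t)\<bar> \<le> t\<^sup>2" for s t :: real
    proof (cases "s \<ge> 0"; cases "s + t \<ge> 0")
      assume "s \<ge> 0" "\<not> s + t \<ge> 0"
      then have "0 \<le> s * (- s - t)" "0 \<le> (s + t)\<^sup>2" "s * t \<le> 0"
        by (auto simp: zero_le_mult_iff mult_le_0_iff)
      then show ?thesis using \<open>s \<ge> 0\<close> \<open>\<not> s + t \<ge> 0\<close>
        by (auto simp: power2_eq_square algebra_simps abs_if)
    next
      assume "\<not> s \<ge> 0" "s + t \<ge> 0"
      then have "(s + t)\<^sup>2 \<le> t\<^sup>2" by (intro power_mono) auto
      then show ?thesis using \<open>\<not> s \<ge> 0\<close> \<open>s + t \<ge> 0\<close> by auto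
    qed (auto simp: power2_eq_square algebra_simps)
    show "AE z in lborel. \<bar>?g z\<bar> \<le> (rep_L2 h z)\<^sup>2"
      using rep_pos_part_AE[of f] rep_pos_part_AE[of "f + h"] rep_add_AE[of f h]
      by eventually_elim (simp add: *)
  qed (use int integrable_rep_power2 in auto)
  finally show ?thesis by (simp add: power2_norm_L2)
qed

text \<open>The quadratic remainder divided by h is h times the squared norm of the difference
  quotient, which converges, so it vanishes in the limit.\<close>

lemma has_right_derivative_power2_norm_pos_part:
  assumes "((\<lambda>h. (u (t + h) - u t) /\<^sub>R h) \<longlongrightarrow> v) (at_right 0)"
  shows "((\<lambda>h. ((norm (pos_part (u (t + h))))\<^sup>2 - (norm (pos_part (u t)))\<^sup>2) / h)
    \<longlongrightarrow> 2 * inner (pos_part (u t)) v) (at_right (0::real))"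
proof -
  let ?k = "\<lambda>h. (u (t + h) - u t) /\<^sub>R h"
  let ?m = "\<lambda>h. ((norm (pos_part (u (t + h))))\<^sup>2 - (norm (pos_part (u t)))\<^sup>2) / h"
  have "((\<lambda>h. h * (norm (?k h))\<^sup>2) \<longlongrightarrow> 0 * (norm v)\<^sup>2) (at_right 0)"
    by (intro tendsto_intros assms)
  then have lim0: "((\<lambda>h. h * (norm (?k h))\<^sup>2) \<longlongrightarrow> 0) (at_right 0)" by simp
  have "\<forall>\<^sub>F h in at_right 0. norm (?m h - 2 * inner (pos_part (u t)) (?k h)) \<le> h * (norm (?k h))\<^sup>2"
    using eventually_at_right_less[of "0::real"]
  proof eventually_elim
    case (elim h)
    have "\<bar>(norm (pos_part (u (t + h))))\<^sup>2 - (norm (pos_part (u t)))\<^sup>2 - 2 * inner (pos_part (u t)) (u (t + h) - u t)\<bar>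
      \<le> (norm (u (t + h) - u t))\<^sup>2" (is "\<bar>?a\<bar> \<le> ?b")
      using power2_norm_pos_part_add[of "u t" "u (t + h) - u t"] by simp
    then have "\<bar>?a\<bar> / h \<le> ?b / h" using elim by (simp add: divide_right_mono)
    moreover have "?m h - 2 * inner (pos_part (u t)) (?k h) = ?a / h"
      by (simp add: divide_inverse algebra_simps)
    moreover have "?b / h = h * (norm (?k h))\<^sup>2"
      using elim by (simp add: power2_eq_square divide_simps)
    ultimately show ?case using elim by (simp add: abs_divide)
  qed
  then have "((\<lambda>h. ?m h - 2 * inner (pos_part (u t)) (?k h)) \<longlongrightarrow> 0) (at_right 0)"
    by (rule Lim_null_comparison[OF _ lim0])
  moreover have "((\<lambda>h. 2 * inner (pos_part (u t)) (?k h)) \<longlongrightarrow> 2 * inner (pos_part (u t)) v) (at_right 0)"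
    by (intro tendsto_intros assms)
  ultimately have "((\<lambda>h. (?m h - 2 * inner (pos_part (u t)) (?k h)) + 2 * inner (pos_part (u t)) (?k h))
    \<longlongrightarrow> 0 + 2 * inner (pos_part (u t)) v) (at_right 0)"
    by (rule tendsto_add)
  then show ?thesis by simp
qed

section \<open>Integration by parts\<close>

lemma set_integral_Icc_derivative:
  fixes p p' :: "real \<Rightarrow> real"
  assumes "a \<le> b" "\<And>z. z \<in> {a..b} \<Longrightarrow> (p has_real_derivative p' z) (at z within {a..b})"
    and "continuous_on {a..b} p'"
  shows "(LINT z:{a..b}|lborel. p' z) = p b - p a"
  unfolding set_lebesgue_integral_def
  by (rule integral_FTC_atLeastAtMost)
    (use assms in \<open>auto simp: has_real_derivative_iff_has_vector_derivative\<close>)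

text \<open>\<open>G\<close> is merely an indefinite Lebesgue integral, so the product p G need not
  be differentiable everywhere and the fundamental theorem does not apply to it. Instead f(s) p'(z)
  is integrated over the triangle s <= z in both orders: integrating in s first gives p'(z) (G z -
  c), integrating in z first gives f(s) (p L - p s).\<close>

lemma integral_by_parts_indefinite_integral:
  fixes p p' f G :: "real \<Rightarrow> real"
  assumes L: "0 \<le> L"
    and p: "\<And>z. z \<in> {0..L} \<Longrightarrow> (p has_real_derivative p' z) (at z within {0..L})"
    and p': "continuous_on {0..L} p'"
    and f: "set_integrable lborel {0..L} f"
    and G: "\<And>z. z \<in> {0..L} \<Longrightarrow> G z = c + (LINT s:{0..z}|lborel. f s)"
  shows "(LINT z:{0..L}|lborel. p z * f z) = p L * G L - p 0 * G 0 - (LINT z:{0..L}|lborel. p' z * G z)"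
proof -
  define f0 where "f0 = (\<lambda>s. indicator {0..L} s * f s)"
  define P where "P = (\<lambda>z. indicator {0..L} z * p' z)"
  have intf: "integrable lborel f0" using f by (simp add: set_integrable_def f0_def)
  have intP: "integrable lborel P"
    using borel_integrable_atLeastAtMost'[OF p'] by (simp add: set_integrable_def P_def)
  have [measurable]: "f0 \<in> borel_measurable borel" "P \<in> borel_measurable borel"
    using borel_measurable_integrable[OF intf] borel_measurable_integrable[OF intP] by auto
  \<comment> \<open>The cutoffs inside \<open>f0\<close> and \<open>P\<close> extend the triangle
    kernel by zero to the whole plane, where Fubini is applied.\<close>
  define k where "k = (\<lambda>(s::real, z). if s \<le> z then f0 s * P z else 0)"
  have [measurable]: "k \<in> borel_measurable (lborel \<Otimes>\<^sub>M lborel)"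
    unfolding k_def by measurable
  have intk: "integrable lborel (\<lambda>z. k (s, z))" for s
    by (rule Bochner_Integration.integrable_bound[of lborel "\<lambda>z. f0 s * P z"])
      (auto simp: k_def intP)
  have "integrable (lborel \<Otimes>\<^sub>M lborel) k"
  proof (rule lborel_pair.Fubini_integrable)
    show "integrable lborel (\<lambda>s. LINT z|lborel. norm (k (s, z)))"
    proof (rule Bochner_Integration.integrable_bound[of lborel "\<lambda>s. f0 s * (LINT z|lborel. \<bar>P z\<bar>)"])
      show "AE s in lborel. norm (LINT z|lborel. norm (k (s, z))) \<le> norm (f0 s * (LINT z|lborel. \<bar>P z\<bar>))"
      proof (rule AE_I2)
        fix s
        have "(LINT z|lborel. norm (k (s, z))) \<le> (LINT z|lborel. \<bar>f0 s\<bar> * \<bar>P z\<bar>)"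
          by (intro integral_mono integrable_norm intk) (auto simp: k_def abs_mult intP)
        then show "norm (LINT z|lborel. norm (k (s, z))) \<le> norm (f0 s * (LINT z|lborel. \<bar>P z\<bar>))"
          by (simp add: abs_mult)
      qed
    qed (use intf in auto)
  qed (use intk in auto)
  then have fub: "(LINT z|lborel. (LINT s|lborel. k (s, z))) = (LINT s|lborel. (LINT z|lborel. k (s, z)))"
    using lborel_pair.Fubini_integral[of "\<lambda>s z. k (s, z)"] by simp
  have ftc: "(LINT z:{s..L}|lborel. p' z) = p L - p s" if "s \<in> {0..L}" for s
  proof (rule set_integral_Icc_derivative)
    have sub: "{s..L} \<subseteq> {0..L}" using that by auto
    show "(p has_real_derivative p' z) (at z within {s..L})" if "z \<in> {s..L}" for z
      by (rule DERIV_subset[OF p sub]) (use that sub in blast)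
    show "continuous_on {s..L} p'" by (rule continuous_on_subset[OF p' sub])
  qed (use that in auto)
  have inner1: "(LINT s|lborel. k (s, z)) = P z * (G z - c)" for z
  proof (cases "z \<in> {0..L}")
    case True
    then have "(\<lambda>s. k (s, z)) = (\<lambda>s. P z * (indicator {0..z} s * f s))"
      by (auto simp: k_def f0_def indicator_def)
    then show ?thesis using G[OF True] by (simp add: set_lebesgue_integral_def)
  next
    case False
    then have "(\<lambda>s. k (s, z)) = (\<lambda>s. 0)" "P z = 0"
      by (auto simp: k_def P_def)
    then show ?thesis by simp
  qed
  have inner2: "(LINT z|lborel. k (s, z)) = f0 s * (p L - p s)" for s
  proof (cases "s \<in> {0..L}")
    case True
    then have "(\<lambda>z. k (s, z)) = (\<lambda>z. f0 s * (indicator {s..L} z * p' z))"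
      by (auto simp: k_def P_def indicator_def)
    then show ?thesis using ftc[OF True] by (simp add: set_lebesgue_integral_def)
  next
    case False
    then have "(\<lambda>z. k (s, z)) = (\<lambda>z. 0)" "f0 s = 0"
      by (auto simp: k_def f0_def)
    then show ?thesis by simp
  qed
  have contp: "continuous_on {0..L} p"
    unfolding continuous_on_eq_continuous_within using p by (blast intro: DERIV_continuous)
  have contG: "continuous_on {0..L} G"
  proof (rule continuous_on_eq)
    have "f integrable_on {0..L}" using set_borel_integral_eq_integral(1)[OF f] .
    then show "continuous_on {0..L} (\<lambda>z. c + integral {0..z} f)"
      by (intro continuous_intros indefinite_integral_continuous_1)
    show "c + integral {0..z} f = G z" if "z \<in> {0..L}" for z
      using G[OF that] set_borel_integral_eq_integral(2)[OF set_integrable_subset[OF f]] that by simp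
  qed
  have intPG: "integrable lborel (\<lambda>z. P z * G z)"
    using borel_integrable_atLeastAtMost'[OF continuous_on_mult[OF p' contG]]
    by (simp add: set_integrable_def P_def mult.assoc)
  obtain B where B: "\<And>s. s \<in> {0..L} \<Longrightarrow> \<bar>p s\<bar> \<le> B"
  proof -
    have "bounded (p ` {0..L})" by (intro compact_imp_bounded compact_continuous_image contp) auto
    then obtain b where "\<forall>x\<in>p ` {0..L}. norm x \<le> b" unfolding bounded_iff ..
    then show thesis by (intro that[of b]) simp
  qed
  have intfp: "integrable lborel (\<lambda>s. f0 s * p s)"
  proof (rule Bochner_Integration.integrable_bound[of lborel "\<lambda>s. B * f0 s"])
    have [measurable]: "(\<lambda>s. indicator {0..L} s *\<^sub>R p s) \<in> borel_measurable borel"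
      by (rule borel_measurable_continuous_on_indicator[OF _ contp]) measurable
    have "(\<lambda>s. f0 s * (indicator {0..L} s *\<^sub>R p s)) \<in> borel_measurable lborel"
      by measurable
    moreover have "(\<lambda>s. f0 s * (indicator {0..L} s *\<^sub>R p s)) = (\<lambda>s. f0 s * p s)"
      by (auto simp: f0_def indicator_def)
    ultimately show "(\<lambda>s. f0 s * p s) \<in> borel_measurable lborel" by simp
    show "AE s in lborel. norm (f0 s * p s) \<le> norm (B * f0 s)"
    proof (rule AE_I2)
      fix s
      show "norm (f0 s * p s) \<le> norm (B * f0 s)"
      proof (cases "s \<in> {0..L}")
        case True
        have "\<bar>p s\<bar> \<le> \<bar>B\<bar>" using order_trans[OF B[OF True] abs_ge_self] .
        then show ?thesis by (simp add: abs_mult mult.commute[of _ "\<bar>f0 s\<bar>"] mult_left_mono)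
      qed (simp add: f0_def)
    qed
  qed (use intf in auto)
  have "(LINT z|lborel. P z * G z) - c * (LINT z|lborel. P z) = p L * (LINT s|lborel. f0 s) - (LINT s|lborel. f0 s * p s)"
  proof -
    have "(LINT z|lborel. P z * G z) - c * (LINT z|lborel. P z) = (LINT z|lborel. P z * G z - c * P z)"
      using intPG intP by simp
    also have "\<dots> = (LINT s|lborel. p L * f0 s - f0 s * p s)"
      using fub unfolding inner1 inner2 by (simp only: right_diff_distrib mult.commute)
    also have "\<dots> = p L * (LINT s|lborel. f0 s) - (LINT s|lborel. f0 s * p s)"
      using intf intfp by simp
    finally show ?thesis .
  qed
  moreover have "(LINT z|lborel. P z) = p L - p 0"
    using ftc[of 0] L by (simp add: set_lebesgue_integral_def P_def)
  moreover have "(LINT s|lborel. f0 s) = G L - c" "G 0 = c"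
  proof -
    show "(LINT s|lborel. f0 s) = G L - c" using G[of L] L by (simp add: set_lebesgue_integral_def f0_def)
    \<comment> \<open>The integral over a single point vanishes, which identifies c with the
      boundary value \<open>G 0\<close>.\<close>
    have "(LINT s:{0..0::real}|lborel. f s) = 0"
      using integral_cong_AE[of "\<lambda>s. indicator {0..0} s * f s" lborel "\<lambda>_. 0"]
        set_borel_integral_eq_integral(2)[OF set_integrable_subset[OF f, of "{0..0}"]] L by simp
    then show "G 0 = c" using G[of 0] L by simp
  qed
  moreover have "(LINT z|lborel. P z * G z) = (LINT z:{0..L}|lborel. p' z * G z)"
    by (simp add: set_lebesgue_integral_def P_def mult.assoc)
  moreover have "(LINT s|lborel. f0 s * p s) = (LINT z:{0..L}|lborel. p z * f z)"
    by (simp add: set_lebesgue_integral_def f0_def mult_ac)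
  ultimately show ?thesis by (simp add: algebra_simps)
qed


section \<open>Continuous representatives and Sobolev data\<close>

text \<open>On a bounded interval square integrability implies integrability: pair the function with
  the indicator, itself square-integrable.\<close>

lemma set_integrable_rep: "set_integrable lborel {a..b} (rep_L2 f)"
proof -
  have "square_integrable (indicator {a..b})"
    by (simp add: square_integrable_def power2_eq_square indicator_inter_arith[symmetric]
        emeasure_lborel_Icc_eq)
  then show ?thesis
    using square_integrable_mult[of "indicator {a..b}" "rep_L2 f"] square_integrable_rep
    by (simp add: set_integrable_def)
qed

lemma AE_lborel_Icc_Ioo:
  fixes a b :: real
  shows "AE z in lborel. z \<in> {a..b} \<longleftrightarrow> z \<in> {a<..<b}"
proof -
  have "AE z in lborel. z \<noteq> a \<and> z \<noteq> b"
    using AE_lborel_singleton[of a] AE_lborel_singleton[of b] by eventually_elim simp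
  then show ?thesis by eventually_elim auto
qed

text \<open>The class vanishes outside the open interval and the endpoints form a null set.
  Measurability goes through \<open>p\<close> cut off by the indicator, since outside [0, L] nothing
  is known about \<open>p\<close>.\<close>

lemma inner_represents:
  assumes "continuous_on {0..L} p" "represents L p u"
  shows "inner u v = (LINT z:{0..L}|lborel. p z * rep_L2 v z)"
  unfolding inner_L2_eq set_lebesgue_integral_def
proof (rule integral_cong_AE)
  have [measurable]: "(\<lambda>z. indicator {0..L} z *\<^sub>R p z) \<in> borel_measurable borel"
    by (rule borel_measurable_continuous_on_indicator[OF _ assms(1)]) measurable
  have "(\<lambda>z. (indicator {0..L} z *\<^sub>R p z) * rep_L2 v z) \<in> borel_measurable lborel"
    by measurable
  then show "(\<lambda>z. indicator {0..L} z *\<^sub>R (p z * rep_L2 v z)) \<in> borel_measurable lborel"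
    by (simp add: mult.assoc)
  have "AE z in lborel. z \<notin> {0<..<L} \<longrightarrow> rep_L2 u z = 0" "AE z in lborel. z \<in> {0<..<L} \<longrightarrow> rep_L2 u z = p z"
    using assms(2) by (auto simp: represents_def L2_on_def)
  with AE_lborel_Icc_Ioo[of 0 L]
  show "AE z in lborel. rep_L2 u z * rep_L2 v z = indicator {0..L} z *\<^sub>R (p z * rep_L2 v z)"
  proof eventually_elim
    case (elim z)
    then show ?case by (cases "z \<in> {0<..<L}") auto
  qed
qed measurable

lemma represents_pos_part:
  assumes "represents L g f"
  shows "represents L (\<lambda>z. max (g z) 0) (pos_part f)"
proof -
  have 1: "AE z in lborel. z \<notin> {0<..<L} \<longrightarrow> rep_L2 f z = 0"
    and 2: "AE z in lborel. z \<in> {0<..<L} \<longrightarrow> rep_L2 f z = g z"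
    using assms by (auto simp: represents_def L2_on_def)
  show ?thesis
    unfolding represents_def L2_on_def mem_Collect_eq
  proof
    show "AE z in lborel. z \<notin> {0<..<L} \<longrightarrow> rep_L2 (pos_part f) z = 0"
      using 1 rep_pos_part_AE[of f] by eventually_elim auto
    show "AE z in lborel. z \<in> {0<..<L} \<longrightarrow> rep_L2 (pos_part f) z = max (g z) 0"
      using 2 rep_pos_part_AE[of f] by eventually_elim auto
  qed
qed

lemma
  assumes "H2_data L f g g' f''"
  shows H2_data_represents: "represents L g f"
    and H2_data_on: "f'' \<in> L2_on L"
    and H2_data_deriv: "z \<in> {0..L} \<Longrightarrow> (g has_real_derivative g' z) (at z within {0..L})"
    and H2_data_deriv2: "z \<in> {0..L} \<Longrightarrow> g' z = g' 0 + (LINT s:{0..z}|lborel. rep_L2 f'' s)"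
  using assms unfolding H2_data_def by blast+

lemma H2_data_continuous:
  assumes "H2_data L f g g' f''"
  shows "continuous_on {0..L} g" "continuous_on {0..L} g'"
proof -
  show "continuous_on {0..L} g"
    using H2_data_deriv[OF assms] unfolding continuous_on_eq_continuous_within by (blast intro: DERIV_continuous)
  show "continuous_on {0..L} g'"
  proof (rule continuous_on_eq)
    have "rep_L2 f'' integrable_on {0..L}"
      using set_borel_integral_eq_integral(1)[OF set_integrable_rep] .
    then show "continuous_on {0..L} (\<lambda>z. g' 0 + integral {0..z} (rep_L2 f''))"
      by (intro continuous_intros indefinite_integral_continuous_1)
    show "g' 0 + integral {0..z} (rep_L2 f'') = g' z" if "z \<in> {0..L}" for z
      using H2_data_deriv2[OF assms that] set_borel_integral_eq_integral(2)[OF set_integrable_rep[of 0 z f'']]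
      by simp
  qed
qed

section \<open>Energy inequality for the positive part\<close>

text \<open>A differentiable approximation of max s 0 with uniform error at most \<epsilon> and
  slope in [0, 1], for \<epsilon> > 0. It can be composed with g and integrated by parts, while max
  (g z) 0 may have kinks where g changes sign.\<close>

definition smooth_pos :: "real \<Rightarrow> real \<Rightarrow> real" where
  "smooth_pos \<epsilon> s = (s + sqrt (s\<^sup>2 + \<epsilon>\<^sup>2)) / 2"

definition smooth_pos_deriv :: "real \<Rightarrow> real \<Rightarrow> real" where
  "smooth_pos_deriv \<epsilon> s = (1 + s / sqrt (s\<^sup>2 + \<epsilon>\<^sup>2)) / 2"

context
  fixes \<epsilon> :: real
  assumes \<epsilon>: "0 < \<epsilon>"
begin

lemma smooth_pos_has_derivative:
  "(smooth_pos \<epsilon> has_real_derivative smooth_pos_deriv \<epsilon> s) (at s)"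
proof -
  have "0 < s\<^sup>2 + \<epsilon>\<^sup>2" using \<epsilon> by (simp add: add_nonneg_pos)
  then show ?thesis
    unfolding smooth_pos_def smooth_pos_deriv_def
    by (auto intro!: derivative_eq_intros simp: divide_simps)
qed

lemma continuous_smooth_pos_deriv: "continuous_on S (smooth_pos_deriv \<epsilon>)"
proof -
  have "sqrt (s\<^sup>2 + \<epsilon>\<^sup>2) \<noteq> 0" for s using \<epsilon> by (simp add: sum_power2_eq_zero_iff)
  then show ?thesis
    unfolding smooth_pos_deriv_def by (intro continuous_intros) auto
qed

lemma smooth_pos_deriv_bounds: "0 \<le> smooth_pos_deriv \<epsilon> s" "smooth_pos_deriv \<epsilon> s \<le> 1"
proof -
  have pos: "0 < sqrt (s\<^sup>2 + \<epsilon>\<^sup>2)" using \<epsilon> by (simp add: add_nonneg_pos)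
  have "\<bar>s\<bar> \<le> sqrt (s\<^sup>2 + \<epsilon>\<^sup>2)" by (intro real_le_rsqrt) simp
  then have "\<bar>s / sqrt (s\<^sup>2 + \<epsilon>\<^sup>2)\<bar> \<le> 1" using pos by (simp add: abs_divide)
  then show "0 \<le> smooth_pos_deriv \<epsilon> s" "smooth_pos_deriv \<epsilon> s \<le> 1"
    unfolding smooth_pos_deriv_def by (auto simp only: abs_le_iff) (simp_all)
qed

lemma smooth_pos_approx: "\<bar>smooth_pos \<epsilon> s - max s 0\<bar> \<le> \<epsilon>"
proof -
  have "\<bar>s\<bar> \<le> sqrt (s\<^sup>2 + \<epsilon>\<^sup>2)" by (intro real_le_rsqrt) simp
  moreover have "sqrt (s\<^sup>2 + \<epsilon>\<^sup>2) \<le> \<bar>s\<bar> + \<epsilon>"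
    using \<epsilon> by (intro real_le_lsqrt) (auto simp: power2_sum)
  moreover have eq: "smooth_pos \<epsilon> s - max s 0 = (sqrt (s\<^sup>2 + \<epsilon>\<^sup>2) - \<bar>s\<bar>) / 2"
    unfolding smooth_pos_def by (cases "0 \<le> s") (simp_all add: field_simps)
  ultimately show ?thesis unfolding eq using \<epsilon> by (subst abs_of_nonneg) auto
qed

text \<open>Integration by parts leaves the integral of p' g' with p' = d g'. Since the slope d lies
  in [0, 1], d^2 <= d, hence p' g' >= (p')^2, and Cauchy-Schwarz bounds the integral of (p')^2 below
  by the squared total increment divided by L.\<close>

lemma H2_smooth_pos_inequality:
  assumes L: "0 < L" and f: "H2_data L f g g' f''"
  shows "(LINT z:{0..L}|lborel. smooth_pos \<epsilon> (g z) * rep_L2 f'' z)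
      + (smooth_pos \<epsilon> (g L) - smooth_pos \<epsilon> (g 0))\<^sup>2 / L
    \<le> smooth_pos \<epsilon> (g L) * g' L - smooth_pos \<epsilon> (g 0) * g' 0"
proof -
  define p where "p = (\<lambda>z. smooth_pos \<epsilon> (g z))"
  define p' where "p' = (\<lambda>z. smooth_pos_deriv \<epsilon> (g z) * g' z)"
  note cont = H2_data_continuous[OF f]
  have p: "(p has_real_derivative p' z) (at z within {0..L})" if "z \<in> {0..L}" for z
    unfolding p_def p'_def
    by (rule DERIV_chain2[OF smooth_pos_has_derivative H2_data_deriv[OF f that]])
  have contp': "continuous_on {0..L} p'"
    unfolding p'_def
    by (intro continuous_on_mult cont continuous_on_compose2[OF continuous_smooth_pos_deriv[of UNIV] cont(1)]) auto
  have "(LINT z:{0..L}|lborel. p z * rep_L2 f'' z) = p L * g' L - p 0 * g' 0 - (LINT z:{0..L}|lborel. p' z * g' z)"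
  proof (rule integral_by_parts_indefinite_integral)
    show "g' z = g' 0 + (LINT s:{0..z}|lborel. rep_L2 f'' s)" if "z \<in> {0..L}" for z
      by (rule H2_data_deriv2[OF f that])
  qed (use L p contp' set_integrable_rep in auto)
  moreover have "(p L - p 0)\<^sup>2 / L \<le> (LINT z:{0..L}|lborel. p' z * g' z)"
  proof -
    \<comment> \<open>The mean slope of p. The tangent bound 2 c s - c^2 <= s^2, integrated with
      this optimal c, is exactly the required Cauchy-Schwarz estimate.\<close>
    define c where "c = (p L - p 0) / L"
    have int1: "set_integrable lborel {0..L} p'"
      by (rule borel_integrable_atLeastAtMost'[OF contp'])
    have int2: "set_integrable lborel {0..L} (\<lambda>z. p' z * g' z)"
      by (intro borel_integrable_atLeastAtMost' continuous_on_mult contp' cont)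
    have int3: "set_integrable lborel {0..L} (\<lambda>z. c\<^sup>2)"
      by (intro borel_integrable_atLeastAtMost' continuous_intros)
    have "2 * c * p' z - c\<^sup>2 \<le> p' z * g' z" for z
    proof -
      let ?d = "smooth_pos_deriv \<epsilon> (g z)"
      have "?d * ?d \<le> ?d * 1" using smooth_pos_deriv_bounds[of "g z"] by (intro mult_left_mono) auto
      then have "?d * ?d * (g' z)\<^sup>2 \<le> ?d * (g' z)\<^sup>2" by (intro mult_right_mono) auto
      moreover have "0 \<le> (p' z - c)\<^sup>2" by simp
      ultimately show ?thesis unfolding p'_def by (simp add: power2_eq_square algebra_simps)
    qed
    then have "(LINT z:{0..L}|lborel. 2 * c * p' z - c\<^sup>2) \<le> (LINT z:{0..L}|lborel. p' z * g' z)"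
      by (intro set_integral_mono set_integral_diff int2 int3 set_integrable_mult_right impI int1)
    moreover have "(LINT z:{0..L}|lborel. 2 * c * p' z - c\<^sup>2) = 2 * c * (p L - p 0) - c\<^sup>2 * L"
    proof -
      have int4: "set_integrable lborel {0..L} (\<lambda>z. 2 * c * p' z)"
        using int1 by (rule set_integrable_mult_right)
      have "(LINT z:{0..L}|lborel. c\<^sup>2) = c\<^sup>2 * L"
        using L by (simp add: set_lebesgue_integral_def)
      moreover have "(LINT z:{0..L}|lborel. 2 * c * p' z) = 2 * c * (p L - p 0)"
        using set_integral_Icc_derivative[OF less_imp_le[OF L] p contp'] by simp
      ultimately show ?thesis
        unfolding set_integral_diff(2)[OF int4 int3] by simp
    qed
    moreover have "2 * c * (p L - p 0) - c\<^sup>2 * L = (p L - p 0)\<^sup>2 / L"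
      unfolding c_def using L by (simp add: power2_eq_square divide_simps)
    ultimately show ?thesis by simp
  qed
  ultimately show ?thesis unfolding p_def by linarith
qed

end

text \<open>The quotient bounds the Dirichlet energy of the positive part from below, by the
  Cauchy--Schwarz inequality; this avoids weak derivatives of \<open>max (g z) 0\<close>.\<close>

lemma H2_pos_part_inequality:
  assumes L: "0 < L" and f: "H2_data L f g g' f''"
  shows "inner (pos_part f) f'' + (max (g L) 0 - max (g 0) 0)\<^sup>2 / L
    \<le> max (g L) 0 * g' L - max (g 0) 0 * g' 0"
proof -
  define e where "e = (\<lambda>n. inverse (real (Suc n)))"
  have e: "0 < e n" for n unfolding e_def by simp
  have e0: "e \<longlonglongrightarrow> 0" unfolding e_def by (rule LIMSEQ_inverse_real_of_nat)
  note cont = H2_data_continuous[OF f]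
  have lim: "(\<lambda>n. smooth_pos (e n) s) \<longlonglongrightarrow> max s 0" for s
  proof -
    have "(\<lambda>n. smooth_pos (e n) s - max s 0) \<longlonglongrightarrow> 0"
      by (rule Lim_null_comparison[OF _ e0]) (simp add: smooth_pos_approx e)
    then show ?thesis by (simp add: LIM_zero_iff)
  qed
  let ?I = "\<lambda>p. (LINT z:{0..L}|lborel. p (g z) * rep_L2 f'' z)"
  have bddint: "set_integrable lborel {0..L} (\<lambda>z. p z * rep_L2 f'' z)" if p: "continuous_on {0..L} p" for p
  proof -
    obtain b where b: "\<forall>x\<in>p ` {0..L}. norm x \<le> b"
      using compact_imp_bounded[OF compact_continuous_image[OF p compact_Icc]] unfolding bounded_iff ..
    have [measurable]: "(\<lambda>z. indicator {0..L} z *\<^sub>R p z) \<in> borel_measurable borel"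
      by (rule borel_measurable_continuous_on_indicator[OF _ p]) measurable
    have "integrable lborel (\<lambda>z. (indicator {0..L} z *\<^sub>R p z) * rep_L2 f'' z)"
    proof (rule Bochner_Integration.integrable_bound)
      show "integrable lborel (\<lambda>z. b * (indicator {0..L} z *\<^sub>R rep_L2 f'' z))"
        using set_integrable_rep[of 0 L f''] unfolding set_integrable_def by (rule integrable_mult_right)
      show "AE z in lborel. norm ((indicator {0..L} z *\<^sub>R p z) * rep_L2 f'' z)
        \<le> norm (b * (indicator {0..L} z *\<^sub>R rep_L2 f'' z))"
      proof (rule AE_I2)
        fix z
        have "\<bar>p z\<bar> \<le> \<bar>b\<bar>" if "z \<in> {0..L}" using b that by force
        then show "norm ((indicator {0..L} z *\<^sub>R p z) * rep_L2 f'' z)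
          \<le> norm (b * (indicator {0..L} z *\<^sub>R rep_L2 f'' z))"
          by (cases "z \<in> {0..L}") (simp_all add: abs_mult mult_right_mono)
      qed
    qed measurable
    then show ?thesis by (simp add: set_integrable_def mult.assoc)
  qed
  have contsm: "continuous_on {0..L} (\<lambda>z. smooth_pos (e n) (g z))" for n
    unfolding smooth_pos_def by (intro continuous_intros cont) simp
  have contmx: "continuous_on {0..L} (\<lambda>z. max (g z) 0)"
    by (intro continuous_intros cont)
  \<comment> \<open>The approximation error is at most \<open>e n\<close> uniformly in z, so it can
    be pulled out in front of the integral of the absolute value of f''.\<close>
  have limI: "(\<lambda>n. ?I (smooth_pos (e n))) \<longlonglongrightarrow> ?I (\<lambda>s. max s 0)"
  proof -
    let ?N = "LINT z:{0..L}|lborel. \<bar>rep_L2 f'' z\<bar>"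
    have abs: "set_integrable lborel {0..L} (\<lambda>z. \<bar>rep_L2 f'' z\<bar>)"
      using set_integrable_abs[OF set_integrable_rep] .
    have bound: "norm (?I (smooth_pos (e n)) - ?I (\<lambda>s. max s 0)) \<le> e n * ?N" for n
    proof -
      have "?I (smooth_pos (e n)) - ?I (\<lambda>s. max s 0)
        = (LINT z:{0..L}|lborel. smooth_pos (e n) (g z) * rep_L2 f'' z - max (g z) 0 * rep_L2 f'' z)"
        by (rule set_integral_diff(2)[symmetric]) (intro bddint contsm contmx)+
      also have "norm \<dots> \<le> (LINT z:{0..L}|lborel. norm (smooth_pos (e n) (g z) * rep_L2 f'' z - max (g z) 0 * rep_L2 f'' z))"
        by (intro set_integral_norm_bound set_integral_diff bddint contsm contmx)
      also have "\<dots> \<le> (LINT z:{0..L}|lborel. e n * \<bar>rep_L2 f'' z\<bar>)"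
      proof (rule set_integral_mono)
        show "set_integrable lborel {0..L} (\<lambda>z. norm (smooth_pos (e n) (g z) * rep_L2 f'' z - max (g z) 0 * rep_L2 f'' z))"
          by (intro set_integrable_norm set_integral_diff bddint contsm contmx)
        show "set_integrable lborel {0..L} (\<lambda>z. e n * \<bar>rep_L2 f'' z\<bar>)"
          by (intro set_integrable_mult_right impI abs)
        show "norm (smooth_pos (e n) (g z) * rep_L2 f'' z - max (g z) 0 * rep_L2 f'' z) \<le> e n * \<bar>rep_L2 f'' z\<bar>" for z
          using mult_right_mono[OF smooth_pos_approx[OF e[of n], of "g z"], of "\<bar>rep_L2 f'' z\<bar>"]
          by (simp add: left_diff_distrib[symmetric] abs_mult)
      qed
      also have "\<dots> = e n * ?N" by simp
      finally show ?thesis .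
    qed
    have "(\<lambda>n. ?I (smooth_pos (e n)) - ?I (\<lambda>s. max s 0)) \<longlonglongrightarrow> 0"
      by (rule Lim_null_comparison[OF always_eventually tendsto_mult_left_zero[OF e0, of ?N]])
        (rule allI, rule bound)
    then show ?thesis by (simp add: LIM_zero_iff)
  qed
  have "?I (\<lambda>s. max s 0) + (max (g L) 0 - max (g 0) 0)\<^sup>2 / L \<le> max (g L) 0 * g' L - max (g 0) 0 * g' 0"
  proof (rule LIMSEQ_le)
    show "(\<lambda>n. ?I (smooth_pos (e n)) + (smooth_pos (e n) (g L) - smooth_pos (e n) (g 0))\<^sup>2 / L)
      \<longlonglongrightarrow> ?I (\<lambda>s. max s 0) + (max (g L) 0 - max (g 0) 0)\<^sup>2 / L"
      by (intro tendsto_intros limI lim) (use L in auto)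
    show "(\<lambda>n. smooth_pos (e n) (g L) * g' L - smooth_pos (e n) (g 0) * g' 0)
      \<longlonglongrightarrow> max (g L) 0 * g' L - max (g 0) 0 * g' 0"
      by (intro tendsto_intros lim)
  qed (use H2_smooth_pos_inequality[OF e L f] in blast)
  then show ?thesis
    using inner_represents[OF contmx represents_pos_part[OF H2_data_represents[OF f]]] by simp
qed


section \<open>Linearity of Sobolev data\<close>

lemma represents_add:
  assumes "represents L g f" "represents L h k"
  shows "represents L (\<lambda>z. g z + h z) (f + k)"
proof -
  have "AE z in lborel. z \<in> {0<..<L} \<longrightarrow> rep_L2 f z = g z" "AE z in lborel. z \<in> {0<..<L} \<longrightarrow> rep_L2 k z = h z"
    using assms by (auto simp: represents_def)
  with rep_add_AE[of f k] have "AE z in lborel. z \<in> {0<..<L} \<longrightarrow> rep_L2 (f + k) z = g z + h z"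
    by eventually_elim auto
  then show ?thesis
    using assms subspace_add[OF L2_on_subspace] by (simp add: represents_def)
qed

lemma represents_scaleR:
  assumes "represents L g f"
  shows "represents L (\<lambda>z. r * g z) (r *\<^sub>R f)"
proof -
  have "AE z in lborel. z \<in> {0<..<L} \<longrightarrow> rep_L2 f z = g z"
    using assms by (auto simp: represents_def)
  with rep_scaleR_AE[of r f] have "AE z in lborel. z \<in> {0<..<L} \<longrightarrow> rep_L2 (r *\<^sub>R f) z = r * g z"
    by eventually_elim auto
  then show ?thesis
    using assms subspace_scale[OF L2_on_subspace] by (simp add: represents_def)
qed

lemma set_integral_rep_add:
  "(LINT s:{a..b}|lborel. rep_L2 (f + k) s) = (LINT s:{a..b}|lborel. rep_L2 f s) + (LINT s:{a..b}|lborel. rep_L2 k s)"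
proof -
  have "(LINT s:{a..b}|lborel. rep_L2 (f + k) s) = (LINT s:{a..b}|lborel. rep_L2 f s + rep_L2 k s)"
    unfolding set_lebesgue_integral_def
    by (rule integral_cong_AE) (use rep_add_AE[of f k] in \<open>auto elim: eventually_mono\<close>)
  also have "\<dots> = (LINT s:{a..b}|lborel. rep_L2 f s) + (LINT s:{a..b}|lborel. rep_L2 k s)"
    by (rule set_integral_add(2)[OF set_integrable_rep set_integrable_rep])
  finally show ?thesis .
qed

lemma set_integral_rep_scaleR:
  "(LINT s:{a..b}|lborel. rep_L2 (r *\<^sub>R f) s) = r * (LINT s:{a..b}|lborel. rep_L2 f s)"
proof -
  have "(LINT s:{a..b}|lborel. rep_L2 (r *\<^sub>R f) s) = (LINT s:{a..b}|lborel. r * rep_L2 f s)"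
    unfolding set_lebesgue_integral_def
    by (rule integral_cong_AE) (use rep_scaleR_AE[of r f] in \<open>auto elim: eventually_mono\<close>)
  then show ?thesis by simp
qed

lemma H2_data_add:
  assumes f: "H2_data L f g g' f''" and k: "H2_data L k h h' k''"
  shows "H2_data L (f + k) (\<lambda>z. g z + h z) (\<lambda>z. g' z + h' z) (f'' + k'')"
  unfolding H2_data_def
proof (intro conjI ballI)
  show "represents L (\<lambda>z. g z + h z) (f + k)"
    by (rule represents_add[OF H2_data_represents[OF f] H2_data_represents[OF k]])
  show "f'' + k'' \<in> L2_on L"
    by (rule subspace_add[OF L2_on_subspace H2_data_on[OF f] H2_data_on[OF k]])
  show "((\<lambda>z. g z + h z) has_real_derivative g' z + h' z) (at z within {0..L})" if "z \<in> {0..L}" for z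
    by (rule DERIV_add[OF H2_data_deriv[OF f that] H2_data_deriv[OF k that]])
  show "g' z + h' z = g' 0 + h' 0 + (LINT s:{0..z}|lborel. rep_L2 (f'' + k'') s)" if "z \<in> {0..L}" for z
    unfolding set_integral_rep_add
    using H2_data_deriv2[OF f that] H2_data_deriv2[OF k that] by linarith
qed

lemma H2_data_scaleR:
  assumes f: "H2_data L f g g' f''"
  shows "H2_data L (r *\<^sub>R f) (\<lambda>z. r * g z) (\<lambda>z. r * g' z) (r *\<^sub>R f'')"
  unfolding H2_data_def
proof (intro conjI ballI)
  show "represents L (\<lambda>z. r * g z) (r *\<^sub>R f)"
    by (rule represents_scaleR[OF H2_data_represents[OF f]])
  show "r *\<^sub>R f'' \<in> L2_on L"
    by (rule subspace_scale[OF L2_on_subspace H2_data_on[OF f]])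
  show "((\<lambda>z. r * g z) has_real_derivative r * g' z) (at z within {0..L})" if "z \<in> {0..L}" for z
    by (rule DERIV_cmult[OF H2_data_deriv[OF f that]])
  show "r * g' z = r * g' 0 + (LINT s:{0..z}|lborel. rep_L2 (r *\<^sub>R f'') s)" if "z \<in> {0..L}" for z
    unfolding set_integral_rep_scaleR
    using arg_cong[OF H2_data_deriv2[OF f that], of "\<lambda>x. r * x"] by (simp only: distrib_left)
qed

lemma H2_data_uminus:
  assumes "H2_data L f g g' f''"
  shows "H2_data L (- f) (\<lambda>z. - g z) (\<lambda>z. - g' z) (- f'')"
  using H2_data_scaleR[OF assms, of "-1"] by simp

lemma H2_data_diff:
  assumes "H2_data L f g g' f''" "H2_data L k h h' k''"
  shows "H2_data L (f - k) (\<lambda>z. g z - h z) (\<lambda>z. g' z - h' z) (f'' - k'')"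
  using H2_data_add[OF assms(1) H2_data_uminus[OF assms(2)]] by simp

section \<open>Classes of continuous and of twice differentiable functions\<close>

lemma square_integrable_indicator_mult:
  assumes "continuous_on {0..L} g"
  shows "square_integrable (\<lambda>z. indicator {0<..<L} z * g z)"
proof -
  have 1: "(\<lambda>z. indicator {0<..<L} z *\<^sub>R g z) \<in> borel_measurable borel"
    by (rule borel_measurable_continuous_on_indicator)
      (auto intro: continuous_on_subset[OF assms])
  have 2: "set_integrable lborel {0..L} (\<lambda>z. (g z)\<^sup>2)"
    by (intro borel_integrable_atLeastAtMost' continuous_intros assms)
  have "integrable lborel (\<lambda>z. (indicator {0<..<L} z * g z)\<^sup>2)"
    by (rule Bochner_Integration.integrable_bound[OF 2[unfolded set_integrable_def]])
      (use 1 in \<open>auto simp: indicator_def\<close>)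
  with 1 show ?thesis by (simp add: square_integrable_def)
qed

lemma represents_L2_of:
  assumes "continuous_on {0..L} g"
  shows "represents L g (L2_of L g)"
proof -
  note ae = rep_abs_AE[OF square_integrable_indicator_mult[OF assms], folded L2_of_def]
  have "AE z in lborel. z \<notin> {0<..<L} \<longrightarrow> rep_L2 (L2_of L g) z = 0" using ae by eventually_elim simp
  moreover have "AE z in lborel. z \<in> {0<..<L} \<longrightarrow> rep_L2 (L2_of L g) z = g z" using ae by eventually_elim simp
  ultimately show ?thesis by (simp add: represents_def L2_on_def)
qed

text \<open>Classical twice differentiable functions with continuous second derivative enter the
  Sobolev space here; it is applied to polynomials for density and to cosines for the
  eigenfunctions.\<close>

lemma H2_data_L2_of:
  assumes g: "\<And>z. z \<in> {0..L} \<Longrightarrow> (g has_real_derivative g' z) (at z within {0..L})"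
    and g': "\<And>z. z \<in> {0..L} \<Longrightarrow> (g' has_real_derivative h z) (at z within {0..L})"
    and h: "continuous_on {0..L} h"
  shows "H2_data L (L2_of L g) g g' (L2_of L h)"
  unfolding H2_data_def
proof (intro conjI ballI)
  have "continuous_on {0..L} g"
    unfolding continuous_on_eq_continuous_within using g by (blast intro: DERIV_continuous)
  then show "represents L g (L2_of L g)" by (rule represents_L2_of)
  show "L2_of L h \<in> L2_on L" using represents_L2_of[OF h] by (simp add: represents_def)
  fix z assume z: "z \<in> {0..L}"
  then show "(g has_real_derivative g' z) (at z within {0..L})" by (rule g)
  have sub: "{0..z} \<subseteq> {0..L}" using z by auto
  have "AE s in lborel. s \<in> {0<..<L} \<longrightarrow> rep_L2 (L2_of L h) s = h s"
    using represents_L2_of[OF h] by (simp add: represents_def)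
  with AE_lborel_Icc_Ioo[of 0 L]
  have ae: "AE s in lborel. indicator {0..z} s *\<^sub>R rep_L2 (L2_of L h) s = indicator {0..z} s *\<^sub>R h s"
    by eventually_elim (use sub in \<open>auto simp: indicator_def\<close>)
  have "(LINT s:{0..z}|lborel. rep_L2 (L2_of L h) s) = (LINT s:{0..z}|lborel. h s)"
    unfolding set_lebesgue_integral_def
  proof (rule integral_cong_AE[OF _ _ ae])
    show "(\<lambda>s. indicator {0..z} s *\<^sub>R h s) \<in> borel_measurable lborel"
      using borel_measurable_continuous_on_indicator[OF _ continuous_on_subset[OF h sub]] by simp
  qed measurable
  also have "\<dots> = g' z - g' 0"
    proof (rule set_integral_Icc_derivative)
    show "(g' has_real_derivative h s) (at s within {0..z})" if "s \<in> {0..z}" for s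
      by (rule DERIV_subset[OF g' sub]) (use that sub in blast)
  qed (use z continuous_on_subset[OF h sub] in auto)
  finally show "g' z = g' 0 + (LINT s:{0..z}|lborel. rep_L2 (L2_of L h) s)" by simp
qed

section \<open>Density\<close>

text \<open>With all boundary data zero, pairs of such functions satisfy the homogeneous boundary
  conditions of \<open>coupled_op\<close> for every \<kappa> and \<gamma>, so density of this set
  gives density of the domain.\<close>

definition H2_flat :: "real \<Rightarrow> L2 set" where
  "H2_flat L = {f. \<exists>g g' f''. H2_data L f g g' f'' \<and> g 0 = 0 \<and> g' 0 = 0 \<and> g L = 0 \<and> g' L = 0}"

text \<open>The polynomial factor vanishes to second order at 0 and L and tends to 1 in between.\<close>

lemma L2_of_polynomial_in_H2_flat:
  assumes L: "0 < L" and p: "real_polynomial_function p"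
  shows "L2_of L (\<lambda>z. (1 - (1 - 2 * z / L) ^ (2 * Suc n))\<^sup>2 * p z) \<in> H2_flat L"
proof -
  define v where "v = (\<lambda>z. 1 - (1 - 2 * z / L) ^ (2 * Suc n))"
  have "real_polynomial_function (\<lambda>z. 1 + (-1) * (1 + (-2/L) * z) ^ (2 * Suc n))"
    by (intro real_polynomial_function.intros real_polynomial_function_power) auto
  then have v: "real_polynomial_function v" by (simp add: v_def)
  obtain v' where v': "real_polynomial_function v'" "\<And>z. (v has_real_derivative v' z) (at z)"
    using has_real_derivative_polynomial_function[OF v] by auto
  obtain p' where p': "real_polynomial_function p'" "\<And>z. (p has_real_derivative p' z) (at z)"
    using has_real_derivative_polynomial_function[OF p] by auto
  define q where "q = (\<lambda>z. v z * v z * p z)"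
  define q' where "q' = (\<lambda>z. 2 * v z * v' z * p z + v z * v z * p' z)"
  have "real_polynomial_function q'"
    unfolding q'_def by (intro real_polynomial_function.intros v v'(1) p p'(1))
  then obtain h where h: "real_polynomial_function h" "\<And>z. (q' has_real_derivative h z) (at z)"
    using has_real_derivative_polynomial_function by metis
  have "H2_data L (L2_of L q) q q' (L2_of L h)"
  proof (rule H2_data_L2_of)
    show "(q has_real_derivative q' z) (at z within {0..L})" for z
      unfolding q_def q'_def
      by (auto intro!: derivative_eq_intros DERIV_subset[OF v'(2)] DERIV_subset[OF p'(2)]
          simp: algebra_simps)
    show "(q' has_real_derivative h z) (at z within {0..L})" for z
      by (rule DERIV_subset[OF h(2)]) simp
    show "continuous_on {0..L} h"
      using h(1) by (simp add: continuous_on_polymonial_function real_polynomial_function_eq)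
  qed
  moreover have "v 0 = 0" "v L = 0" using L by (simp_all add: v_def)
  then have "q 0 = 0" "q' 0 = 0" "q L = 0" "q' L = 0" by (simp_all add: q_def q'_def)
  ultimately have "L2_of L q \<in> H2_flat L"
    unfolding H2_flat_def by blast
  then show ?thesis by (simp add: q_def v_def power2_eq_square)
qed

text \<open>A measurable function is an almost-everywhere limit of continuous ones. Truncation keeps
  these bounded, Weierstrass replaces them by polynomials, and the cutoff \<open>w n\<close> removes
  the boundary data; the uniform bound on (0, L) then gives convergence in norm.\<close>

lemma bounded_in_closure_H2_flat:
  assumes L: "0 < L" and f: "f \<in> L2_on L" and M: "AE z in lborel. \<bar>rep_L2 f z\<bar> \<le> M"
  shows "f \<in> closure (H2_flat L)"
proof -
  \<comment> \<open>This notion of measurability unfolds to a sequence of continuous functions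
    converging off a negligible set.\<close>
  have "rep_L2 f measurable_on UNIV"
    by (rule lebesgue_measurable_imp_measurable_on) (use sets.top[of lebesgue] in \<open>simp_all add: measurable_completion\<close>)
  then obtain N g where N: "negligible N" and g: "\<And>n. continuous_on UNIV (g n)"
    and lim: "\<And>z. z \<notin> N \<Longrightarrow> (\<lambda>n. g n z) \<longlonglongrightarrow> rep_L2 f z"
    by (auto simp: measurable_on_def)
  have "AE z in lebesgue. z \<notin> N"
    using N by (intro AE_not_in) (simp add: negligible_iff_null_sets)
  then have aeN: "AE z in lborel. z \<notin> N" by (simp add: AE_completion_iff)
  \<comment> \<open>Clamping to [-M, M] does not change the limit, because almost every value of f
    lies in that range.\<close>
  define G where "G = (\<lambda>n z. max (- M) (min M (g n z)))"
  have contG: "continuous_on {0..L} (G n)" for n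
    unfolding G_def by (intro continuous_intros continuous_on_subset[OF g]) auto
  have "\<exists>p. real_polynomial_function p \<and> (\<forall>z\<in>{0..L}. \<bar>G n z - p z\<bar> < inverse (real (Suc n)))" for n
    using Stone_Weierstrass_real_polynomial_function[OF compact_Icc contG[of n], of "inverse (real (Suc n))"]
    by (metis inverse_positive_iff_positive of_nat_0_less_iff zero_less_Suc)
  then obtain p where p: "\<And>n. real_polynomial_function (p n)"
    and Gp: "\<And>n z. z \<in> {0..L} \<Longrightarrow> \<bar>G n z - p n z\<bar> < inverse (real (Suc n))"
    by metis
  define w where "w = (\<lambda>n z. (1 - (1 - 2 * z / L) ^ (2 * Suc n))\<^sup>2)"
  define s where "s = (\<lambda>n z. indicator {0<..<L} z * (w n z * p n z))"
  have contp: "continuous_on {0..L} (p n)" for n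
    using p[of n] by (simp add: continuous_on_polymonial_function real_polynomial_function_eq)
  have contw: "continuous_on {0..L} (w n)" for n
    unfolding w_def using L by (intro continuous_intros) auto
  have abs1: "\<bar>1 - 2 * z / L\<bar> < 1" if "z \<in> {0<..<L}" for z
    using that L by (auto simp: abs_less_iff field_simps)
  have w01: "0 \<le> w n z" "w n z \<le> 1" if "z \<in> {0<..<L}" for n z
  proof -
    have "(1 - 2 * z / L) ^ (2 * Suc n) \<le> 1"
      using abs1[OF that] by (simp add: power_mult abs_square_le_1 power_le_one del: mult_Suc_right power_Suc)
    moreover have "0 \<le> (1 - 2 * z / L) ^ (2 * Suc n)" by (rule zero_le_even_power) simp
    ultimately show "w n z \<le> 1" unfolding w_def by (intro power_le_one) auto
  qed (simp add: w_def)
  have wlim: "(\<lambda>n. w n z) \<longlonglongrightarrow> 1" if "z \<in> {0<..<L}" for z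
  proof -
    have "(\<lambda>n. (1 - 2 * z / L) ^ n) \<longlonglongrightarrow> 0"
      by (rule LIMSEQ_power_zero) (use abs1[OF that] in simp)
    moreover have "filterlim (\<lambda>n. 2 * Suc n) sequentially sequentially"
      by (rule filterlim_subseq) (simp add: strict_mono_def)
    ultimately have "(\<lambda>n. (1 - 2 * z / L) ^ (2 * Suc n)) \<longlonglongrightarrow> 0"
      by (rule filterlim_compose)
    then have "(\<lambda>n. (1 - (1 - 2 * z / L) ^ (2 * Suc n))\<^sup>2) \<longlonglongrightarrow> (1 - 0)\<^sup>2"
      by (intro tendsto_intros)
    then show ?thesis by (simp add: w_def)
  qed
  have outside: "AE z in lborel. z \<notin> {0<..<L} \<longrightarrow> rep_L2 f z = 0"
    using f by (simp add: L2_on_def)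
  have "(\<lambda>n. abs_L2 (s n)) \<longlonglongrightarrow> abs_L2 (rep_L2 f)"
  proof (rule tendsto_abs_L2)
    show "square_integrable (s n)" for n
      unfolding s_def by (intro square_integrable_indicator_mult continuous_intros contp contw)
    show "square_integrable (rep_L2 f)" by (rule square_integrable_rep)
    show "AE z in lborel. (\<lambda>n. s n z) \<longlonglongrightarrow> rep_L2 f z"
      using aeN outside M
    proof eventually_elim
      case (elim z)
      show ?case
      proof (cases "z \<in> {0<..<L}")
        case True
        have "(\<lambda>n. G n z) \<longlonglongrightarrow> max (- M) (min M (rep_L2 f z))"
          unfolding G_def by (intro tendsto_intros lim elim(1))
        moreover have "max (- M) (min M (rep_L2 f z)) = rep_L2 f z" using elim(3) by auto
        ultimately have 1: "(\<lambda>n. G n z) \<longlonglongrightarrow> rep_L2 f z" by simp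
        have "(\<lambda>n. G n z - p n z) \<longlonglongrightarrow> 0"
          by (rule Lim_null_comparison[OF always_eventually LIMSEQ_inverse_real_of_nat])
            (use Gp[of z] True in \<open>auto simp: less_imp_le\<close>)
        from tendsto_diff[OF 1 this] have "(\<lambda>n. p n z) \<longlonglongrightarrow> rep_L2 f z" by simp
        from tendsto_mult[OF wlim[OF True] this] show ?thesis using True by (simp add: s_def)
      qed (use elim in \<open>simp add: s_def\<close>)
    qed
    \<comment> \<open>The bound 2 M + 1 is the sum of M for f and M + 1 for the polynomial, which is
      within 1 of a function bounded by M; the cutoff lies between 0 and 1.\<close>
    show "AE z in lborel. (s n z - rep_L2 f z)\<^sup>2 \<le> indicator {0<..<L} z * (2 * M + 1)\<^sup>2" for n
      using outside M
    proof eventually_elim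
      case (elim z)
      show ?case
      proof (cases "z \<in> {0<..<L}")
        case True
        have "\<bar>G n z\<bar> \<le> M" using elim(2) by (auto simp: G_def)
        moreover have "\<bar>G n z - p n z\<bar> \<le> 1"
          using Gp[of z n] True inverse_le_1_iff[of "real (Suc n)"] by auto
        ultimately have "\<bar>p n z\<bar> \<le> M + 1" by linarith
        moreover have "w n z * \<bar>p n z\<bar> \<le> 1 * \<bar>p n z\<bar>"
          by (rule mult_right_mono) (use w01[OF True] in auto)
        moreover have "\<bar>s n z\<bar> = w n z * \<bar>p n z\<bar>"
          using True w01[OF True] by (simp add: s_def abs_mult)
        ultimately have "\<bar>s n z - rep_L2 f z\<bar> \<le> \<bar>2 * M + 1\<bar>" using elim(2) by linarith
        then show ?thesis using True by (simp add: abs_le_square_iff)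
      qed (use elim in \<open>simp add: s_def\<close>)
    qed
    show "integrable lborel (\<lambda>z. indicator {0<..<L} z * (2 * M + 1)\<^sup>2)"
      using L by (intro integrable_mult_left integrable_real_indicator) auto
  qed
  moreover have "abs_L2 (s n) \<in> H2_flat L" for n
    using L2_of_polynomial_in_H2_flat[OF L p[of n], of n] by (simp add: L2_of_def s_def w_def)
  ultimately show ?thesis
    unfolding abs_rep_L2 closure_sequential by (intro exI[of _ "\<lambda>n. abs_L2 (s n)"]) simp
qed

text \<open>The truncations of f at height n are bounded, and their squared distance to f has the
  majorant f^2. Idempotence of the closure does the rest.\<close>

lemma L2_on_subset_closure_H2_flat:
  assumes L: "0 < L"
  shows "L2_on L \<subseteq> closure (H2_flat L)"
proof
  fix f assume f: "f \<in> L2_on L"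
  define s where "s = (\<lambda>n z. max (- real n) (min (real n) (rep_L2 f z)))"
  have sabs: "\<bar>s n z\<bar> \<le> \<bar>rep_L2 f z\<bar>" for n z unfolding s_def by auto
  have [measurable]: "s n \<in> borel_measurable borel" for n unfolding s_def by measurable
  have sqs: "square_integrable (s n)" for n
  proof -
    have "integrable lborel (\<lambda>z. (s n z)\<^sup>2)"
      by (rule Bochner_Integration.integrable_bound[OF integrable_rep_power2[of f]])
        (use sabs[of n] in \<open>auto simp: abs_le_square_iff\<close>)
    then show ?thesis by (simp add: square_integrable_def)
  qed
  have "(\<lambda>n. abs_L2 (s n)) \<longlonglongrightarrow> abs_L2 (rep_L2 f)"
  proof (rule tendsto_abs_L2[OF sqs square_integrable_rep])
    show "AE z in lborel. (\<lambda>n. s n z) \<longlonglongrightarrow> rep_L2 f z"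
    proof (rule AE_I2)
      fix z
      obtain m :: nat where m: "\<bar>rep_L2 f z\<bar> \<le> real m" using real_arch_simple by blast
      have "\<forall>\<^sub>F n in sequentially. s n z = rep_L2 f z"
        using eventually_ge_at_top[of m] by eventually_elim (use m in \<open>auto simp: s_def\<close>)
      then show "(\<lambda>n. s n z) \<longlonglongrightarrow> rep_L2 f z" by (rule tendsto_eventually)
    qed
    show "AE z in lborel. (s n z - rep_L2 f z)\<^sup>2 \<le> (rep_L2 f z)\<^sup>2" for n
    proof (rule AE_I2)
      fix z
      have "\<bar>s n z - rep_L2 f z\<bar> \<le> \<bar>rep_L2 f z\<bar>" unfolding s_def by auto
      then show "(s n z - rep_L2 f z)\<^sup>2 \<le> (rep_L2 f z)\<^sup>2" by (simp add: abs_le_square_iff)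
    qed
  qed (rule integrable_rep_power2)
  moreover have "abs_L2 (s n) \<in> closure (H2_flat L)" for n
  proof (rule bounded_in_closure_H2_flat[OF L])
    note ae = rep_abs_AE[OF sqs[of n]]
    show "AE z in lborel. \<bar>rep_L2 (abs_L2 (s n)) z\<bar> \<le> real n"
      using ae by eventually_elim (auto simp: s_def)
    have "AE z in lborel. z \<notin> {0<..<L} \<longrightarrow> rep_L2 f z = 0" using f by (simp add: L2_on_def)
    with ae show "abs_L2 (s n) \<in> L2_on L"
      unfolding L2_on_def mem_Collect_eq by eventually_elim (auto simp: s_def)
  qed
  ultimately have "f \<in> closure (closure (H2_flat L))"
    unfolding abs_rep_L2 closure_sequential[of f] by (intro exI[of _ "\<lambda>n. abs_L2 (s n)"]) simp
  then show "f \<in> closure (H2_flat L)" by simp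
qed


section \<open>Semigroups\<close>

text \<open>If \<phi> rose, take the last time c at which \<phi> lies below the line of a small
  slope \<epsilon> through its initial value; continuity makes it attained. A nonpositive right
  derivative at c keeps \<phi> below that line slightly beyond c, a contradiction.\<close>

lemma real_nonincreasing_of_right_derivative:
  fixes \<phi> :: "real \<Rightarrow> real"
  assumes b: "0 \<le> b" and cont: "continuous_on {0..b} \<phi>"
    and der: "\<And>t. 0 \<le> t \<Longrightarrow> t < b \<Longrightarrow> \<exists>D\<le>0. ((\<lambda>h. (\<phi> (t + h) - \<phi> t) / h) \<longlongrightarrow> D) (at_right 0)"
  shows "\<phi> b \<le> \<phi> 0"
proof (rule ccontr)
  assume "\<not> \<phi> b \<le> \<phi> 0"
  then have lt: "\<phi> 0 < \<phi> b" by simp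
  with b have b0: "0 < b" by (cases "b = 0") auto
  \<comment> \<open>Half the mean slope: positive, and small enough that \<phi> still lies strictly
    above the line at b.\<close>
  define \<epsilon> where "\<epsilon> = (\<phi> b - \<phi> 0) / (2 * b)"
  have \<epsilon>: "0 < \<epsilon>" "\<phi> 0 < \<phi> b - \<epsilon> * b" using lt b0 by (auto simp: \<epsilon>_def field_simps)
  define A where "A = {t \<in> {0..b}. \<phi> t - \<epsilon> * t \<le> \<phi> 0}"
  have "closed A"
  proof -
    have "continuous_on {0..b} (\<lambda>t. \<phi> t - \<epsilon> * t)" by (intro continuous_intros cont)
    then have "closed ({0..b} \<inter> (\<lambda>t. \<phi> t - \<epsilon> * t) -` {..\<phi> 0})"
      by (rule continuous_closed_preimage) auto
    moreover have "{0..b} \<inter> (\<lambda>t. \<phi> t - \<epsilon> * t) -` {..\<phi> 0} = A" by (auto simp: A_def)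
    ultimately show ?thesis by simp
  qed
  moreover have bdd: "bdd_above A" by (rule bdd_aboveI[of _ b]) (simp add: A_def)
  moreover have "0 \<in> A" using b by (simp add: A_def)
  ultimately have c: "Sup A \<in> A" by (intro closed_contains_Sup) auto
  define c where "c = Sup A"
  have cA: "0 \<le> c" "c \<le> b" "\<phi> c - \<epsilon> * c \<le> \<phi> 0" using c by (auto simp: c_def A_def)
  have "b \<notin> A" using \<epsilon> by (simp add: A_def)
  then have "c < b" using c cA(2) by (cases "c = b") (auto simp: c_def)
  obtain D where D: "D \<le> 0" "((\<lambda>h. (\<phi> (c + h) - \<phi> c) / h) \<longlongrightarrow> D) (at_right 0)"
    using der[OF cA(1) \<open>c < b\<close>] by blast
  have "\<forall>\<^sub>F h in at_right 0. (\<phi> (c + h) - \<phi> c) / h < \<epsilon>"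
    by (rule order_tendstoD(2)[OF D(2)]) (use D(1) \<epsilon> in simp)
  moreover have "\<forall>\<^sub>F h in at_right 0. h < b - c"
    using \<open>c < b\<close> by (intro eventually_at_rightI[of 0 "b - c"]) auto
  ultimately have "\<forall>\<^sub>F h::real in at_right 0. False"
    using eventually_at_right_less[of "0::real"]
  proof eventually_elim
    case (elim h)
    have "\<phi> (c + h) - \<phi> c < \<epsilon> * h" using elim(1,3) by (simp add: field_simps)
    then have "c + h \<in> A" using cA elim by (simp add: A_def algebra_simps)
    then have "c + h \<le> c" unfolding c_def using bdd by (rule cSup_upper)
    with elim(3) show False by simp
  qed
  then show False by simp
qed

context
  fixes X :: "'a::real_normed_vector set" and T :: "real \<Rightarrow> 'a \<Rightarrow> 'a"
  assumes sg: "C0_semigroup_on X T" and X: "subspace X"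
begin

lemma semigroup_in: "0 \<le> t \<Longrightarrow> u \<in> X \<Longrightarrow> T t u \<in> X"
  using sg by (simp add: C0_semigroup_on_def)

lemma semigroup_add: "0 \<le> t \<Longrightarrow> u \<in> X \<Longrightarrow> v \<in> X \<Longrightarrow> T t (u + v) = T t u + T t v"
  using sg by (simp add: C0_semigroup_on_def)

lemma semigroup_scaleR: "0 \<le> t \<Longrightarrow> u \<in> X \<Longrightarrow> T t (r *\<^sub>R u) = r *\<^sub>R T t u"
  using sg by (simp add: C0_semigroup_on_def)

lemma semigroup_diff: "0 \<le> t \<Longrightarrow> u \<in> X \<Longrightarrow> v \<in> X \<Longrightarrow> T t (u - v) = T t u - T t v"
  using semigroup_add[of t u "- v"] semigroup_scaleR[of t v "-1"] subspace_neg[OF X, of v] by simp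

lemma semigroup_bounded: "0 \<le> t \<Longrightarrow> \<exists>M. \<forall>u\<in>X. norm (T t u) \<le> M * norm u"
  using sg by (simp add: C0_semigroup_on_def)

lemma semigroup_0: "u \<in> X \<Longrightarrow> T 0 u = u"
  using sg by (simp add: C0_semigroup_on_def)

lemma semigroup_plus: "0 \<le> s \<Longrightarrow> 0 \<le> t \<Longrightarrow> u \<in> X \<Longrightarrow> T (s + t) u = T s (T t u)"
  using sg by (simp add: C0_semigroup_on_def)

lemma semigroup_tendsto: "u \<in> X \<Longrightarrow> ((\<lambda>t. T t u) \<longlongrightarrow> u) (at_right 0)"
  using sg by (simp add: C0_semigroup_on_def)

lemma semigroup_tendsto_compose:
  assumes "0 \<le> t" "(f \<longlongrightarrow> l) F" "\<forall>\<^sub>F x in F. f x \<in> X" "l \<in> X"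
  shows "((\<lambda>x. T t (f x)) \<longlongrightarrow> T t l) F"
proof -
  obtain M where M: "\<forall>u\<in>X. norm (T t u) \<le> M * norm u"
    using semigroup_bounded[OF assms(1)] ..
  have "((\<lambda>x. norm (f x - l)) \<longlongrightarrow> 0) F"
    using assms(2) by (simp add: LIM_zero_iff tendsto_norm_zero_iff)
  then have lim: "((\<lambda>x. M * norm (f x - l)) \<longlongrightarrow> 0) F" by (rule tendsto_mult_right_zero)
  have "((\<lambda>x. T t (f x) - T t l) \<longlongrightarrow> 0) F"
  proof (rule Lim_null_comparison[OF _ lim])
    show "\<forall>\<^sub>F x in F. norm (T t (f x) - T t l) \<le> M * norm (f x - l)"
      using assms(3)
    proof eventually_elim
      case (elim x)
      then show ?case
        using M semigroup_diff[OF assms(1) elim assms(4)] subspace_diff[OF X elim assms(4)] by auto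
    qed
  qed
  then show ?thesis by (simp add: LIM_zero_iff)
qed

text \<open>The gliding hump: the signs of the increments are chosen so that no cancellation occurs at
  the times at which the operator norms blow up.\<close>

lemma semigroup_bounded_near_0:
  assumes complete: "\<And>y. (\<And>n. y n \<in> X) \<Longrightarrow> summable (\<lambda>n. norm (y n)) \<Longrightarrow> \<exists>s\<in>X. y sums s"
  shows "\<exists>\<delta>>0. \<exists>M. \<forall>t\<in>{0..\<delta>}. \<forall>u\<in>X. norm (T t u) \<le> M * norm u"
proof (rule ccontr)
  assume contra: "\<not> ?thesis"
  define N where "N = (\<lambda>t. SUP u\<in>{u \<in> X. norm u \<le> 1}. norm (T t u))"
  have bdd: "bdd_above ((\<lambda>u. norm (T t u)) ` {u \<in> X. norm u \<le> 1})" if t: "0 \<le> t" for t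
  proof -
    obtain M where M: "\<forall>u\<in>X. norm (T t u) \<le> M * norm u" using semigroup_bounded[OF t] ..
    have "norm (T t u) \<le> \<bar>M\<bar>" if "u \<in> X" "norm u \<le> 1" for u
    proof -
      have "norm (T t u) \<le> M * norm u" using M that by blast
      also have "\<dots> \<le> \<bar>M\<bar> * norm u" by (rule mult_right_mono) auto
      also have "\<dots> \<le> \<bar>M\<bar> * 1" by (rule mult_left_mono) (use that in auto)
      finally show ?thesis by simp
    qed
    then show ?thesis by (intro bdd_aboveI2) auto
  qed
  have N0: "0 \<le> N t" if "0 \<le> t" for t
    unfolding N_def
    by (rule cSUP_upper2[OF bdd[OF that], of 0]) (use X in \<open>auto simp: subspace_0\<close>)
  have N: "norm (T t u) \<le> N t * norm u" if t: "0 \<le> t" and u: "u \<in> X" for t u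
  proof (cases "u = 0")
    case True
    then show ?thesis using semigroup_scaleR[OF t u, of 0] by simp
  next
    case False
    have "norm (T t (inverse (norm u) *\<^sub>R u)) \<le> N t"
      unfolding N_def by (rule cSUP_upper[OF _ bdd[OF t]])
        (use False subspace_scale[OF X u] in auto)
    then show ?thesis
      using False unfolding semigroup_scaleR[OF t u] by (simp add: field_simps)
  qed
  \<comment> \<open>Failure of local boundedness supplies times tending to 0 at which the operator
    norm \<open>N\<close> is at least 4^n; this growth must beat the decay 3^-n of the increments
    below.\<close>
  have "\<exists>t. 0 \<le> t \<and> t \<le> inverse (real (Suc n)) \<and> 4 ^ n \<le> N t" for n
  proof (rule ccontr)
    assume "\<not> ?thesis"
    then have "norm (T t u) \<le> 4 ^ n * norm u" if "t \<in> {0..inverse (real (Suc n))}" "u \<in> X" for t u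
      using that N[of t u] mult_right_mono[of "N t" "4 ^ n" "norm u"] by force
    with contra show False by (metis inverse_positive_iff_positive of_nat_0_less_iff zero_less_Suc)
  qed
  then obtain t where t: "\<And>n. 0 \<le> t n" "\<And>n. t n \<le> inverse (real (Suc n))" "\<And>n. 4 ^ n \<le> N (t n)"
    by metis
  have Npos: "0 < N (t n)" for n
    by (rule less_le_trans[OF _ t(3)]) simp
  \<comment> \<open>The supremum need not be attained; unit-ball vectors reaching the fraction 2/3
    of it suffice.\<close>
  have "\<exists>u\<in>X. norm u \<le> 1 \<and> 2/3 * N (t n) \<le> norm (T (t n) u)" for n
  proof -
    have "\<exists>u\<in>{u \<in> X. norm u \<le> 1}. 2/3 * N (t n) < norm (T (t n) u)"
      unfolding N_def
      by (subst less_cSUP_iff[OF _ bdd[OF t(1)], symmetric])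
        (use Npos[of n] subspace_0[OF X] in \<open>auto simp: N_def\<close>)
    then show ?thesis by force
  qed
  then obtain u where u: "\<And>n. u n \<in> X" "\<And>n. norm (u n) \<le> 1" "\<And>n. 2/3 * N (t n) \<le> norm (T (t n) (u n))"
    by metis
  \<comment> \<open>With ratio 1/3 the increments after step n add up to at most half of
    (1/3)^(n+1), below the fraction 2/3 retained at that step.\<close>
  define d where "d = (\<lambda>n. (1/3) ^ Suc n *\<^sub>R u n)"
  have dX: "d n \<in> X" for n unfolding d_def by (rule subspace_scale[OF X u(1)])
  have dnorm: "norm (d n) \<le> (1/3) ^ Suc n" for n
    unfolding d_def using u(2)[of n] by (simp add: mult_left_le power_le_one)
  define x where "x = rec_nat 0 (\<lambda>n x. if norm (T (t n) (d n)) \<le> norm (T (t n) (x + d n)) then x + d n else x - d n)"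
  have x0: "x 0 = 0" by (simp add: x_def)
  have xSuc: "x (Suc n) = (if norm (T (t n) (d n)) \<le> norm (T (t n) (x n + d n)) then x n + d n else x n - d n)" for n
    by (simp add: x_def)
  have xX: "x n \<in> X" for n
    by (induction n) (auto simp: x0 xSuc subspace_0[OF X] subspace_add[OF X] subspace_diff[OF X] dX)
  have hump: "norm (T (t n) (d n)) \<le> norm (T (t n) (x (Suc n)))" for n
  proof (cases "norm (T (t n) (d n)) \<le> norm (T (t n) (x n + d n))")
    case False
    have "2 *\<^sub>R T (t n) (d n) = T (t n) (x n + d n) - T (t n) (x n - d n)"
      by (simp add: semigroup_add semigroup_diff t(1) xX dX scaleR_2)
    then have "2 * norm (T (t n) (d n)) \<le> norm (T (t n) (x n + d n)) + norm (T (t n) (x n - d n))"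
      using norm_triangle_ineq4[of "T (t n) (x n + d n)" "T (t n) (x n - d n)"]
      by (metis abs_numeral norm_scaleR)
    with False show ?thesis by (simp add: xSuc)
  qed (simp add: xSuc)
  define y where "y = (\<lambda>n. x (Suc n) - x n)"
  have ynorm: "norm (y n) \<le> (1/3) ^ Suc n" for n
    using dnorm[of n] by (simp add: y_def xSuc)
  have "summable (\<lambda>n. norm (y n))"
    by (rule summable_comparison_test'[of "\<lambda>n. (1/3) ^ Suc n" 0])
      (use ynorm in \<open>auto intro!: summable_mult summable_geometric\<close>)
  moreover have "y n \<in> X" for n unfolding y_def by (rule subspace_diff[OF X xX xX])
  ultimately obtain s where s: "s \<in> X" "y sums s" using complete by blast
  have sumy: "(\<Sum>k<n. y k) = x n" for n
    unfolding y_def by (simp add: sum_lessThan_telescope x0)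
  then have xs: "x \<longlonglongrightarrow> s" using s(2) by (simp add: sums_def)
  have dist: "norm (x (m + j) - x m) \<le> (1/3) ^ m / 2 * (1 - (1/3) ^ j)" for m j
  proof (induction j)
    case (Suc j)
    have "norm (x (m + Suc j) - x m) \<le> norm (y (m + j)) + norm (x (m + j) - x m)"
      using norm_triangle_ineq[of "y (m + j)" "x (m + j) - x m"] by (simp add: y_def)
    also have "\<dots> \<le> (1/3) ^ Suc (m + j) + (1/3) ^ m / 2 * (1 - (1/3) ^ j)"
      by (rule add_mono[OF ynorm Suc])
    finally show ?case by (simp add: power_add field_simps)
  qed simp
  have tail: "norm (s - x m) \<le> (1/3) ^ m / 2" for m
  proof (rule LIMSEQ_le_const2)
    show "(\<lambda>j. norm (x (j + m) - x m)) \<longlonglongrightarrow> norm (s - x m)"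
      by (intro tendsto_intros LIMSEQ_ignore_initial_segment xs)
    have "norm (x (j + m) - x m) \<le> (1/3) ^ m / 2" for j
    proof -
      have "(1/3) ^ m / 2 * (1 - (1/3) ^ j) \<le> (1/3 :: real) ^ m / 2 * 1"
        by (rule mult_left_mono) auto
      from order_trans[OF dist[of m j] this] show ?thesis by (simp add: add.commute)
    qed
    then show "\<exists>N. \<forall>n\<ge>N. norm (x (n + m) - x m) \<le> (1/3) ^ m / 2" by blast
  qed
  \<comment> \<open>The margin 2/3 - 1/2 = 1/6 survives the tail; multiplied by (1/3)^(n+1) and 4^n
    it becomes (4/3)^n / 18.\<close>
  have big: "(4/3) ^ n / 18 \<le> norm (T (t n) s)" for n
  proof -
    have "norm (T (t n) (s - x (Suc n))) \<le> N (t n) * ((1/3) ^ Suc n / 2)"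
      using N[OF t(1)[of n] subspace_diff[OF X s(1) xX[of "Suc n"]]]
        mult_left_mono[OF tail[of "Suc n"] N0[OF t(1)[of n]]] by linarith
    moreover have "(1/3) ^ Suc n * (2/3 * N (t n)) \<le> norm (T (t n) (x (Suc n)))"
    proof -
      have "(1/3) ^ Suc n * (2/3 * N (t n)) \<le> (1/3) ^ Suc n * norm (T (t n) (u n))"
        by (rule mult_left_mono[OF u(3)]) simp
      also have "\<dots> = norm (T (t n) (d n))"
        unfolding d_def semigroup_scaleR[OF t(1) u(1)] by simp
      also note hump
      finally show ?thesis .
    qed
    moreover have "norm (T (t n) (x (Suc n))) \<le> norm (T (t n) s) + norm (T (t n) (s - x (Suc n)))"
      using norm_triangle_ineq4[of "T (t n) s" "T (t n) (s - x (Suc n))"]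
      by (simp add: semigroup_diff[OF t(1) s(1) xX])
    moreover have "N (t n) * ((1/3) ^ Suc n / 2) = (1/3) ^ Suc n * N (t n) / 2"
      "(1/3) ^ Suc n * (2/3 * N (t n)) = 2/3 * ((1/3) ^ Suc n * N (t n))" by simp_all
    ultimately have "(1/3) ^ Suc n * N (t n) / 6 \<le> norm (T (t n) s)" by linarith
    moreover have "(1/3) ^ Suc n * 4 ^ n \<le> (1/3) ^ Suc n * N (t n)"
      by (rule mult_left_mono[OF t(3)]) simp
    moreover have "(1/3) ^ Suc n * 4 ^ n / 6 = (4/3 :: real) ^ n / 18"
      by (simp add: power_divide)
    ultimately show ?thesis by linarith
  qed
  have "\<forall>\<^sub>F h in at_right 0. dist (T h s) s < 1"
    using tendstoD[OF semigroup_tendsto[OF s(1)], of 1] by simp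
  then obtain b where b: "0 < b" "\<And>h. 0 < h \<Longrightarrow> h < b \<Longrightarrow> dist (T h s) s < 1"
    unfolding eventually_at_right_field by auto
  have "\<forall>\<^sub>F n in sequentially. inverse (real (Suc n)) < b"
    by (rule order_tendstoD(2)[OF LIMSEQ_inverse_real_of_nat b(1)])
  moreover have "\<forall>\<^sub>F n in sequentially. 18 * (norm s + 1) < (4/3) ^ n"
  proof -
    obtain m where m: "18 * (norm s + 1) < (4/3) ^ m" using real_arch_pow[of "4/3"] by auto
    show ?thesis
      using eventually_ge_at_top[of m]
    proof eventually_elim
      case (elim n)
      have "(4/3 :: real) ^ m \<le> (4/3) ^ n" by (rule power_increasing[OF elim]) simp
      with m show ?case by linarith
    qed
  qed
  \<comment> \<open>Right continuity at 0 keeps the orbit of s within distance 1 of s for small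
    times, whereas \<open>big\<close> makes it unbounded along times tending to 0.\<close>
  ultimately have "\<forall>\<^sub>F n::nat in sequentially. False"
  proof eventually_elim
    case (elim n)
    have "dist (T (t n) s) s < 1"
      using b(2)[of "t n"] t(1,2)[of n] elim(1) semigroup_0[OF s(1)] by (cases "t n = 0") force+
    then have "norm (T (t n) s) < norm s + 1"
      using norm_triangle_ineq2[of "T (t n) s" s] by (simp add: dist_norm)
    with big[of n] elim(2) show False by simp
  qed
  then show False by simp
qed

text \<open>A time up to n \<delta> splits into steps of length at most \<delta>, each costing a
  factor M. Taking M at least 1 makes the powers increase, so that \<open>M ^ n\<close> also covers
  shorter times.\<close>

lemma semigroup_locally_bounded:
  assumes complete: "\<And>y. (\<And>n. y n \<in> X) \<Longrightarrow> summable (\<lambda>n. norm (y n)) \<Longrightarrow> \<exists>s\<in>X. y sums s"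
  shows "\<exists>M. \<forall>t\<in>{0..b}. \<forall>u\<in>X. norm (T t u) \<le> M * norm u"
proof -
  obtain \<delta> M0 where \<delta>: "0 < \<delta>" and M0: "\<And>t u. t \<in> {0..\<delta>} \<Longrightarrow> u \<in> X \<Longrightarrow> norm (T t u) \<le> M0 * norm u"
    using semigroup_bounded_near_0[OF complete] by blast
  define M where "M = max 1 M0"
  have M: "norm (T t u) \<le> M * norm u" if "t \<in> {0..\<delta>}" "u \<in> X" for t u
    using M0[OF that] mult_right_mono[of M0 M "norm u"] by (simp add: M_def)
  have "\<forall>t\<in>{0..real n * \<delta>}. \<forall>u\<in>X. norm (T t u) \<le> M ^ n * norm u" for n
  proof (induction n)
    case 0
    then show ?case by (simp add: semigroup_0)
  next
    case (Suc n)
    show ?case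
    proof (intro ballI)
      fix t u assume t: "t \<in> {0..real (Suc n) * \<delta>}" and u: "u \<in> X"
      show "norm (T t u) \<le> M ^ Suc n * norm u"
      proof (cases "t \<le> \<delta>")
        case True
        have "1 \<le> M ^ n" by (rule one_le_power) (simp add: M_def)
        then have "M * norm u \<le> M ^ Suc n * norm u"
          by (simp add: M_def mult_right_mono mult_le_cancel_left1)
        with M[of t u] t u True show ?thesis by simp
      next
        case False
        have "T t u = T (t - \<delta>) (T \<delta> u)"
          using semigroup_plus[of "t - \<delta>" \<delta> u] False \<delta> u by simp
        also have "norm \<dots> \<le> M ^ n * norm (T \<delta> u)"
        proof -
          have "t - \<delta> \<in> {0..real n * \<delta>}" using t False by (simp add: algebra_simps)
          then show ?thesis using Suc.IH semigroup_in[of \<delta> u] \<delta> u by simp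
        qed
        also have "\<dots> \<le> M ^ n * (M * norm u)"
          by (rule mult_left_mono) (use M[of \<delta> u] \<delta> u in \<open>auto simp: M_def\<close>)
        finally show ?thesis by (simp add: mult_ac)
      qed
    qed
  qed
  moreover obtain n where "b / \<delta> \<le> real n" using real_arch_simple by blast
  then have "b \<le> real n * \<delta>" using \<delta> by (simp add: field_simps)
  ultimately show ?thesis by (intro exI[of _ "M ^ n"]) force
qed

text \<open>For s <= t the increment of the orbit is \<open>T s\<close> applied to T (t - s) u - u.
  For continuity from the left the outer operator moves with the approaching time, hence the need
  for a bound uniform on [0, b].\<close>

lemma semigroup_continuous_on:
  assumes complete: "\<And>y. (\<And>n. y n \<in> X) \<Longrightarrow> summable (\<lambda>n. norm (y n)) \<Longrightarrow> \<exists>s\<in>X. y sums s"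
    and u: "u \<in> X"
  shows "continuous_on {0..b} (\<lambda>t. T t u)"
proof -
  obtain M where M: "\<And>t v. t \<in> {0..b} \<Longrightarrow> v \<in> X \<Longrightarrow> norm (T t v) \<le> M * norm v"
    using semigroup_locally_bounded[OF complete] by blast
  have *: "norm (T t u - T s u) \<le> M * norm (T (t - s) u - u)" if "s \<in> {0..b}" "s \<le> t" for s t
  proof -
    have "T t u - T s u = T s (T (t - s) u - u)"
      using semigroup_plus[of s "t - s" u] that u by (simp add: semigroup_diff semigroup_in)
    then show ?thesis
      using M[OF that(1), of "T (t - s) u - u"] u that by (simp add: semigroup_in subspace_diff[OF X])
  qed
  show ?thesis
    unfolding continuous_on_iff
  proof (intro ballI allI impI)
    fix t e :: real assume t: "t \<in> {0..b}" and e: "0 < e"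
    define e' where "e' = e / (\<bar>M\<bar> + 1)"
    have e': "0 < e'" "\<bar>M\<bar> * e' < e" using e by (auto simp: e'_def field_simps)
    have "\<forall>\<^sub>F h in at_right 0. dist (T h u) u < e'"
      by (rule tendstoD[OF semigroup_tendsto[OF u] e'(1)])
    then obtain d where d: "0 < d" "\<And>h. 0 < h \<Longrightarrow> h < d \<Longrightarrow> dist (T h u) u < e'"
      unfolding eventually_at_right_field by auto
    have small: "norm (T r u - T s u) < e" if "s \<in> {0..b}" "s \<le> r" "r - s < d" for r s
    proof -
      have "norm (T (r - s) u - u) \<le> e'"
        using d(2)[of "r - s"] that e'(1) semigroup_0[OF u] by (cases "r = s") (auto simp: dist_norm)
      then have "M * norm (T (r - s) u - u) \<le> \<bar>M\<bar> * e'" by (intro mult_mono) auto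
      with *[OF that(1,2)] e'(2) show ?thesis by linarith
    qed
    show "\<exists>d>0. \<forall>t'\<in>{0..b}. dist t' t < d \<longrightarrow> dist (T t' u) (T t u) < e"
    proof (intro exI[of _ d] conjI ballI impI d(1))
      fix t' assume t': "t' \<in> {0..b}" "dist t' t < d"
      show "dist (T t' u) (T t u) < e"
        using small[of t t'] small[of t' t] t t'
        by (cases "t \<le> t'") (auto simp: dist_norm dist_real_def norm_minus_commute)
    qed
  qed
qed

text \<open>The difference quotient of the orbit at t is the bounded operator \<open>T t\<close>
  applied to the quotient at 0. The same quotient, read as that of the initial value
  \<open>T t u\<close>, shows that the orbit stays in the domain.\<close>

lemma
  assumes uv: "(u, v) \<in> generator_on X T" and t: "0 \<le> t"
  shows semigroup_right_derivative: "((\<lambda>h. (T (t + h) u - T t u) /\<^sub>R h) \<longlongrightarrow> T t v) (at_right 0)"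
    and generator_invariant: "(T t u, T t v) \<in> generator_on X T"
proof -
  have u: "u \<in> X" and v: "v \<in> X" and lim: "((\<lambda>h. (T h u - u) /\<^sub>R h) \<longlongrightarrow> v) (at_right 0)"
    using uv by (auto simp: generator_on_def)
  have pos: "\<forall>\<^sub>F h::real in at_right 0. 0 < h" by (rule eventually_at_right_less)
  have in_X: "\<forall>\<^sub>F h in at_right 0. (T h u - u) /\<^sub>R h \<in> X"
    using pos by eventually_elim (simp add: subspace_scale[OF X] subspace_diff[OF X] semigroup_in u)
  have lim2: "((\<lambda>h. T t ((T h u - u) /\<^sub>R h)) \<longlongrightarrow> T t v) (at_right 0)"
    by (rule semigroup_tendsto_compose[OF t lim in_X v])
  have eq: "\<forall>\<^sub>F h in at_right 0. T t ((T h u - u) /\<^sub>R h) = (T (t + h) u - T t u) /\<^sub>R h"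
    using pos
    by eventually_elim
      (use t u in \<open>simp add: semigroup_scaleR semigroup_diff subspace_diff[OF X] semigroup_in semigroup_plus\<close>)
  show der: "((\<lambda>h. (T (t + h) u - T t u) /\<^sub>R h) \<longlongrightarrow> T t v) (at_right 0)"
    using Lim_transform_eventually[OF lim2 eq] .
  have "\<forall>\<^sub>F h in at_right 0. (T (t + h) u - T t u) /\<^sub>R h = (T h (T t u) - T t u) /\<^sub>R h"
    using pos by eventually_elim (use t u semigroup_plus[of _ t u] in \<open>simp add: add.commute\<close>)
  from Lim_transform_eventually[OF der this] show "(T t u, T t v) \<in> generator_on X T"
    using t u v by (simp add: generator_on_def semigroup_in)
qed

end


section \<open>The characteristic equation\<close>

context
  fixes L \<gamma> :: real
  assumes L: "0 < L" and \<gamma>: "\<gamma> < 0"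
begin

text \<open>Periodicity moves every branch of the tangent to a common interval, and the factor x + k
  pi remembers the branch.\<close>

lemma shifted_in_char_roots_iff:
  assumes x: "0 < x + real k * pi"
  shows "(x + real k * pi) / L \<in> char_roots L \<gamma> \<longleftrightarrow> cos x \<noteq> 0 \<and> tan x * (x + real k * pi) = - \<gamma> * L"
proof -
  have "cos (x + real k * pi) \<noteq> 0 \<longleftrightarrow> cos x \<noteq> 0"
    by (simp add: cos_add)
  moreover have "- \<gamma> / ((x + real k * pi) / L) = tan (x + real k * pi) \<longleftrightarrow> tan x * (x + real k * pi) = - \<gamma> * L"
    unfolding tan_periodic_nat using x by (auto simp: field_simps)
  ultimately show ?thesis
    using L x unfolding char_roots_def by (auto simp: zero_less_divide_iff)
qed

text \<open>Multiplying the equation by the cosine removes the pole. The resulting continuous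
  function is \<gamma> L < 0 at 0 and pi/2 + k pi > 0 at pi/2, so it has an interior zero.\<close>

lemma char_root_exists:
  "\<exists>x. 0 < x \<and> x < pi/2 \<and> (x + real k * pi) / L \<in> char_roots L \<gamma>"
proof -
  define f where "f = (\<lambda>x. (x + real k * pi) * sin x + \<gamma> * L * cos x)"
  have f0: "f 0 < 0" using L \<gamma> by (simp add: f_def mult_neg_pos)
  have f1: "0 < f (pi/2)" by (simp add: f_def add_pos_nonneg)
  have "\<exists>x. 0 \<le> x \<and> x \<le> pi/2 \<and> f x = 0"
    by (rule IVT') (use f0 f1 in \<open>auto simp: f_def intro!: continuous_intros\<close>)
  then obtain x where x: "0 \<le> x" "x \<le> pi/2" "f x = 0" by blast
  moreover have "x \<noteq> 0" "x \<noteq> pi/2" using x(3) f0 f1 by (metis less_irrefl)+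
  ultimately have x': "0 < x" "x < pi/2" by simp_all
  have "0 < cos x" by (rule cos_gt_zero[OF x'])
  moreover have "0 < x + real k * pi" using x' by (simp add: add_pos_nonneg)
  moreover have "tan x * (x + real k * pi) = - \<gamma> * L"
    using x(3) \<open>0 < cos x\<close> unfolding f_def tan_def by (simp add: field_simps)
  ultimately show ?thesis using x' shifted_in_char_roots_iff[of x k] by auto
qed

text \<open>On (0, pi/2) the product tan x (x + k pi) has two positive strictly increasing factors,
  so it takes the value -\<gamma> L at most once.\<close>

lemma char_root_unique:
  assumes "0 < x" "x < pi/2" "(x + real k * pi) / L \<in> char_roots L \<gamma>"
    and "0 < y" "y < pi/2" "(y + real k * pi) / L \<in> char_roots L \<gamma>"
  shows "x = y"
proof -
  have False if "0 < x" "x < y" "y < pi/2" "(x + real k * pi) / L \<in> char_roots L \<gamma>"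
    "(y + real k * pi) / L \<in> char_roots L \<gamma>" for x y
  proof -
    have "0 < x + real k * pi" "0 < y + real k * pi" using that by (auto intro: add_pos_nonneg)
    then have "tan x * (x + real k * pi) = tan y * (y + real k * pi)"
      using that shifted_in_char_roots_iff by metis
    moreover have "tan x < tan y" by (rule tan_monotone) (use that in auto)
    moreover have "0 < tan x" by (rule tan_gt_zero) (use that in auto)
    ultimately show False
      using mult_strict_mono[of "tan x" "tan y" "x + real k * pi" "y + real k * pi"]
        that \<open>0 < x + real k * pi\<close> by simp
  qed
  then show ?thesis using assms by (metis linorder_neqE_linordered_idom)
qed

text \<open>Since \<gamma> < 0, the tangent is positive at a root, which leaves only the first half
  of each period for the reduced angle.\<close>

lemma char_root_cases:
  assumes \<mu>: "\<mu> \<in> char_roots L \<gamma>"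
  obtains k x where "0 < x" "x < pi/2" "\<mu> = (x + real k * pi) / L"
proof -
  have pos: "0 < \<mu> * L" and cosn: "cos (\<mu> * L) \<noteq> 0" and "- \<gamma> / \<mu> = tan (\<mu> * L)" "0 < \<mu>"
    using \<mu> L by (auto simp: char_roots_def)
  then have tanpos: "0 < tan (\<mu> * L)" using \<gamma> by (metis divide_pos_pos neg_0_less_iff_less)
  define k where "k = nat \<lfloor>\<mu> * L / pi\<rfloor>"
  define x where "x = \<mu> * L - real k * pi"
  have k: "real k = of_int \<lfloor>\<mu> * L / pi\<rfloor>" using pos by (simp add: k_def)
  have "real k \<le> \<mu> * L / pi" "\<mu> * L / pi < real k + 1" unfolding k by linarith+
  then have x0: "0 \<le> x" "x < pi" unfolding x_def by (auto simp: field_simps)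
  have \<mu>x: "\<mu> * L = x + real k * pi" by (simp add: x_def)
  have tanx: "0 < tan x" using tanpos unfolding \<mu>x by (simp add: tan_periodic_nat)
  then have "x \<noteq> 0" by auto
  moreover have "x \<noteq> pi/2"
  proof
    assume "x = pi/2"
    \<comment> \<open>At its pole \<open>tan\<close> is a division by 0 with value 0, so positivity
      of the tangent excludes this point too.\<close>
    then have "tan x = 0" by (simp only: tan_def cos_pi_half div_by_0)
    with tanx show False by simp
  qed
  moreover have "\<not> pi/2 < x"
  proof
    assume "pi/2 < x"
    then have "tan (x - pi) < 0" using x0 by (intro tan_less_zero) auto
    then show False using tanx tan_periodic_pi[of "x - pi"] by simp
  qed
  ultimately have "0 < x" "x < pi/2" using x0 by auto
  moreover have "\<mu> = (x + real k * pi) / L" using \<mu>x L by (simp add: field_simps)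
  ultimately show ?thesis by (rule that)
qed

text \<open>Branch k contributes exactly one root, with angle between k pi and k pi + pi/2; these
  intervals are disjoint and ordered, so the enumeration by branches is increasing.\<close>

lemma char_roots_enumeration:
  obtains r :: "nat \<Rightarrow> real" where "strict_mono r" "range r = char_roots L \<gamma>"
    "\<And>k. real k * pi < r k * L" "\<And>k. r k * L < real k * pi + pi/2"
proof -
  obtain x where x: "\<And>k. 0 < x k" "\<And>k. x k < pi/2" "\<And>k. (x k + real k * pi) / L \<in> char_roots L \<gamma>"
    using char_root_exists by metis
  define r where "r = (\<lambda>k. (x k + real k * pi) / L)"
  show thesis
  proof
    show "real k * pi < r k * L" "r k * L < real k * pi + pi/2" for k
      using x[of k] L by (auto simp: r_def)
    show "strict_mono r"
    proof (rule strict_monoI_Suc)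
      fix k
      have "x k + real k * pi < x (Suc k) + real (Suc k) * pi"
      proof -
        have "x k < pi + x (Suc k)" using x(2)[of k] x(1)[of "Suc k"] pi_gt_zero by linarith
        then show ?thesis by (simp add: algebra_simps)
      qed
      then show "r k < r (Suc k)" unfolding r_def using L by (simp add: divide_strict_right_mono)
    qed
    show "range r = char_roots L \<gamma>"
    proof
      show "range r \<subseteq> char_roots L \<gamma>" using x(3) by (auto simp: r_def)
      show "char_roots L \<gamma> \<subseteq> range r"
      proof
        fix \<mu> assume \<mu>: "\<mu> \<in> char_roots L \<gamma>"
        then obtain k y where "0 < y" "y < pi/2" "\<mu> = (y + real k * pi) / L" by (rule char_root_cases)
        then have "\<mu> = r k" using char_root_unique[of y k "x k"] x \<mu> by (simp add: r_def)
        then show "\<mu> \<in> range r" by simp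
      qed
    qed
  qed
qed

text \<open>Exactly k + 1 roots lie at or below the root of branch k, which matches the counting in
  \<open>eig_mu_def\<close>. The shift by one arises because branches are numbered from 0 and
  eigenvalues from 1.\<close>

lemma eig_mu_properties:
  shows eig_mu_image: "eig_mu L \<gamma> ` {1..} = char_roots L \<gamma>"
    and eig_mu_bounds: "real k * pi < eig_mu L \<gamma> (Suc k) * L" "eig_mu L \<gamma> (Suc k) * L < real k * pi + pi/2"
proof -
  obtain r :: "nat \<Rightarrow> real" where r: "strict_mono r" "range r = char_roots L \<gamma>"
    "\<And>k. real k * pi < r k * L" "\<And>k. r k * L < real k * pi + pi/2"
    using char_roots_enumeration by blast
  have le: "{\<nu> \<in> char_roots L \<gamma>. \<nu> \<le> r k} = r ` {..k}" for k
    using strict_mono_less_eq[OF r(1)] unfolding r(2)[symmetric] by auto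
  have card: "card (r ` {..k}) = Suc k" for k
    using strict_mono_imp_inj_on[OF r(1)] by (simp add: card_image inj_on_subset)
  have eq: "eig_mu L \<gamma> (Suc k) = r k" for k
    unfolding eig_mu_def
  proof (rule the_equality)
    show "r k \<in> char_roots L \<gamma> \<and> finite {\<nu> \<in> char_roots L \<gamma>. \<nu> \<le> r k} \<and> card {\<nu> \<in> char_roots L \<gamma>. \<nu> \<le> r k} = Suc k"
      unfolding le card using r(2) by auto
    fix \<mu> assume \<mu>: "\<mu> \<in> char_roots L \<gamma> \<and> finite {\<nu> \<in> char_roots L \<gamma>. \<nu> \<le> \<mu>} \<and> card {\<nu> \<in> char_roots L \<gamma>. \<nu> \<le> \<mu>} = Suc k"
    then obtain j where "\<mu> = r j" using r(2) by auto
    with \<mu> show "\<mu> = r k" by (simp add: le card)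
  qed
  have "{1..} = range Suc" by (auto simp: image_iff) (metis Suc_le_D)
  then have "eig_mu L \<gamma> ` {1..} = (\<lambda>k. eig_mu L \<gamma> (Suc k)) ` UNIV" by (simp only: image_image)
  then show "eig_mu L \<gamma> ` {1..} = char_roots L \<gamma>" using r(2) by (simp add: eq)
  show "real k * pi < eig_mu L \<gamma> (Suc k) * L" "eig_mu L \<gamma> (Suc k) * L < real k * pi + pi/2"
    unfolding eq by (rule r)+
qed

lemma char_roots_pos: "\<mu> \<in> char_roots L \<gamma> \<Longrightarrow> 0 < \<mu>"
  by (simp add: char_roots_def)

text \<open>The form without fractions is the Robin condition at L for cos (\<mu> z). A zero of the
  cosine cannot satisfy it, because the sine would then vanish as well.\<close>

lemma char_roots_iff:
  "\<mu> \<in> char_roots L \<gamma> \<longleftrightarrow> 0 < \<mu> \<and> - \<mu> * sin (\<mu> * L) = \<gamma> * cos (\<mu> * L)"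
proof -
  have "sin (\<mu> * L) \<noteq> 0" if "cos (\<mu> * L) = 0"
    using that sin_cos_squared_add[of "\<mu> * L"] by auto
  then show ?thesis
    unfolding char_roots_def tan_def by (cases "cos (\<mu> * L) = 0") (auto simp: field_simps)
qed

end


section \<open>Solutions of the eigenvalue equation\<close>

text \<open>The set in (0, L) where two continuous representatives differ is open and null, hence
  empty; continuity extends the equality to the endpoints. This gives meaning to boundary values of
  a class.\<close>

lemma represents_unique:
  assumes L: "0 < L" and g: "continuous_on {0..L} g" "represents L g f"
    and h: "continuous_on {0..L} h" "represents L h f" and z: "z \<in> {0..L}"
  shows "g z = h z"
proof -
  define k where "k = (\<lambda>z. g z - h z)"
  have contk: "continuous_on {0..L} k" unfolding k_def by (intro continuous_intros g h)
  have "AE z in lborel. z \<in> {0<..<L} \<longrightarrow> k z = 0"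
    using g(2) h(2) unfolding represents_def k_def by auto
  define S where "S = {0<..<L} \<inter> k -` (- {0})"
  have "open S"
    unfolding S_def
    by (rule continuous_open_preimage) (auto intro: continuous_on_subset[OF contk])
  moreover have "AE z in lborel. z \<notin> S"
    using \<open>AE z in lborel. z \<in> {0<..<L} \<longrightarrow> k z = 0\<close> by eventually_elim (simp add: S_def)
  ultimately have "S \<in> null_sets lborel" by (subst AE_iff_null_sets) auto
  then have "negligible S" by (simp add: negligible_iff_null_sets null_sets_completionI)
  then have "S = {}" using open_not_negligible \<open>open S\<close> by blast
  then have "k z = 0" if "z \<in> {0<..<L}" for z using that by (auto simp: S_def)
  then have "k z = 0"
    using continuous_constant_on_closure[of "{0<..<L}" k 0 z] contk z L by simp
  then show ?thesis by (simp add: k_def)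
qed

lemma point_value_eq:
  assumes "0 < L" "continuous_on {0..L} g" "represents L g f" "z \<in> {0..L}"
  shows "point_value L f z = g z"
  unfolding point_value_def
proof (rule the_equality)
  show "\<exists>g'. continuous_on {0..L} g' \<and> represents L g' f \<and> g z = g' z" using assms by blast
  show "v = g z" if "\<exists>g'. continuous_on {0..L} g' \<and> represents L g' f \<and> v = g' z" for v
    using that represents_unique[OF assms(1)] assms by blast
qed

lemma represents_0_imp: "represents L (\<lambda>_. 0) f \<Longrightarrow> f = 0"
  unfolding represents_def L2_on_def
  using rep_zero_AE by (intro L2_eqI) (auto elim!: AE_mp)

lemma represents_eq_0:
  assumes "represents L g f" "\<And>z. z \<in> {0<..<L} \<Longrightarrow> g z = 0"
  shows "f = 0"
proof (rule represents_0_imp)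
  show "represents L (\<lambda>_. 0) f"
    using assms unfolding represents_def by (auto elim!: AE_mp)
qed

lemma L2_of_scaleR:
  assumes "continuous_on {0..L} g"
  shows "L2_of L (\<lambda>z. r * g z) = r *\<^sub>R L2_of L g"
proof -
  have "represents L (\<lambda>z. r * g z) (L2_of L (\<lambda>z. r * g z))"
    by (intro represents_L2_of continuous_intros assms)
  then have "represents L (\<lambda>z. r * g z + - 1 * (r * g z)) (L2_of L (\<lambda>z. r * g z) + - 1 *\<^sub>R (r *\<^sub>R L2_of L g))"
    by (intro represents_add represents_scaleR represents_L2_of continuous_intros assms)
  then have "L2_of L (\<lambda>z. r * g z) + - 1 *\<^sub>R (r *\<^sub>R L2_of L g) = 0"
    by (rule represents_eq_0) simp
  then show ?thesis by simp
qed

lemma H2_data_0: "H2_data L 0 (\<lambda>_. 0) (\<lambda>_. 0) 0"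
proof -
  have "represents L (\<lambda>_. 0) 0"
    using rep_zero_AE subspace_0[OF L2_on_subspace] unfolding represents_def by auto
  moreover have "(LINT s:{0..z}|lborel. rep_L2 0 s) = 0" for z
    using set_integral_rep_scaleR[of 0 z 0 0] by simp
  ultimately show ?thesis
    using subspace_0[OF L2_on_subspace] by (simp add: H2_data_def)
qed

lemma H2_data_sum:
  assumes "finite I" "\<And>i. i \<in> I \<Longrightarrow> H2_data L (f i) (g i) (g' i) (f'' i)"
  shows "H2_data L (\<Sum>i\<in>I. f i) (\<lambda>z. \<Sum>i\<in>I. g i z) (\<lambda>z. \<Sum>i\<in>I. g' i z) (\<Sum>i\<in>I. f'' i)"
  using assms
proof (induction I)
  case empty
  then show ?case using H2_data_0 by simp
next
  case (insert i I)
  then show ?case using H2_data_add[of L "f i" "g i" "g' i" "f'' i"] by simp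
qed

text \<open>Bootstrapping: the second derivative is a multiple of the class itself, which has a
  continuous representative, so g' is an indefinite integral of a continuous function and the
  equation holds classically.\<close>

lemma H2_data_ode:
  assumes f: "H2_data L f g g' (c *\<^sub>R f)" and z: "z \<in> {0..L}"
  shows "(g' has_real_derivative c * g z) (at z within {0..L})"
proof -
  have cont: "continuous_on {0..L} (\<lambda>s. c * g s)"
    by (intro continuous_intros H2_data_continuous(1)[OF f])
  have ae: "AE s in lborel. s \<in> {0<..<L} \<longrightarrow> rep_L2 f s = g s"
    using H2_data_represents[OF f] by (simp add: represents_def)
  have eq: "g' z = g' 0 + integral {0..z} (\<lambda>s. c * g s)" if z: "z \<in> {0..L}" for z
  proof -
    have sub: "{0..z} \<subseteq> {0..L}" using z by auto
    have "(LINT s:{0..z}|lborel. rep_L2 (c *\<^sub>R f) s) = (LINT s:{0..z}|lborel. c * g s)"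
      unfolding set_lebesgue_integral_def
    proof (rule integral_cong_AE)
      show "(\<lambda>s. indicator {0..z} s *\<^sub>R (c * g s)) \<in> borel_measurable lborel"
        using borel_measurable_continuous_on_indicator[OF _ continuous_on_subset[OF cont sub]] by simp
      show "AE s in lborel. indicator {0..z} s *\<^sub>R rep_L2 (c *\<^sub>R f) s = indicator {0..z} s *\<^sub>R (c * g s)"
        using ae rep_scaleR_AE[of c f] AE_lborel_Icc_Ioo[of 0 L]
        by eventually_elim (use sub in \<open>auto simp: indicator_def\<close>)
    qed measurable
    also have "\<dots> = integral {0..z} (\<lambda>s. c * g s)"
      by (rule set_borel_integral_eq_integral(2))
        (rule borel_integrable_atLeastAtMost'[OF continuous_on_subset[OF cont sub]])
    finally show ?thesis using H2_data_deriv2[OF f z] by simp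
  qed
  have "((\<lambda>z. g' 0 + integral {0..z} (\<lambda>s. c * g s)) has_real_derivative c * g z) (at z within {0..L})"
    using DERIV_add[OF DERIV_const integral_has_real_derivative[OF cont z]] by simp
  then show ?thesis
    by (rule has_field_derivative_transform_within[OF _ zero_less_one z]) (rule eq[symmetric])
qed

text \<open>The product g g' is nondecreasing, starts at 0 and ends at \<gamma> g(L)^2 <= 0, so it
  vanishes identically. Then g(L) = 0, and g^2, whose derivative is 2 g g', is constantly 0. Thus
  there is no nonnegative eigenvalue.\<close>

lemma ode_nonneg_zero:
  assumes L: "0 < L" and \<gamma>: "\<gamma> < 0" and c: "0 \<le> c" and f: "H2_data L f g g' (c *\<^sub>R f)"
    and bc: "g' 0 = 0" "g' L = \<gamma> * g L"
  shows "f = 0"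
proof -
  note dg = H2_data_deriv[OF f] and dg' = H2_data_ode[OF f]
  note cont = H2_data_continuous[OF f]
  define \<phi> where "\<phi> = (\<lambda>z. g z * g' z)"
  have d\<phi>: "(\<phi> has_real_derivative (g' z)\<^sup>2 + c * (g z)\<^sup>2) (at z within {0..L})" if "z \<in> {0..L}" for z
    unfolding \<phi>_def
    by (rule derivative_eq_intros dg[OF that] dg'[OF that] refl)+ (simp add: power2_eq_square algebra_simps)
  have mono: "\<phi> a \<le> \<phi> b" if ab: "0 \<le> a" "a \<le> b" "b \<le> L" for a b
  proof (rule DERIV_nonneg_imp_increasing_open[OF ab(2)])
    show "\<exists>y. (\<phi> has_real_derivative y) (at x) \<and> 0 \<le> y" if "a < x" "x < b" for x
    proof (intro exI conjI)
      show "(\<phi> has_real_derivative (g' x)\<^sup>2 + c * (g x)\<^sup>2) (at x)"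
        using d\<phi>[of x] that ab at_within_Icc_at[of 0 x L] by simp
      show "0 \<le> (g' x)\<^sup>2 + c * (g x)\<^sup>2" using c by simp
    qed
    show "continuous_on {a..b} \<phi>"
      unfolding \<phi>_def by (intro continuous_intros continuous_on_subset[OF cont(1)] continuous_on_subset[OF cont(2)])
        (use ab in auto)
  qed
  have \<phi>L: "\<phi> L = \<gamma> * (g L)\<^sup>2" by (simp add: \<phi>_def bc power2_eq_square)
  have "\<phi> L \<le> 0" unfolding \<phi>L using \<gamma> by (simp add: mult_nonpos_nonneg)
  moreover have \<phi>0: "\<phi> 0 = 0" by (simp add: \<phi>_def bc)
  ultimately have \<phi>z: "\<phi> z = 0" if "z \<in> {0..L}" for z
    using mono[of 0 z] mono[of z L] that by force
  then have gL: "g L = 0" using \<phi>L \<gamma> L by simp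
  have "\<exists>k. \<forall>z\<in>{0..L}. (g z)\<^sup>2 = k"
  proof (rule has_field_derivative_zero_constant)
    show "((\<lambda>z. (g z)\<^sup>2) has_real_derivative 0) (at z within {0..L})" if "z \<in> {0..L}" for z
      by (rule derivative_eq_intros dg[OF that] refl)+ (use \<phi>z[OF that] in \<open>auto simp: \<phi>_def\<close>)
  qed simp
  then obtain k where k: "\<forall>z\<in>{0..L}. (g z)\<^sup>2 = k" ..
  have "(g z)\<^sup>2 = (g L)\<^sup>2" if "z \<in> {0..L}" for z
    using bspec[OF k that] bspec[OF k, of L] L by simp
  then have "g z = 0" if "z \<in> {0<..<L}" for z using gL that by simp
  then show "f = 0" by (rule represents_eq_0[OF H2_data_represents[OF f]])
qed

lemma ode_cos:
  assumes \<mu>: "0 < \<mu>" and f: "H2_data L f g g' (- \<mu>\<^sup>2 *\<^sub>R f)" and bc: "g' 0 = 0"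
    and z: "z \<in> {0..L}"
  shows "g z = g 0 * cos (\<mu> * z)" "g' z = - \<mu> * g 0 * sin (\<mu> * z)"
proof -
  note dg = H2_data_deriv[OF f] and dg' = H2_data_ode[OF f]
  \<comment> \<open>The vector (\<mu> g, g') rotates as z grows; \<open>A\<close> and
    \<open>B\<close> are its coordinates after rotating back by the angle \<mu> z, hence
    constant.\<close>
  define A where "A = (\<lambda>z. \<mu> * g z * cos (\<mu> * z) - g' z * sin (\<mu> * z))"
  define B where "B = (\<lambda>z. \<mu> * g z * sin (\<mu> * z) + g' z * cos (\<mu> * z))"
  have 0: "0 \<in> {0..L}" using z by auto
  have "\<exists>k. \<forall>z\<in>{0..L}. A z = k"
  proof (rule has_field_derivative_zero_constant)
    show "(A has_real_derivative 0) (at z within {0..L})" if "z \<in> {0..L}" for z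
      unfolding A_def
      by (rule derivative_eq_intros dg[OF that] dg'[OF that] refl)+ (simp add: power2_eq_square algebra_simps)
  qed simp
  then obtain k where k: "\<And>z. z \<in> {0..L} \<Longrightarrow> A z = k" by blast
  have A: "A z = \<mu> * g 0" using k[OF z] k[OF 0] by (simp add: A_def)
  have "\<exists>k. \<forall>z\<in>{0..L}. B z = k"
  proof (rule has_field_derivative_zero_constant)
    show "(B has_real_derivative 0) (at z within {0..L})" if "z \<in> {0..L}" for z
      unfolding B_def
      by (rule derivative_eq_intros dg[OF that] dg'[OF that] refl)+ (simp add: power2_eq_square algebra_simps)
  qed simp
  then obtain k where k: "\<And>z. z \<in> {0..L} \<Longrightarrow> B z = k" by blast
  have B: "B z = 0" using k[OF z] k[OF 0] by (simp add: B_def bc)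
  have "\<mu> * g z = A z * cos (\<mu> * z) + B z * sin (\<mu> * z)"
  proof -
    have "A z * cos (\<mu> * z) + B z * sin (\<mu> * z) = \<mu> * g z * ((sin (\<mu> * z))\<^sup>2 + (cos (\<mu> * z))\<^sup>2)"
      unfolding A_def B_def by algebra
    then show ?thesis by simp
  qed
  then show "g z = g 0 * cos (\<mu> * z)" using A B \<mu> by simp
  have "g' z = B z * cos (\<mu> * z) - A z * sin (\<mu> * z)"
  proof -
    have "B z * cos (\<mu> * z) - A z * sin (\<mu> * z) = g' z * ((sin (\<mu> * z))\<^sup>2 + (cos (\<mu> * z))\<^sup>2)"
      unfolding A_def B_def by algebra
    then show ?thesis by simp
  qed
  then show "g' z = - \<mu> * g 0 * sin (\<mu> * z)" using A B by simp
qed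


section \<open>Spectral decomposition of the reflected diffusion operator\<close>

lemma mem_refl_op_iff:
  "(w, v) \<in> refl_op D L \<gamma> \<longleftrightarrow>
    (\<exists>w'' g g'. v = D *\<^sub>R w'' \<and> H2_data L w g g' w'' \<and> g' 0 = 0 \<and> g' L = \<gamma> * g L)"
  unfolding refl_op_def by blast

lemma refl_op_diff:
  assumes "(w, v) \<in> refl_op D L \<gamma>" "(w', v') \<in> refl_op D L \<gamma>"
  shows "(w - w', v - v') \<in> refl_op D L \<gamma>"
proof -
  obtain u g g' where 1: "v = D *\<^sub>R u" "H2_data L w g g' u" "g' 0 = 0" "g' L = \<gamma> * g L"
    using assms(1) unfolding mem_refl_op_iff by blast
  obtain u' h h' where 2: "v' = D *\<^sub>R u'" "H2_data L w' h h' u'" "h' 0 = 0" "h' L = \<gamma> * h L"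
    using assms(2) unfolding mem_refl_op_iff by blast
  have "v - v' = D *\<^sub>R (u - u')" "g' 0 - h' 0 = 0" "g' L - h' L = \<gamma> * (g L - h L)"
    using 1 2 by (simp_all add: algebra_simps)
  then show ?thesis
    unfolding mem_refl_op_iff using H2_data_diff[OF 1(2) 2(2)] by blast
qed

lemma eig_fun_eq: "eig_fun L \<gamma> i = eig_coeff L \<gamma> i *\<^sub>R L2_of L (\<lambda>z. cos (eig_mu L \<gamma> i * z))"
  unfolding eig_fun_def by (rule L2_of_scaleR) (intro continuous_intros)

lemma H2_data_eig_fun:
  "H2_data L (eig_fun L \<gamma> i) (\<lambda>z. eig_coeff L \<gamma> i * cos (eig_mu L \<gamma> i * z))
    (\<lambda>z. eig_coeff L \<gamma> i * (- eig_mu L \<gamma> i * sin (eig_mu L \<gamma> i * z)))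
    (- (eig_mu L \<gamma> i)\<^sup>2 *\<^sub>R eig_fun L \<gamma> i)"
proof -
  let ?m = "eig_mu L \<gamma> i" and ?c = "eig_coeff L \<gamma> i"
  have "H2_data L (L2_of L (\<lambda>z. ?c * cos (?m * z))) (\<lambda>z. ?c * cos (?m * z))
    (\<lambda>z. ?c * (- ?m * sin (?m * z))) (L2_of L (\<lambda>z. - ?m\<^sup>2 * (?c * cos (?m * z))))"
    by (rule H2_data_L2_of)
      (auto intro!: derivative_eq_intros continuous_intros simp: power2_eq_square)
  moreover have "L2_of L (\<lambda>z. - ?m\<^sup>2 * (?c * cos (?m * z))) = - ?m\<^sup>2 *\<^sub>R eig_fun L \<gamma> i"
    unfolding eig_fun_def by (rule L2_of_scaleR) (intro continuous_intros)
  ultimately show ?thesis unfolding eig_fun_def by simp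
qed

lemma H2_data_eig_sum:
  assumes "finite I"
  shows "H2_data L (\<Sum>i\<in>I. a i *\<^sub>R eig_fun L \<gamma> i)
    (\<lambda>z. \<Sum>i\<in>I. a i * (eig_coeff L \<gamma> i * cos (eig_mu L \<gamma> i * z)))
    (\<lambda>z. \<Sum>i\<in>I. a i * (eig_coeff L \<gamma> i * (- eig_mu L \<gamma> i * sin (eig_mu L \<gamma> i * z))))
    (\<Sum>i\<in>I. a i *\<^sub>R (- (eig_mu L \<gamma> i)\<^sup>2 *\<^sub>R eig_fun L \<gamma> i))"
  by (intro H2_data_sum H2_data_scaleR H2_data_eig_fun assms)

lemma eig_sum_in_L2_on:
  assumes "finite I"
  shows "(\<Sum>i\<in>I. a i *\<^sub>R eig_fun L \<gamma> i) \<in> L2_on L"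
  using H2_data_represents[OF H2_data_eig_sum[OF assms]] by (simp add: represents_def)

lemma point_value_eig_sum:
  assumes "0 < L" "finite I"
  shows "point_value L (\<Sum>i\<in>I. a i *\<^sub>R eig_fun L \<gamma> i) 0 = (\<Sum>i\<in>I. a i * eig_coeff L \<gamma> i)"
  using point_value_eq[OF assms(1) H2_data_continuous(1)[OF H2_data_eig_sum[OF assms(2)]]
      H2_data_represents[OF H2_data_eig_sum[OF assms(2)]], of 0] assms by simp

lemma eig_sum_in_set_F:
  assumes "finite I" "I \<subseteq> {1..}" "a \<in> Gamma1 L \<gamma> I" "a \<in> Gamma2 D L \<gamma> I"
  shows "(\<Sum>i\<in>I. a i *\<^sub>R eig_fun L \<gamma> i) \<in> set_F D L \<gamma>"
  using assms unfolding set_F_def by blast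

text \<open>Replacing every weight by the largest weight M among the positive coefficients can only
  increase the sum: the negative coefficients carry weights at least M by \<open>Gamma2\<close>.
  What remains is M times the sum in \<open>Gamma1\<close>. Monotonicity is asked only on the
  eigenvalues that occur, as the resolvent weight is controlled only below
  \<open>lam\<close>.\<close>

lemma weighted_eig_sum_nonpos:
  assumes I: "finite I" and c: "\<And>i. 0 < eig_coeff L \<gamma> i"
    and a: "a \<in> Gamma1 L \<gamma> I" "a \<in> Gamma2 D L \<gamma> I"
    and w0: "\<And>i. i \<in> I \<Longrightarrow> 0 \<le> w (eig_val D L \<gamma> i)"
    and w: "\<And>i j. i \<in> I \<Longrightarrow> j \<in> I \<Longrightarrow> eig_val D L \<gamma> i < eig_val D L \<gamma> j \<Longrightarrow>
      w (eig_val D L \<gamma> i) \<le> w (eig_val D L \<gamma> j)"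
  shows "(\<Sum>i\<in>I. a i * w (eig_val D L \<gamma> i) * eig_coeff L \<gamma> i) \<le> (0::real)"
proof (cases "{i \<in> I. 0 < a i} = {}")
  case True
  then have "a i \<le> 0" if "i \<in> I" for i using that by force
  then show ?thesis
    using w0 c by (intro sum_nonpos mult_nonpos_nonneg) (auto simp: less_imp_le)
next
  case False
  let ?W = "\<lambda>i. w (eig_val D L \<gamma> i)"
  define M where "M = Max (?W ` {i \<in> I. 0 < a i})"
  have fin: "finite (?W ` {i \<in> I. 0 < a i})" using I by simp
  have le: "?W i \<le> M" if "i \<in> I" "0 < a i" for i
    unfolding M_def by (rule Max_ge[OF fin]) (use that in auto)
  have "M \<in> ?W ` {i \<in> I. 0 < a i}" unfolding M_def by (rule Max_in[OF fin]) (use False in auto)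
  then obtain j where j: "j \<in> I" "0 < a j" "M = ?W j" by auto
  have ge: "M \<le> ?W i" if i: "i \<in> I" "a i < 0" for i
  proof -
    have "ereal (eig_val D L \<gamma> j) \<le> (SUP i\<in>{i \<in> I. 0 < a i}. ereal (eig_val D L \<gamma> i))"
      by (rule SUP_upper) (use j in simp)
    also have "\<dots> < (INF i\<in>{i \<in> I. a i < 0}. ereal (eig_val D L \<gamma> i))"
      using a(2) by (simp add: Gamma2_def)
    also have "\<dots> \<le> ereal (eig_val D L \<gamma> i)"
      by (rule INF_lower) (use i in simp)
    finally show ?thesis unfolding j(3) using w[OF j(1) i(1)] by simp
  qed
  have "a i * ?W i \<le> a i * M" if "i \<in> I" for i
    using le[OF that] ge[OF that] by (cases "a i" "0::real" rule: linorder_cases) auto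
  then have "a i * ?W i * eig_coeff L \<gamma> i \<le> M * (a i * eig_coeff L \<gamma> i)" if "i \<in> I" for i
    using mult_right_mono[of "a i * ?W i" "a i * M" "eig_coeff L \<gamma> i"] c[of i] that
    by (simp add: mult_ac)
  then have "(\<Sum>i\<in>I. a i * ?W i * eig_coeff L \<gamma> i) \<le> (\<Sum>i\<in>I. M * (a i * eig_coeff L \<gamma> i))"
    by (rule sum_mono)
  also have "\<dots> = M * (\<Sum>i\<in>I. a i * eig_coeff L \<gamma> i)" by (rule sum_distrib_left[symmetric])
  also have "\<dots> \<le> 0"
    using w0[OF j(1)] a(1) by (intro mult_nonneg_nonpos) (auto simp: j(3) Gamma1_def)
  finally show ?thesis .
qed

context
  fixes D L \<gamma> :: real
  assumes D: "0 < D" and L: "0 < L" and \<gamma>: "\<gamma> < 0"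
begin

text \<open>The continuous representative equals 1 at 0, so the class is not zero and the
  normalization in \<open>eig_coeff\<close> is a genuine division.\<close>

lemma norm_L2_of_cos_pos: "0 < norm (L2_of L (\<lambda>z. cos (\<mu> * z)))"
proof -
  have cont: "continuous_on {0..L} (\<lambda>z. cos (\<mu> * z))" by (intro continuous_intros)
  have "L2_of L (\<lambda>z. cos (\<mu> * z)) \<noteq> 0"
  proof
    assume "L2_of L (\<lambda>z. cos (\<mu> * z)) = 0"
    then have "represents L (\<lambda>z. cos (\<mu> * z)) 0" using represents_L2_of[OF cont] by simp
    from represents_unique[OF L cont this _ H2_data_represents[OF H2_data_0], of 0] L
    show False by simp
  qed
  then show ?thesis by simp
qed

lemma eig_coeff_pos: "0 < eig_coeff L \<gamma> i"
  unfolding eig_coeff_def using norm_L2_of_cos_pos by simp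

lemma norm_eig_fun: "norm (eig_fun L \<gamma> i) = 1"
  using norm_L2_of_cos_pos[of "eig_mu L \<gamma> i"] unfolding eig_fun_eq eig_coeff_def by simp

lemma eig_mu_in_char_roots: "1 \<le> i \<Longrightarrow> eig_mu L \<gamma> i \<in> char_roots L \<gamma>"
  using eig_mu_image[OF L \<gamma>] by auto

lemma eig_val_neg:
  assumes "1 \<le> i"
  shows "eig_val D L \<gamma> i < 0"
  using char_roots_pos[OF L \<gamma> eig_mu_in_char_roots[OF assms]] D by (simp add: eig_val_def)

lemma eig_sum_in_refl_op:
  assumes I: "finite I" "I \<subseteq> {1..}"
  shows "(\<Sum>i\<in>I. a i *\<^sub>R eig_fun L \<gamma> i, \<Sum>i\<in>I. (a i * eig_val D L \<gamma> i) *\<^sub>R eig_fun L \<gamma> i) \<in> refl_op D L \<gamma>"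
proof -
  have "- eig_mu L \<gamma> i * sin (eig_mu L \<gamma> i * L) = \<gamma> * cos (eig_mu L \<gamma> i * L)" if "i \<in> I" for i
    using char_roots_iff[OF L \<gamma>] eig_mu_in_char_roots that I by auto
  then have "(\<Sum>i\<in>I. a i * (eig_coeff L \<gamma> i * (- eig_mu L \<gamma> i * sin (eig_mu L \<gamma> i * L))))
    = \<gamma> * (\<Sum>i\<in>I. a i * (eig_coeff L \<gamma> i * cos (eig_mu L \<gamma> i * L)))"
    unfolding sum_distrib_left by (intro sum.cong refl) (simp add: mult_ac)
  moreover have "(\<Sum>i\<in>I. (a i * eig_val D L \<gamma> i) *\<^sub>R eig_fun L \<gamma> i)
    = D *\<^sub>R (\<Sum>i\<in>I. a i *\<^sub>R (- (eig_mu L \<gamma> i)\<^sup>2 *\<^sub>R eig_fun L \<gamma> i))"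
    unfolding scaleR_sum_right by (intro sum.cong refl) (simp add: eig_val_def mult_ac)
  moreover have "(\<Sum>i\<in>I. a i * (eig_coeff L \<gamma> i * (- eig_mu L \<gamma> i * sin (eig_mu L \<gamma> i * 0)))) = 0" by simp
  ultimately show ?thesis
    unfolding mem_refl_op_iff using H2_data_eig_sum[OF I(1)] by blast
qed

lemma eigenvector_eig_fun:
  assumes "1 \<le> i"
  shows "eigenvector (refl_op D L \<gamma>) (eig_val D L \<gamma> i) (eig_fun L \<gamma> i)"
proof -
  have "eig_fun L \<gamma> i \<noteq> 0" using norm_eig_fun[of i] by auto
  then show ?thesis
    using eig_sum_in_refl_op[of "{i}" "\<lambda>_. 1"] assms by (simp add: eigenvector_def)
qed

text \<open>The sign argument forces lam / D = -\<mu>^2 with \<mu> > 0, so the eigenvector is g(0)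
  cos (\<mu> z) with g(0) nonzero. Cancelling g(0) in the Robin condition leaves the characteristic
  equation.\<close>

lemma eigenvalue_imp:
  assumes "eigenvector (refl_op D L \<gamma>) lam w"
  shows "lam \<in> eig_val D L \<gamma> ` {1..}"
proof -
  have w: "w \<noteq> 0" and "(w, lam *\<^sub>R w) \<in> refl_op D L \<gamma>"
    using assms by (auto simp: eigenvector_def)
  then obtain w'' g g' where "lam *\<^sub>R w = D *\<^sub>R w''" and H: "H2_data L w g g' w''"
    and bc: "g' 0 = 0" "g' L = \<gamma> * g L"
    unfolding mem_refl_op_iff by blast
  define c where "c = lam / D"
  have "w'' = inverse D *\<^sub>R (D *\<^sub>R w'')" using D by simp
  also have "\<dots> = c *\<^sub>R w"
    unfolding \<open>lam *\<^sub>R w = D *\<^sub>R w''\<close>[symmetric] c_def by (simp add: field_simps)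
  finally have H: "H2_data L w g g' (c *\<^sub>R w)" using H by simp
  have "c < 0"
    using ode_nonneg_zero[OF L \<gamma> _ H bc] w by force
  define \<mu> where "\<mu> = sqrt (- c)"
  have \<mu>: "0 < \<mu>" "c = - \<mu>\<^sup>2" using \<open>c < 0\<close> by (simp_all add: \<mu>_def)
  have H: "H2_data L w g g' (- \<mu>\<^sup>2 *\<^sub>R w)" using H \<mu>(2) by simp
  note sol = ode_cos[OF \<mu>(1) H bc(1)]
  have "g 0 \<noteq> 0"
  proof
    assume "g 0 = 0"
    then have "g z = 0" if "z \<in> {0<..<L}" for z using sol(1)[of z] that by simp
    then show False using represents_eq_0[OF H2_data_represents[OF H]] w by blast
  qed
  moreover have "- \<mu> * g 0 * sin (\<mu> * L) = \<gamma> * (g 0 * cos (\<mu> * L))"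
    using sol(1)[of L] sol(2)[of L] bc(2) L by simp
  then have "g 0 * (- \<mu> * sin (\<mu> * L)) = g 0 * (\<gamma> * cos (\<mu> * L))" by (simp only: mult_ac)
  ultimately have "- \<mu> * sin (\<mu> * L) = \<gamma> * cos (\<mu> * L)" by (metis mult_cancel_left)
  then have "\<mu> \<in> char_roots L \<gamma>" using char_roots_iff[OF L \<gamma>] \<mu>(1) by simp
  then obtain i where "i \<in> {1..}" "\<mu> = eig_mu L \<gamma> i" unfolding eig_mu_image[OF L \<gamma>, symmetric] by blast
  moreover have "lam = - D * \<mu>\<^sup>2" using \<mu>(2) D by (simp add: c_def field_simps)
  ultimately show ?thesis by (auto simp: eig_val_def)
qed

lemma eigenvalues_eq: "{lam. \<exists>w. eigenvector (refl_op D L \<gamma>) lam w} = eig_val D L \<gamma> ` {1..}"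
  using eigenvalue_imp eigenvector_eig_fun by blast

text \<open>The explicit sum solves the resolvent equation termwise. The definite description also
  needs uniqueness: a nonzero difference of two solutions would be an eigenvector for
  \<open>lam\<close> > 0, while all eigenvalues are negative.\<close>

lemma resolvent_eig_sum:
  assumes lam: "0 < lam" and I: "finite I" "I \<subseteq> {1..}"
  shows "resolvent lam (refl_op D L \<gamma>) (\<Sum>i\<in>I. a i *\<^sub>R eig_fun L \<gamma> i)
    = (\<Sum>i\<in>I. (a i / (lam - eig_val D L \<gamma> i)) *\<^sub>R eig_fun L \<gamma> i)"
  unfolding resolvent_def
proof (rule the_equality)
  let ?A = "refl_op D L \<gamma>"
  let ?w = "\<Sum>i\<in>I. (a i / (lam - eig_val D L \<gamma> i)) *\<^sub>R eig_fun L \<gamma> i"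
  let ?v = "\<Sum>i\<in>I. (a i / (lam - eig_val D L \<gamma> i) * eig_val D L \<gamma> i) *\<^sub>R eig_fun L \<gamma> i"
  let ?y = "\<Sum>i\<in>I. a i *\<^sub>R eig_fun L \<gamma> i"
  have wv: "(?w, ?v) \<in> ?A" by (rule eig_sum_in_refl_op[OF I])
  have eq: "lam *\<^sub>R ?w - ?v = ?y"
    unfolding scaleR_sum_right sum_subtractf[symmetric]
  proof (rule sum.cong[OF refl])
    fix i assume "i \<in> I"
    then have "lam - eig_val D L \<gamma> i \<noteq> 0" using eig_val_neg[of i] I lam by force
    then have "lam * (a i / (lam - eig_val D L \<gamma> i)) - a i / (lam - eig_val D L \<gamma> i) * eig_val D L \<gamma> i = a i"
      by (simp add: divide_simps) (simp add: algebra_simps)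
    then show "lam *\<^sub>R (a i / (lam - eig_val D L \<gamma> i)) *\<^sub>R eig_fun L \<gamma> i
      - (a i / (lam - eig_val D L \<gamma> i) * eig_val D L \<gamma> i) *\<^sub>R eig_fun L \<gamma> i = a i *\<^sub>R eig_fun L \<gamma> i"
      by (simp only: scaleR_scaleR scaleR_left_diff_distrib[symmetric])
  qed
  show "\<exists>v. (?w, v) \<in> ?A \<and> lam *\<^sub>R ?w - v = ?y" using wv eq by blast
  fix w assume "\<exists>v. (w, v) \<in> ?A \<and> lam *\<^sub>R w - v = ?y"
  then obtain v where v: "(w, v) \<in> ?A" "lam *\<^sub>R w - v = ?y" by blast
  have "v - ?v = lam *\<^sub>R (w - ?w)" using v(2) eq by (simp add: algebra_simps)
  then have "(w - ?w, lam *\<^sub>R (w - ?w)) \<in> ?A" using refl_op_diff[OF v(1) wv] by simp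
  moreover have "lam \<notin> eig_val D L \<gamma> ` {1..}" using eig_val_neg lam by force
  ultimately show "w = ?w" using eigenvalue_imp[of lam "w - ?w"] by (auto simp: eigenvector_def)
qed

lemma resolvent_power_eig_sum:
  assumes lam: "0 < lam" and I: "finite I" "I \<subseteq> {1..}"
  shows "(resolvent lam (refl_op D L \<gamma>) ^^ m) (\<Sum>i\<in>I. a i *\<^sub>R eig_fun L \<gamma> i)
    = (\<Sum>i\<in>I. (a i / (lam - eig_val D L \<gamma> i) ^ m) *\<^sub>R eig_fun L \<gamma> i)"
proof (induction m)
  case (Suc m)
  then show ?case
    using resolvent_eig_sum[OF lam I, of "\<lambda>i. a i / (lam - eig_val D L \<gamma> i) ^ m"]
    by (simp add: mult.commute)
qed simp

text \<open>All eigenvalues are negative, so the threshold \<omega> = 0 serves every element: for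
  \<open>lam\<close> > 0 the weights of the m-th resolvent power are positive and increase with the
  eigenvalue.\<close>

lemma set_F_subset_set_E: "set_F D L \<gamma> \<subseteq> set_E D L \<gamma>"
proof
  fix e assume "e \<in> set_F D L \<gamma>"
  then obtain I a where I: "finite I" "I \<subseteq> {1..}" and a: "a \<in> Gamma1 L \<gamma> I" "a \<in> Gamma2 D L \<gamma> I"
    and e: "e = (\<Sum>i\<in>I. a i *\<^sub>R eig_fun L \<gamma> i)"
    unfolding set_F_def by auto
  have "point_value L ((resolvent lam (refl_op D L \<gamma>) ^^ m) e) 0 \<le> 0" if lam: "0 < lam" for lam m
  proof -
    have pos: "0 < lam - eig_val D L \<gamma> i" if "i \<in> I" for i using eig_val_neg[of i] I lam that by force
    have "(\<Sum>i\<in>I. a i * (1 / (lam - eig_val D L \<gamma> i) ^ m) * eig_coeff L \<gamma> i) \<le> 0"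
    proof (rule weighted_eig_sum_nonpos[OF I(1) eig_coeff_pos a])
      show "0 \<le> 1 / (lam - eig_val D L \<gamma> i) ^ m" if "i \<in> I" for i using pos[OF that] by simp
      show "1 / (lam - eig_val D L \<gamma> i) ^ m \<le> 1 / (lam - eig_val D L \<gamma> j) ^ m"
        if "i \<in> I" "j \<in> I" "eig_val D L \<gamma> i < eig_val D L \<gamma> j" for i j
        using pos[OF that(1)] pos[OF that(2)] that(3) by (intro divide_left_mono power_mono) auto
    qed
    then show ?thesis
      unfolding e resolvent_power_eig_sum[OF lam I] point_value_eig_sum[OF L I(1)] by simp
  qed
  then show "e \<in> set_E D L \<gamma>"
    unfolding set_E_def using eig_sum_in_L2_on[OF I(1)] e by (auto intro!: exI[of _ 0])
qed

text \<open>The conventions for empty index sets make the empty sum admissible. It is the comparison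
  function for nonpositive initial errors.\<close>

lemma zero_in_set_F: "0 \<in> set_F D L \<gamma>"
proof -
  have "(\<lambda>_. 0) \<in> Gamma1 L \<gamma> {} \<inter> Gamma2 D L \<gamma> {}"
    by (simp add: Gamma1_def Gamma2_def bot_ereal_def top_ereal_def)
  then show ?thesis using eig_sum_in_set_F[of "{}" "\<lambda>_. 0"] by simp
qed

text \<open>The witness is \<open>cos (\<mu>\<^sub>3 z) - cos (\<mu>\<^sub>1 z)\<close>, which is positive at \<open>z = 2 \<pi> / \<mu>\<^sub>3\<close>.\<close>

lemma set_F_not_subset_L2_nonpos: "set_F D L \<gamma> - L2_nonpos L \<noteq> {}"
proof -
  let ?c = "eig_coeff L \<gamma>" and ?m = "eig_mu L \<gamma>"
  have m1: "0 < ?m 1" "?m 1 * L < pi/2"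
    using eig_mu_bounds[OF L \<gamma>, of 0] L by (auto simp: zero_less_mult_iff)
  \<comment> \<open>The third root belongs to branch 2; it is the first whose cosine completes a
    full period inside (0, L).\<close>
  have m3: "2 * pi < ?m 3 * L"
    using eig_mu_bounds(1)[OF L \<gamma>, of 2] by (simp add: numeral_3_eq_3)
  then have m3pos: "0 < ?m 3" using L pi_gt_zero by (metis less_trans mult_pos_pos zero_less_mult_pos2 zero_less_numeral)
  have "?m 1 * L < ?m 3 * L" using m1 m3 pi_gt_zero by linarith
  then have m13: "?m 1 < ?m 3" using L by simp
  \<comment> \<open>Dividing by the normalizing coefficients turns the combination into a difference
    of plain cosines and makes the sum in \<open>Gamma1\<close> exactly 0.\<close>
  define a where "a = (\<lambda>i::nat. if i = 1 then - 1 / ?c 1 else 1 / ?c 3)"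
  define e where "e = (\<Sum>i\<in>{1,3}. a i *\<^sub>R eig_fun L \<gamma> i)"
  have c: "0 < ?c i" for i by (rule eig_coeff_pos)
  have sets: "{i \<in> {1,3}. a i < 0} = {1}" "{i \<in> {1,3}. 0 < a i} = {3}"
    using c[of 1] c[of 3] by (auto simp: a_def not_less)
  have "a \<in> Gamma1 L \<gamma> {1,3}" using c[of 1] c[of 3] by (simp add: Gamma1_def a_def)
  moreover have "eig_val D L \<gamma> 3 < eig_val D L \<gamma> 1"
    using D m1 m13 by (simp add: eig_val_def power_strict_mono)
  then have "a \<in> Gamma2 D L \<gamma> {1,3}" unfolding Gamma2_def mem_Collect_eq sets by simp
  ultimately have eF: "e \<in> set_F D L \<gamma>" unfolding e_def by (intro eig_sum_in_set_F) auto
  define g where "g = (\<lambda>z. cos (?m 3 * z) - cos (?m 1 * z))"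
  have "(\<Sum>i\<in>{1,3}. a i * (?c i * cos (?m i * z))) = g z" for z
    using c[of 1] c[of 3] by (simp add: a_def g_def)
  then have rep: "represents L g e"
    using H2_data_represents[OF H2_data_eig_sum[of "{1,3}" L a \<gamma>]] unfolding e_def by simp
  define z0 where "z0 = 2 * pi / ?m 3"
  have z0: "0 < z0" "z0 < L" using m3 m3pos L by (auto simp: z0_def field_simps)
  have "?m 1 * z0 < pi"
  proof -
    have "?m 1 * z0 < ?m 1 * L" using m1(1) z0 by simp
    with m1(2) pi_gt_zero show ?thesis by linarith
  qed
  then have "cos (?m 1 * z0) < cos 0" using m1 z0 by (intro cos_monotone_0_pi) auto
  moreover have "?m 3 * z0 = 2 * pi" using m3pos by (simp add: z0_def)
  ultimately have gz0: "0 < g z0" by (simp add: g_def)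
  have "e \<notin> L2_nonpos L"
  proof
    define S where "S = {0<..<L} \<inter> g -` {0<..}"
    assume "e \<in> L2_nonpos L"
    then have "AE z in lborel. z \<in> {0<..<L} \<longrightarrow> rep_L2 e z \<le> 0" by (simp add: L2_nonpos_def)
    moreover have "AE z in lborel. z \<in> {0<..<L} \<longrightarrow> rep_L2 e z = g z" using rep by (simp add: represents_def)
    ultimately have "AE z in lborel. z \<notin> S" by eventually_elim (auto simp: S_def)
    moreover have "open S" unfolding S_def g_def
      by (intro continuous_open_preimage continuous_intros open_greaterThan open_greaterThanLessThan)
    ultimately have "S \<in> null_sets lborel" by (subst AE_iff_null_sets) auto
    then have "negligible S" by (simp add: negligible_iff_null_sets null_sets_completionI)
    moreover have "z0 \<in> S" using z0 gz0 by (simp add: S_def)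
    ultimately show False using open_not_negligible[OF \<open>open S\<close>] by blast
  qed
  with eF show ?thesis by blast
qed

end


section \<open>Positivity of the coupled semigroup\<close>

text \<open>The subspace is the orthogonal complement of the classes \<open>out k\<close> supported
  outside the interval, an intersection of closed sets. For the converse inclusion f is tested
  against its own outer part.\<close>

lemma closed_L2_on: "closed (L2_on L)"
proof -
  define out where "out = (\<lambda>k. abs_L2 (\<lambda>z. indicator (- {0<..<L}) z * rep_L2 k z))"
  have repO: "AE z in lborel. rep_L2 (out k) z = indicator (- {0<..<L}) z * rep_L2 k z" for k
    unfolding out_def
  proof (rule rep_abs_AE)
    have "integrable lborel (\<lambda>z. (indicator (- {0<..<L}) z * rep_L2 k z)\<^sup>2)"
      by (rule Bochner_Integration.integrable_bound[OF integrable_rep_power2[of k]])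
        (auto simp: indicator_def)
    then show "square_integrable (\<lambda>z. indicator (- {0<..<L}) z * rep_L2 k z)"
      by (simp add: square_integrable_def)
  qed
  have "L2_on L = (\<Inter>k. {f. inner f (out k) = 0})"
  proof (intro equalityI subsetI INT_I CollectI)
    fix f k assume "f \<in> L2_on L"
    then have "AE z in lborel. z \<notin> {0<..<L} \<longrightarrow> rep_L2 f z = 0" by (simp add: L2_on_def)
    with repO[of k] have "AE z in lborel. rep_L2 f z * rep_L2 (out k) z = 0"
      by eventually_elim (auto simp: indicator_def)
    then show "inner f (out k) = 0" unfolding inner_L2_eq by (rule integral_eq_zero_AE)
  next
    fix f assume "f \<in> (\<Inter>k. {f. inner f (out k) = 0})"
    then have "(LINT z|lborel. rep_L2 f z * rep_L2 (out f) z) = 0" by (simp add: inner_L2_eq)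
    moreover have "AE z in lborel. 0 \<le> rep_L2 f z * rep_L2 (out f) z"
      using repO[of f] by eventually_elim (auto simp: indicator_def)
    ultimately have "AE z in lborel. rep_L2 f z * rep_L2 (out f) z = 0"
      using integral_nonneg_eq_0_iff_AE[OF integrable_rep_mult] by blast
    with repO[of f] show "f \<in> L2_on L"
      unfolding L2_on_def mem_Collect_eq by eventually_elim (auto simp: indicator_def)
  qed
  moreover have "closed (\<Inter>k. {f. inner f (out k) = 0})"
    by (intro closed_INT ballI closed_Collect_eq continuous_intros)
  ultimately show ?thesis by simp
qed

lemma L2_on_series:
  assumes y: "\<And>n. y n \<in> L2_on L" and s: "summable (\<lambda>n. norm (y n))"
  shows "(\<Sum>n. y n) \<in> L2_on L" "y sums (\<Sum>n. y n)"
proof -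
  show *: "y sums (\<Sum>n. y n)" using summable_L2[OF s] by (rule summable_sums)
  show "(\<Sum>n. y n) \<in> L2_on L"
    by (rule closed_sequentially[OF closed_L2_on _ *[unfolded sums_def]])
      (intro subspace_sum[OF L2_on_subspace] y)
qed

text \<open>The series form of completeness is the shape in which the gliding hump argument requires
  it.\<close>

lemma L2_on_Times_complete:
  assumes y: "\<And>n. y n \<in> L2_on L \<times> L2_on L" and s: "summable (\<lambda>n. norm (y n))"
  shows "\<exists>s\<in>L2_on L \<times> L2_on L. y sums s"
proof -
  have 1: "summable (\<lambda>n. norm (fst (y n)))" "summable (\<lambda>n. norm (snd (y n)))"
    using norm_fst_le[of "fst (y n)" "snd (y n)" for n] norm_snd_le[of "snd (y n)" "fst (y n)" for n]
    by (auto intro!: summable_comparison_test'[OF s, of 0])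
  have 2: "fst (y n) \<in> L2_on L" "snd (y n) \<in> L2_on L" for n using y[of n] by (simp_all add: mem_Times_iff)
  note f = L2_on_series[OF 2(1) 1(1)] and g = L2_on_series[OF 2(2) 1(2)]
  have "(\<lambda>n. (\<Sum>i<n. fst (y i), \<Sum>i<n. snd (y i))) \<longlonglongrightarrow> (\<Sum>n. fst (y n), \<Sum>n. snd (y n))"
    by (rule tendsto_Pair[OF f(2)[unfolded sums_def] g(2)[unfolded sums_def]])
  moreover have "(\<Sum>i<n. fst (y i), \<Sum>i<n. snd (y i)) = (\<Sum>i<n. y i)" for n
    by (rule prod_eqI) (simp_all add: fst_sum snd_sum)
  ultimately have "y sums (\<Sum>n. fst (y n), \<Sum>n. snd (y n))" by (simp add: sums_def)
  with f(1) g(1) show ?thesis by blast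
qed

lemma L2_on_Times_subset_closure_domain:
  assumes "0 < L"
  shows "L2_on L \<times> L2_on L \<subseteq> closure (Domain (coupled_op D L \<kappa> \<gamma>))"
proof -
  have "H2_flat L \<times> H2_flat L \<subseteq> Domain (coupled_op D L \<kappa> \<gamma>)"
  proof
    fix u assume "u \<in> H2_flat L \<times> H2_flat L"
    then obtain x e where u: "u = (x, e)" and "x \<in> H2_flat L" "e \<in> H2_flat L" by blast
    then obtain gx gx' x'' ge ge' e'' where H: "H2_data L x gx gx' x''" "H2_data L e ge ge' e''"
      and bc: "gx 0 = 0" "gx' 0 = 0" "gx L = 0" "gx' L = 0" "ge 0 = 0" "ge' 0 = 0" "ge L = 0" "ge' L = 0"
      unfolding H2_flat_def by blast
    from bc have "gx' 0 = - \<kappa> * gx 0 - \<kappa> * ge 0" "ge' L = \<gamma> * ge L" by simp_all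
    with H bc have "((x, e), (D *\<^sub>R x'', D *\<^sub>R e'')) \<in> coupled_op D L \<kappa> \<gamma>"
      unfolding coupled_op_def by blast
    then show "u \<in> Domain (coupled_op D L \<kappa> \<gamma>)" unfolding u by blast
  qed
  then have "closure (H2_flat L) \<times> closure (H2_flat L) \<subseteq> closure (Domain (coupled_op D L \<kappa> \<gamma>))"
    unfolding closure_Times[symmetric] by (rule closure_mono)
  with L2_on_subset_closure_H2_flat[OF assms] show ?thesis by blast
qed

lemma mem_coupled_op_iff:
  "(u, v) \<in> coupled_op D L \<kappa> \<gamma> \<longleftrightarrow>
    (\<exists>x'' e'' gx gx' ge ge'. v = (D *\<^sub>R x'', D *\<^sub>R e'') \<and>
      H2_data L (fst u) gx gx' x'' \<and> H2_data L (snd u) ge ge' e'' \<and>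
      gx' 0 = - \<kappa> * gx 0 - \<kappa> * ge 0 \<and> ge' 0 = 0 \<and> gx' L = 0 \<and> ge' L = \<gamma> * ge L)"
proof -
  obtain x e where u: "u = (x, e)" by (cases u)
  show ?thesis
    unfolding u coupled_op_def fst_conv snd_conv by (simp only: mem_Collect_eq prod.inject) blast
qed

text \<open>The boundary influx of \<open>x\<close> at 0 is absorbed by the dissipation of \<open>d\<close>, whose value at 0 is
  controlled by the Robin term at \<open>L\<close> and the Dirichlet energy.\<close>

lemma coupled_dissipation:
  assumes L: "0 < L" and \<kappa>: "\<kappa> < 0" and \<gamma>: "\<gamma> < 0"
    and x: "H2_data L x gx gx' x''" and d: "H2_data L d gd gd' d''"
    and bcx: "gx' 0 = - \<kappa> * gx 0 - \<kappa> * (gd 0 + b)" "gx' L = 0" and b: "b \<le> 0"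
    and bcd: "gd' 0 = 0" "gd' L = \<gamma> * gd L"
  shows "inner (pos_part (- x)) (- x'') + - \<kappa> * (L - 1 / \<gamma>) * inner (pos_part d) d'' \<le> 0"
proof -
  \<comment> \<open>In the boundary condition, \<open>gd 0 + b\<close> splits the error at 0 into
    the excess d and the value b of the comparison solution; multiplied by p >= 0, the nonpositive b
    has the favorable sign.\<close>
  define k where "k = - \<kappa>"
  define p where "p = max (- gx 0) 0"
  define q0 where "q0 = max (gd 0) 0"
  define qL where "qL = max (gd L) 0"
  have k: "0 < k" using \<kappa> by (simp add: k_def)
  have "0 \<le> p" by (simp add: p_def)
  have "0 \<le> (max (- gx L) 0 - max (- gx 0) 0)\<^sup>2 / L" using L by simp
  then have "inner (pos_part (- x)) (- x'') \<le> p * gx' 0"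
    using H2_pos_part_inequality[OF L H2_data_uminus[OF x]] bcx(2) by (simp add: p_def)
  also have "p * gx' 0 = k * (p * gx 0 + p * gd 0 + p * b)"
    unfolding bcx(1) k_def by (simp add: algebra_simps)
  also have "\<dots> \<le> k * (- p\<^sup>2 + p * q0 + 0)"
  proof (intro mult_left_mono add_mono)
    show "p * gx 0 \<le> - p\<^sup>2" unfolding p_def by (auto simp: max_def power2_eq_square)
    show "gd 0 \<le> q0" by (simp add: q0_def)
    show "p * b \<le> 0" using \<open>0 \<le> p\<close> b by (rule mult_nonneg_nonpos)
  qed (use k \<open>0 \<le> p\<close> in auto)
  \<comment> \<open>Maximizing over p, at p = q0 / 2, eliminates the unknown boundary value of x;
    only the excess at 0 remains.\<close>
  also have "\<dots> \<le> k * q0\<^sup>2 / 4"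
  proof -
    have "0 \<le> (p - q0 / 2)\<^sup>2" by simp
    then have "- p\<^sup>2 + p * q0 + 0 \<le> q0\<^sup>2 / 4" by (simp add: power2_eq_square algebra_simps)
    from mult_left_mono[OF this, of k] k show ?thesis by simp
  qed
  finally have 1: "inner (pos_part (- x)) (- x'') \<le> k * q0\<^sup>2 / 4" .
  \<comment> \<open>C is k L + k / |\<gamma>|: the first summand pays for the Dirichlet energy, as C
    / L >= k, the second for the Robin term, as C |\<gamma>| >= k.\<close>
  define C where "C = k * (L - 1 / \<gamma>)"
  have "1 / \<gamma> < 0" using \<gamma> by simp
  then have C: "0 < C" unfolding C_def using k L by (intro mult_pos_pos) linarith+
  have "max (gd L) 0 * gd' L = \<gamma> * qL\<^sup>2"
    unfolding bcd(2) qL_def by (auto simp: max_def power2_eq_square)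
  then have "inner (pos_part d) d'' \<le> \<gamma> * qL\<^sup>2 - (qL - q0)\<^sup>2 / L"
    using H2_pos_part_inequality[OF L d] bcd(1) by (simp add: qL_def q0_def)
  then have "C * inner (pos_part d) d'' \<le> C * (\<gamma> * qL\<^sup>2 - (qL - q0)\<^sup>2 / L)"
    using C by simp
  also have "\<dots> = - ((C * - \<gamma>) * qL\<^sup>2 + (C / L) * (qL - q0)\<^sup>2)" by (simp add: algebra_simps)
  also have "\<dots> \<le> - (k * qL\<^sup>2 + k * (qL - q0)\<^sup>2)"
  proof -
    have "C * - \<gamma> = k * L * - \<gamma> + k" using \<gamma> by (simp add: C_def right_diff_distrib left_diff_distrib)
    moreover have "0 \<le> k * L * - \<gamma>" using k \<gamma> L by (intro mult_nonneg_nonneg) auto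
    ultimately have "k \<le> C * - \<gamma>" by linarith
    moreover have "k \<le> C / L"
    proof -
      have "k * L \<le> C" unfolding C_def using k \<open>1 / \<gamma> < 0\<close> by (intro mult_left_mono) linarith+
      then show ?thesis using L by (simp add: pos_le_divide_eq)
    qed
    ultimately show ?thesis
      by (intro le_imp_neg_le add_mono mult_right_mono) auto
  qed
  \<comment> \<open>The minimum over qL, at qL = q0 / 2, is k q0^2 / 2, twice the influx k q0^2 / 4
    to be absorbed.\<close>
  also have "\<dots> \<le> - (k * q0\<^sup>2 / 2)"
  proof -
    have "0 \<le> (2 * qL - q0)\<^sup>2" by simp
    then have "q0\<^sup>2 / 2 \<le> qL\<^sup>2 + (qL - q0)\<^sup>2" by (simp add: power2_eq_square algebra_simps)
    from mult_left_mono[OF this, of k] k show ?thesis by (simp add: algebra_simps)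
  qed
  finally have "C * inner (pos_part d) d'' \<le> - (k * q0\<^sup>2 / 2)" .
  moreover have "0 \<le> k * q0\<^sup>2" using k by simp
  ultimately show ?thesis using 1 unfolding C_def k_def by linarith
qed

section \<open>Decay of the Lyapunov functional along orbits\<close>

lemma continuous_on_pos_part [continuous_intros]:
  "continuous_on S f \<Longrightarrow> continuous_on S (\<lambda>x. pos_part (f x))"
  unfolding continuous_on_def by (auto intro: tendsto_pos_part)

definition eig_evolution :: "real \<Rightarrow> real \<Rightarrow> real \<Rightarrow> nat set \<Rightarrow> (nat \<Rightarrow> real) \<Rightarrow> real \<Rightarrow> L2" where
  "eig_evolution D L \<gamma> I a t = (\<Sum>i\<in>I. (a i * exp (eig_val D L \<gamma> i * t)) *\<^sub>R eig_fun L \<gamma> i)"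

lemma eig_evolution_0: "eig_evolution D L \<gamma> I a 0 = (\<Sum>i\<in>I. a i *\<^sub>R eig_fun L \<gamma> i)"
  by (simp add: eig_evolution_def)

lemma continuous_on_eig_evolution: "continuous_on S (eig_evolution D L \<gamma> I a)"
  unfolding eig_evolution_def by (intro continuous_intros)

lemma eig_evolution_right_derivative:
  "((\<lambda>h. (eig_evolution D L \<gamma> I a (t + h) - eig_evolution D L \<gamma> I a t) /\<^sub>R h) \<longlongrightarrow>
    (\<Sum>i\<in>I. (a i * exp (eig_val D L \<gamma> i * t) * eig_val D L \<gamma> i) *\<^sub>R eig_fun L \<gamma> i)) (at_right 0)"
proof -
  let ?f = "\<lambda>i t. a i * exp (eig_val D L \<gamma> i * t)"
  have "((\<lambda>h. (?f i (t + h) - ?f i t) / h) \<longlongrightarrow> ?f i t * eig_val D L \<gamma> i) (at_right 0)" for i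
  proof -
    have "DERIV (?f i) t :> ?f i t * eig_val D L \<gamma> i"
      by (auto intro!: derivative_eq_intros)
    then show ?thesis unfolding DERIV_def by (rule tendsto_mono[OF at_le, rotated]) simp
  qed
  then have "((\<lambda>h. \<Sum>i\<in>I. ((?f i (t + h) - ?f i t) / h) *\<^sub>R eig_fun L \<gamma> i) \<longlongrightarrow>
    (\<Sum>i\<in>I. (?f i t * eig_val D L \<gamma> i) *\<^sub>R eig_fun L \<gamma> i)) (at_right 0)"
    by (intro tendsto_intros)
  moreover have "(\<Sum>i\<in>I. ((?f i (t + h) - ?f i t) / h) *\<^sub>R eig_fun L \<gamma> i)
    = (eig_evolution D L \<gamma> I a (t + h) - eig_evolution D L \<gamma> I a t) /\<^sub>R h" for h
    unfolding eig_evolution_def sum_subtractf[symmetric] scaleR_sum_right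
    by (intro sum.cong refl) (simp only: scaleR_left_diff_distrib[symmetric] scaleR_scaleR divide_inverse mult.commute)
  ultimately show ?thesis by simp
qed

text \<open>The comparison class is a parameter because it moves with time along
  \<open>eig_evolution\<close>.\<close>

definition lyapunov :: "real \<Rightarrow> L2 \<Rightarrow> L2 \<times> L2 \<Rightarrow> real" where
  "lyapunov C f u = (norm (pos_part (- fst u)))\<^sup>2 + C * (norm (pos_part (snd u - f)))\<^sup>2"

context
  fixes D L \<kappa> \<gamma> :: real and T :: "real \<Rightarrow> L2 \<times> L2 \<Rightarrow> L2 \<times> L2"
  assumes D: "0 < D" and L: "0 < L" and \<kappa>: "\<kappa> < 0" and \<gamma>: "\<gamma> < 0"
    and gen: "generates_on (L2_on L \<times> L2_on L) (coupled_op D L \<kappa> \<gamma>) T"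
begin

lemma coupled_semigroup: "C0_semigroup_on (L2_on L \<times> L2_on L) T"
  using gen by (simp add: generates_on_def)

lemma coupled_generator: "generator_on (L2_on L \<times> L2_on L) T = coupled_op D L \<kappa> \<gamma>"
  using gen by (simp add: generates_on_def)

lemma L2_on_Times_subspace: "subspace (L2_on L \<times> L2_on L)"
  by (intro subspace_Times L2_on_subspace)

context
  fixes I :: "nat set" and a :: "nat \<Rightarrow> real"
  assumes I: "finite I" "I \<subseteq> {1..}" and a: "a \<in> Gamma1 L \<gamma> I" "a \<in> Gamma2 D L \<gamma> I"
begin

abbreviation "profile \<equiv> eig_evolution D L \<gamma> I a"
abbreviation "\<Phi> \<equiv> lyapunov (- \<kappa> * (L - 1 / \<gamma>))"

text \<open>For t >= 0 the weight exp (s t) is nondecreasing in s; this is where forward time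
  enters.\<close>

lemma eig_evolution_boundary_nonpos:
  assumes "0 \<le> t"
  shows "(\<Sum>i\<in>I. a i * exp (eig_val D L \<gamma> i * t) * eig_coeff L \<gamma> i) \<le> 0"
  by (rule weighted_eig_sum_nonpos[OF I(1) eig_coeff_pos[OF D L \<gamma>] a])
    (use assms in \<open>simp_all add: mult_right_mono\<close>)

text \<open>Writing the time derivative as D times a second derivative lets the profile be
  subtracted from the error: the excess again has Sobolev data with the homogeneous conditions of
  the error.\<close>

lemma eig_evolution_H2_data:
  assumes "0 \<le> t"
  obtains g g' f where "H2_data L (profile t) g g' f" "g 0 \<le> 0" "g' 0 = 0" "g' L = \<gamma> * g L"
    "(\<Sum>i\<in>I. (a i * exp (eig_val D L \<gamma> i * t) * eig_val D L \<gamma> i) *\<^sub>R eig_fun L \<gamma> i) = D *\<^sub>R f"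
proof -
  let ?b = "\<lambda>i. a i * exp (eig_val D L \<gamma> i * t)"
  obtain f g g' where f: "(\<Sum>i\<in>I. (?b i * eig_val D L \<gamma> i) *\<^sub>R eig_fun L \<gamma> i) = D *\<^sub>R f"
    and H: "H2_data L (\<Sum>i\<in>I. ?b i *\<^sub>R eig_fun L \<gamma> i) g g' f" and bc: "g' 0 = 0" "g' L = \<gamma> * g L"
    using eig_sum_in_refl_op[OF D L \<gamma> I, of ?b] unfolding mem_refl_op_iff by blast
  have "g 0 = (\<Sum>i\<in>I. ?b i * eig_coeff L \<gamma> i)"
    using point_value_eq[OF L H2_data_continuous(1)[OF H] H2_data_represents[OF H], of 0]
      point_value_eig_sum[OF L I(1)] L by simp
  then have "g 0 \<le> 0" using eig_evolution_boundary_nonpos[OF assms] by simp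
  then show thesis using that H f bc unfolding eig_evolution_def by blast
qed

text \<open>Invariance of the domain supplies Sobolev data for the orbit at time t, so the chain
  rule for both squared norms reduces the claim to the stationary estimate
  \<open>coupled_dissipation\<close>.\<close>

lemma lyapunov_right_derivative:
  assumes u: "(u, v) \<in> coupled_op D L \<kappa> \<gamma>" and t: "0 \<le> t"
  shows "\<exists>r\<le>0. ((\<lambda>h. (\<Phi> (profile (t + h)) (T (t + h) u) - \<Phi> (profile t) (T t u)) / h) \<longlongrightarrow> r) (at_right 0)"
proof -
  define C where "C = - \<kappa> * (L - 1 / \<gamma>)"
  define x where "x = (\<lambda>t. - fst (T t u))"
  define d where "d = (\<lambda>t. snd (T t u) - profile t)"
  have "(u, v) \<in> generator_on (L2_on L \<times> L2_on L) T" using u by (simp add: coupled_generator)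
  note der = semigroup_right_derivative[OF coupled_semigroup L2_on_Times_subspace this t]
    and inv = generator_invariant[OF coupled_semigroup L2_on_Times_subspace this t, unfolded coupled_generator]
  obtain x'' e'' gx gx' ge ge' where v: "T t v = (D *\<^sub>R x'', D *\<^sub>R e'')"
    and Hx: "H2_data L (fst (T t u)) gx gx' x''" and He: "H2_data L (snd (T t u)) ge ge' e''"
    and bc: "gx' 0 = - \<kappa> * gx 0 - \<kappa> * ge 0" "ge' 0 = 0" "gx' L = 0" "ge' L = \<gamma> * ge L"
    using inv unfolding mem_coupled_op_iff by blast
  obtain g g' f where HE: "H2_data L (profile t) g g' f" and g0: "g 0 \<le> 0" and bcE: "g' 0 = 0" "g' L = \<gamma> * g L"
    and derE: "(\<Sum>i\<in>I. (a i * exp (eig_val D L \<gamma> i * t) * eig_val D L \<gamma> i) *\<^sub>R eig_fun L \<gamma> i) = D *\<^sub>R f"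
    by (rule eig_evolution_H2_data[OF t])
  have diss: "inner (pos_part (x t)) (- x'') + C * inner (pos_part (d t)) (e'' - f) \<le> 0"
    unfolding C_def x_def d_def
    by (rule coupled_dissipation[OF L \<kappa> \<gamma> Hx H2_data_diff[OF He HE] _ _ g0])
      (use bc bcE in \<open>simp_all add: algebra_simps\<close>)
  have "((\<lambda>h. (x (t + h) - x t) /\<^sub>R h) \<longlongrightarrow> - (D *\<^sub>R x'')) (at_right 0)"
    using tendsto_minus[OF tendsto_fst[OF der]] unfolding v x_def by (simp add: algebra_simps)
  note dx = has_right_derivative_power2_norm_pos_part[OF this]
  have "((\<lambda>h. (d (t + h) - d t) /\<^sub>R h) \<longlongrightarrow> D *\<^sub>R e'' - D *\<^sub>R f) (at_right 0)"
    using tendsto_diff[OF tendsto_snd[OF der] eig_evolution_right_derivative[of D L \<gamma> I a t]]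
    unfolding v derE d_def by (simp add: algebra_simps)
  note dd = has_right_derivative_power2_norm_pos_part[OF this]
  define r where "r = 2 * inner (pos_part (x t)) (- (D *\<^sub>R x'')) + C * (2 * inner (pos_part (d t)) (D *\<^sub>R e'' - D *\<^sub>R f))"
  \<comment> \<open>The diffusion constant multiplies both second derivatives alike and factors out,
    so C does not depend on it.\<close>
  have "r = 2 * D * (inner (pos_part (x t)) (- x'') + C * inner (pos_part (d t)) (e'' - f))"
    by (simp add: r_def algebra_simps)
  with diss D have "r \<le> 0" by (simp add: mult_nonneg_nonpos)
  moreover have "(\<Phi> (profile (t + h)) (T (t + h) u) - \<Phi> (profile t) (T t u)) / h
    = ((norm (pos_part (x (t + h))))\<^sup>2 - (norm (pos_part (x t)))\<^sup>2) / h
      + C * (((norm (pos_part (d (t + h))))\<^sup>2 - (norm (pos_part (d t)))\<^sup>2) / h)" for h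
    unfolding lyapunov_def C_def[symmetric] x_def d_def
    by (simp add: diff_divide_distrib add_divide_distrib right_diff_distrib)
  then have "((\<lambda>h. (\<Phi> (profile (t + h)) (T (t + h) u) - \<Phi> (profile t) (T t u)) / h) \<longlongrightarrow> r) (at_right 0)"
    using tendsto_add[OF dx tendsto_mult_left[OF dd, of C]] by (simp only: r_def)
  ultimately show ?thesis by blast
qed

lemma lyapunov_nonincreasing_domain:
  assumes u: "(u, v) \<in> coupled_op D L \<kappa> \<gamma>" and t: "0 \<le> t"
  shows "\<Phi> (profile t) (T t u) \<le> \<Phi> (profile 0) (T 0 u)"
proof (rule real_nonincreasing_of_right_derivative[OF t])
  have "u \<in> L2_on L \<times> L2_on L" using u unfolding coupled_generator[symmetric] generator_on_def by blast
  then have "continuous_on {0..t} (\<lambda>t. T t u)"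
    by (rule semigroup_continuous_on[OF coupled_semigroup L2_on_Times_subspace, rotated]) (rule L2_on_Times_complete)
  then show "continuous_on {0..t} (\<lambda>t. \<Phi> (profile t) (T t u))"
    unfolding lyapunov_def by (intro continuous_intros continuous_on_eig_evolution)
qed (use lyapunov_right_derivative[OF u] in blast)

text \<open>At fixed t both sides are continuous in the initial value, \<open>T t\<close> being
  bounded, so the inequality passes to limits of points of the domain.\<close>

lemma lyapunov_nonincreasing:
  assumes u: "u \<in> L2_on L \<times> L2_on L" and t: "0 \<le> t"
  shows "\<Phi> (profile t) (T t u) \<le> \<Phi> (profile 0) u"
proof -
  obtain w where w: "\<And>n. w n \<in> Domain (coupled_op D L \<kappa> \<gamma>)" "w \<longlonglongrightarrow> u"
  proof -
    have "u \<in> closure (Domain (coupled_op D L \<kappa> \<gamma>))"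
      using L2_on_Times_subset_closure_domain[OF L] u by blast
    then show thesis using that unfolding closure_sequential by blast
  qed
  have wX: "w n \<in> L2_on L \<times> L2_on L" for n
    using w(1)[of n] unfolding coupled_generator[symmetric] generator_on_def by blast
  have Tw: "(\<lambda>n. T t (w n)) \<longlonglongrightarrow> T t u"
    by (rule semigroup_tendsto_compose[OF coupled_semigroup L2_on_Times_subspace t w(2) _ u]) (use wX in simp)
  show ?thesis
  proof (rule LIMSEQ_le)
    show "(\<lambda>n. \<Phi> (profile t) (T t (w n))) \<longlonglongrightarrow> \<Phi> (profile t) (T t u)"
      unfolding lyapunov_def by (intro tendsto_intros Tw)
    show "(\<lambda>n. \<Phi> (profile 0) (w n)) \<longlonglongrightarrow> \<Phi> (profile 0) u"
      unfolding lyapunov_def by (intro tendsto_intros w(2))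
    have "\<Phi> (profile t) (T t (w n)) \<le> \<Phi> (profile 0) (w n)" for n
      using w(1)[of n] lyapunov_nonincreasing_domain[OF _ t, of "w n"] semigroup_0[OF coupled_semigroup L2_on_Times_subspace wX[of n]]
      by (auto simp: Domain.simps)
    then show "\<exists>N. \<forall>n\<ge>N. \<Phi> (profile t) (T t (w n)) \<le> \<Phi> (profile 0) (w n)" by blast
  qed
qed

end

text \<open>Assuming only that an element f of \<open>set_F\<close> dominates e treats both kinds of
  initial errors together: f is e itself in one case and 0 in the other. A functional that starts at
  0, does not increase and is a sum of nonnegative terms forces each term to vanish.\<close>

lemma coupled_semigroup_positive:
  assumes f: "f \<in> set_F D L \<gamma>" and e: "e \<in> L2_on L" and ef: "AE z in lborel. rep_L2 e z \<le> rep_L2 f z"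
    and x: "x \<in> L2_nonneg L" and t: "0 \<le> t"
  shows "T t (x, e) \<in> L2_nonneg L \<times> L2_on L"
proof -
  obtain I a where I: "finite I" "I \<subseteq> {1..}" and a: "a \<in> Gamma1 L \<gamma> I" "a \<in> Gamma2 D L \<gamma> I"
    and f_eq: "f = (\<Sum>i\<in>I. a i *\<^sub>R eig_fun L \<gamma> i)"
    using f unfolding set_F_def by auto
  define C where "C = - \<kappa> * (L - 1 / \<gamma>)"
  have "1 / \<gamma> < 0" using \<gamma> by simp
  then have C: "0 \<le> C" unfolding C_def using \<kappa> L by (intro mult_nonneg_nonneg) linarith+
  have xX: "x \<in> L2_on L" and x0: "AE z in lborel. z \<in> {0<..<L} \<longrightarrow> 0 \<le> rep_L2 x z"
    using x by (auto simp: L2_nonneg_def)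
  have u: "(x, e) \<in> L2_on L \<times> L2_on L" using xX e by simp
  have "AE z in lborel. z \<notin> {0<..<L} \<longrightarrow> rep_L2 x z = 0" using xX by (simp add: L2_on_def)
  with x0 rep_uminus_AE[of x] have "AE z in lborel. rep_L2 (- x) z \<le> 0"
    by eventually_elim auto
  moreover have "AE z in lborel. rep_L2 (e - f) z \<le> 0"
    using ef rep_diff_AE[of e f] by eventually_elim simp
  ultimately have "lyapunov C f (x, e) = 0"
    unfolding lyapunov_def by (simp add: pos_part_eq_0_iff[THEN iffD2])
  then have "lyapunov C (eig_evolution D L \<gamma> I a t) (T t (x, e)) \<le> 0"
    using lyapunov_nonincreasing[OF I a u t] unfolding C_def eig_evolution_0 f_eq by simp
  moreover have "0 \<le> C * (norm (pos_part (snd (T t (x, e)) - eig_evolution D L \<gamma> I a t)))\<^sup>2"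
    using C by simp
  ultimately have "(norm (pos_part (- fst (T t (x, e)))))\<^sup>2 \<le> 0" unfolding lyapunov_def by linarith
  then have "pos_part (- fst (T t (x, e))) = 0" by simp
  then have "AE z in lborel. rep_L2 (- fst (T t (x, e))) z \<le> 0" by (simp only: pos_part_eq_0_iff)
  with rep_uminus_AE[of "fst (T t (x, e))"] have "AE z in lborel. 0 \<le> rep_L2 (fst (T t (x, e))) z"
    by eventually_elim simp
  moreover have "T t (x, e) \<in> L2_on L \<times> L2_on L" by (rule semigroup_in[OF coupled_semigroup L2_on_Times_subspace t u])
  ultimately show ?thesis by (auto simp: L2_nonneg_def mem_Times_iff)
qed

end

theorem theorem17:
  fixes D\<^sub>a L :: real
  assumes "D\<^sub>a > 0" and "L > 0"
  shows "(\<forall>\<gamma><0.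
      {lam. \<exists>w. eigenvector (refl_op D\<^sub>a L \<gamma>) lam w} = eig_val D\<^sub>a L \<gamma> ` {1..} \<and>
      (\<forall>i\<ge>1. eigenvector (refl_op D\<^sub>a L \<gamma>) (eig_val D\<^sub>a L \<gamma> i) (eig_fun L \<gamma> i) \<and>
             norm (eig_fun L \<gamma> i) = 1 \<and> eig_coeff L \<gamma> i > 0) \<and>
      set_F D\<^sub>a L \<gamma> \<subseteq> set_E D\<^sub>a L \<gamma> \<and>
      set_F D\<^sub>a L \<gamma> - L2_nonpos L \<noteq> {})
    \<and>
    (\<forall>\<kappa><0. \<forall>\<gamma><0. \<kappa> \<noteq> \<gamma> \<longrightarrow>
      (\<forall>e\<^sub>0 \<in> set_F D\<^sub>a L \<gamma> \<union> L2_nonpos L. \<forall>T.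
         generates_on (L2_on L \<times> L2_on L) (coupled_op D\<^sub>a L \<kappa> \<gamma>) T \<longrightarrow>
         (\<forall>x\<^sub>0 \<in> L2_nonneg L. \<forall>t\<ge>0. T t (x\<^sub>0, e\<^sub>0) \<in> L2_nonneg L \<times> L2_on L)))"
proof (intro conjI allI impI ballI)
  fix \<gamma> :: real assume \<gamma>: "\<gamma> < 0"
  note as = assms \<gamma>
  show "{lam. \<exists>w. eigenvector (refl_op D\<^sub>a L \<gamma>) lam w} = eig_val D\<^sub>a L \<gamma> ` {1..}"
    by (rule eigenvalues_eq[OF as])
  show "eigenvector (refl_op D\<^sub>a L \<gamma>) (eig_val D\<^sub>a L \<gamma> i) (eig_fun L \<gamma> i)" if "1 \<le> i" for i
    by (rule eigenvector_eig_fun[OF as that])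
  show "norm (eig_fun L \<gamma> i) = 1" "0 < eig_coeff L \<gamma> i" for i
    by (rule norm_eig_fun[OF as] eig_coeff_pos[OF as])+
  show "set_F D\<^sub>a L \<gamma> \<subseteq> set_E D\<^sub>a L \<gamma>" by (rule set_F_subset_set_E[OF as])
  show "set_F D\<^sub>a L \<gamma> - L2_nonpos L \<noteq> {}" by (rule set_F_not_subset_L2_nonpos[OF as])
next
  fix \<kappa> \<gamma> :: real and e\<^sub>0 x\<^sub>0 :: L2 and T :: "real \<Rightarrow> L2 \<times> L2 \<Rightarrow> L2 \<times> L2" and t :: real
  assume \<kappa>: "\<kappa> < 0" and \<gamma>: "\<gamma> < 0" and e0: "e\<^sub>0 \<in> set_F D\<^sub>a L \<gamma> \<union> L2_nonpos L"
    and gen: "generates_on (L2_on L \<times> L2_on L) (coupled_op D\<^sub>a L \<kappa> \<gamma>) T"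
    and x0: "x\<^sub>0 \<in> L2_nonneg L" and t: "0 \<le> t"
  note pos = coupled_semigroup_positive[OF assms \<kappa> \<gamma> gen _ _ _ x0 t]
  from e0 show "T t (x\<^sub>0, e\<^sub>0) \<in> L2_nonneg L \<times> L2_on L"
  proof
    assume F: "e\<^sub>0 \<in> set_F D\<^sub>a L \<gamma>"
    then have "e\<^sub>0 \<in> L2_on L" unfolding set_F_def by (auto intro: eig_sum_in_L2_on)
    then show ?thesis using pos[OF F] by simp
  next
    assume "e\<^sub>0 \<in> L2_nonpos L"
    then have e: "e\<^sub>0 \<in> L2_on L" and "AE z in lborel. z \<in> {0<..<L} \<longrightarrow> rep_L2 e\<^sub>0 z \<le> 0"
      by (auto simp: L2_nonpos_def)
    moreover have "AE z in lborel. z \<notin> {0<..<L} \<longrightarrow> rep_L2 e\<^sub>0 z = 0" using e by (simp add: L2_on_def)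
    ultimately have "AE z in lborel. rep_L2 e\<^sub>0 z \<le> rep_L2 0 z"
      using rep_zero_AE by (auto elim!: AE_mp)
    \<comment> \<open>A nonpositive error is compared with the zero element of \<open>set_F\<close>,
      whose evolution is again zero.\<close>
    then show ?thesis by (rule pos[OF zero_in_set_F[OF assms \<gamma>] e])
  qed
qed

end
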